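(* For every knot $K$ in $S^3$, $$\mathcal{J}_{\mathfrak{sl}(2),(2)}(K)\big|_{q=\exp(2\pi i/12)} \;=\; 2\,\mathcal{J}_{\mathcal{D}_4,P}(K)\;=\;2 .$$
   Context: Quantum numbers: $[m]_q=\frac{q^m-q^{-m}}{q-q^{-1}}$. All invariants are multiplicative under disjoint union, with value $1$ on the empty link (so the unknot is not normalized to $1$). Temperley–Lieb: let $s\in\mathbb{C}^*$, $q=s^2$. $TL(s)$ is the ribbon category with objects the natural numbers, morphisms $a\to b$ linear combinations of planar tangles from $a$ bottom points to $b$ top points, each closed circle being replaced by $[2]_q=q+q^{-1}$, and braiding (Kauffman bracket) $X = i s\,(\text{two vertical strands}) - i s^{-1}\,(\text{cup-cap})$, where $X$ is the crossing whose over-strand runs from lower left to upper right (a positive crossing when both strands are oriented upward). $f^{(m)}\in \mathrm{End}(m)$ is the Jones–Wenzl projection: the unique nonzero idempotent killed by all caps and cups on adjacent strands. Colored Jones polynomial: $\mathcal{J}_{\mathfrak{sl}(2),(k)}(L)=(i^{k^2}s^{k^2+2k})^{-\mathrm{writhe}(L)}$ times the value in $TL(s)$ of the blackboard $k$-cable of a diagram of $L$ with $f^{(k)}$ inserted on each component. For even $k$ it depends only on $q$. The $\mathcal{D}_{2n}$ planar algebra ($n\ge 2$): put $q=\exp(\frac{2\pi i}{8n-4})$. $\mathcal{D}_{2n}$ is the unshaded planar algebra over $\mathbb{C}$ generated by one box $S$ with $4n-4$ strands and a marked boundary interval, modulo: (1) a closed circle equals $[2]_q$; (2) when $S$ is drawn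 with all strands pointing up and the marked interval on the left, bending the leftmost strand around the bottom so that it becomes the rightmost strand gives $i\cdot S$; (3) joining two adjacent strands of $S$ by a cap gives $0$; (4) the disjoint union of one copy of $S$ with all $4n-4$ strands going up and, below it, one copy with all $4n-4$ strands going down (marked intervals on the left) equals $[2n-1]_q\, f^{(4n-4)}$. Regard $S$ as an endomorphism of $2n-2$ points (marked interval on the left) and put $P=\frac12(f^{(2n-2)}+S)$, $Q=\frac12(f^{(2n-2)}-S)$; these are minimal projections. The even part $\frac12\mathcal{D}_{2n}$ (even numbers of points), with crossings resolved by the Kauffman bracket formula above ($s^2=q$), is a ribbon category. $\mathcal{J}_{\mathcal{D}_{2n},P}(L)$ is defined, for an oriented link $L$, by taking the blackboard $(2n-2)$-cable of a diagram of $L$, inserting one $P$ (in the direction of the orientation) on each component, evaluating in $\mathcal{D}_{2n}$, and multiplying by $(q^{2n(n-1)})^{-\mathrm{writhe}(L)}$. *)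

theory Defs
  imports Complex_Main
begin

section \<open>Linear combinations of planar tangles\<close>

definition qnum :: "complex \<Rightarrow> nat \<Rightarrow> complex" where
  "qnum q m = (q ^ m - inverse q ^ m) / (q - inverse q)"

text \<open>
  Formal planar diagrams, with their composites and linear combinations. Diagrams are read from
  bottom to top: in \<open>t \<odot> u\<close> the diagram \<open>t\<close> is stacked on top of \<open>u\<close>, and in \<open>t \<otimes> u\<close> it stands to
  the left of \<open>u\<close>. \<open>Box k\<close> is a generator with \<open>k\<close> boundary strands, all pointing up, its marked
  interval being on the left; every other position of a box is obtained by bending strands.
\<close>

datatype tangle =
    Strands nat
  | Cup
  | Cap
  | Box nat
  | Comp tangle tangle (infixl "\<odot>" 75)
  | Tensor tangle tangle (infixl "\<otimes>" 80)
  | Zero nat nat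
  | Add tangle tangle (infixl "\<oplus>" 65)
  | Scale complex tangle (infixr "\<cdot>" 85)

text \<open>\<open>hom K t a b\<close>: \<open>t\<close> is well-formed with \<open>a\<close> bottom and \<open>b\<close> top points, and the numbers of
  strands of its boxes lie in \<open>K\<close>.\<close>

inductive hom :: "nat set \<Rightarrow> tangle \<Rightarrow> nat \<Rightarrow> nat \<Rightarrow> bool" for K where
  hom_Strands: "hom K (Strands a) a a"
| hom_Cup: "hom K Cup 0 2"
| hom_Cap: "hom K Cap 2 0"
| hom_Box: "k \<in> K \<Longrightarrow> hom K (Box k) 0 k"
| hom_Comp: "hom K t b c \<Longrightarrow> hom K u a b \<Longrightarrow> hom K (t \<odot> u) a c"
| hom_Tensor: "hom K t a b \<Longrightarrow> hom K u a' b' \<Longrightarrow> hom K (t \<otimes> u) (a + a') (b + b')"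
| hom_Zero: "hom K (Zero a b) a b"
| hom_Add: "hom K t a b \<Longrightarrow> hom K u a b \<Longrightarrow> hom K (t \<oplus> u) a b"
| hom_Scale: "hom K t a b \<Longrightarrow> hom K (c \<cdot> t) a b"

text \<open>For \<open>t\<close> with \<open>k\<close> top points and no bottom points: bend the leftmost strand around the bottom
  of \<open>t\<close> so that it becomes the rightmost one.\<close>

definition bend :: "nat \<Rightarrow> tangle \<Rightarrow> tangle" where
  "bend k t = (Cap \<otimes> Strands k) \<odot> (Strands 1 \<otimes> t \<otimes> Strands 1) \<odot> Cup"

text \<open>
  Equality in the skein theory with generators \<open>Box k\<close> (\<open>k \<in> K\<close>), value \<open>d\<close> of a closed circle, and
  additional local relations \<open>R\<close>. The rules are: congruence; vector space and bilinearity axioms;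
  planar isotopy; the circle relation; the relations in \<open>R\<close>. Planar isotopy of diagrams in Morse
  position is generated by the axioms of a strict monoidal category (sliding distant pieces past each
  other), the two zigzag moves, and the full turn of a box.
\<close>

inductive skein_eq ::
    "nat set \<Rightarrow> complex \<Rightarrow> (tangle \<times> tangle) set \<Rightarrow> tangle \<Rightarrow> tangle \<Rightarrow> bool" for K d R where
  refl: "hom K t a b \<Longrightarrow> skein_eq K d R t t"
| sym: "skein_eq K d R t u \<Longrightarrow> skein_eq K d R u t"
| trans: "skein_eq K d R t u \<Longrightarrow> skein_eq K d R u v \<Longrightarrow> skein_eq K d R t v"
| Comp_cong: "hom K (t \<odot> u) a b \<Longrightarrow> skein_eq K d R t t' \<Longrightarrow> skein_eq K d R u u' \<Longrightarrow>
    skein_eq K d R (t \<odot> u) (t' \<odot> u')"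
| Tensor_cong: "skein_eq K d R t t' \<Longrightarrow> skein_eq K d R u u' \<Longrightarrow>
    skein_eq K d R (t \<otimes> u) (t' \<otimes> u')"
| Add_cong: "hom K (t \<oplus> u) a b \<Longrightarrow> skein_eq K d R t t' \<Longrightarrow> skein_eq K d R u u' \<Longrightarrow>
    skein_eq K d R (t \<oplus> u) (t' \<oplus> u')"
| Scale_cong: "skein_eq K d R t t' \<Longrightarrow> skein_eq K d R (c \<cdot> t) (c \<cdot> t')"

| Add_assoc: "hom K (t \<oplus> u \<oplus> v) a b \<Longrightarrow> skein_eq K d R (t \<oplus> u \<oplus> v) (t \<oplus> (u \<oplus> v))"
| Add_comm: "hom K (t \<oplus> u) a b \<Longrightarrow> skein_eq K d R (t \<oplus> u) (u \<oplus> t)"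
| Add_Zero: "hom K t a b \<Longrightarrow> skein_eq K d R (t \<oplus> Zero a b) t"
| Scale_0: "hom K t a b \<Longrightarrow> skein_eq K d R (0 \<cdot> t) (Zero a b)"
| Scale_1: "hom K t a b \<Longrightarrow> skein_eq K d R (1 \<cdot> t) t"
| Scale_Scale: "hom K t a b \<Longrightarrow> skein_eq K d R (c \<cdot> c' \<cdot> t) ((c * c') \<cdot> t)"
| Scale_add: "hom K t a b \<Longrightarrow> skein_eq K d R ((c + c') \<cdot> t) (c \<cdot> t \<oplus> c' \<cdot> t)"
| Scale_Add: "hom K (t \<oplus> u) a b \<Longrightarrow> skein_eq K d R (c \<cdot> (t \<oplus> u)) (c \<cdot> t \<oplus> c \<cdot> u)"
| Comp_Add_left: "hom K ((t \<oplus> t') \<odot> u) a b \<Longrightarrow>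
    skein_eq K d R ((t \<oplus> t') \<odot> u) (t \<odot> u \<oplus> t' \<odot> u)"
| Comp_Add_right: "hom K (t \<odot> (u \<oplus> u')) a b \<Longrightarrow>
    skein_eq K d R (t \<odot> (u \<oplus> u')) (t \<odot> u \<oplus> t \<odot> u')"
| Comp_Scale_left: "hom K (t \<odot> u) a b \<Longrightarrow> skein_eq K d R (c \<cdot> t \<odot> u) (c \<cdot> (t \<odot> u))"
| Comp_Scale_right: "hom K (t \<odot> u) a b \<Longrightarrow> skein_eq K d R (t \<odot> c \<cdot> u) (c \<cdot> (t \<odot> u))"
| Tensor_Add_left: "hom K ((t \<oplus> t') \<otimes> u) a b \<Longrightarrow>
    skein_eq K d R ((t \<oplus> t') \<otimes> u) (t \<otimes> u \<oplus> t' \<otimes> u)"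
| Tensor_Add_right: "hom K (t \<otimes> (u \<oplus> u')) a b \<Longrightarrow>
    skein_eq K d R (t \<otimes> (u \<oplus> u')) (t \<otimes> u \<oplus> t \<otimes> u')"
| Tensor_Scale_left: "hom K (t \<otimes> u) a b \<Longrightarrow> skein_eq K d R ((c \<cdot> t) \<otimes> u) (c \<cdot> (t \<otimes> u))"
| Tensor_Scale_right: "hom K (t \<otimes> u) a b \<Longrightarrow> skein_eq K d R (t \<otimes> (c \<cdot> u)) (c \<cdot> (t \<otimes> u))"

| Comp_assoc: "hom K (t \<odot> u \<odot> v) a b \<Longrightarrow> skein_eq K d R (t \<odot> u \<odot> v) (t \<odot> (u \<odot> v))"
| Comp_Strands_left: "hom K t a b \<Longrightarrow> skein_eq K d R (Strands b \<odot> t) t"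
| Comp_Strands_right: "hom K t a b \<Longrightarrow> skein_eq K d R (t \<odot> Strands a) t"
| Tensor_assoc: "hom K (t \<otimes> u \<otimes> v) a b \<Longrightarrow> skein_eq K d R (t \<otimes> u \<otimes> v) (t \<otimes> (u \<otimes> v))"
| Tensor_empty_left: "hom K t a b \<Longrightarrow> skein_eq K d R (Strands 0 \<otimes> t) t"
| Tensor_empty_right: "hom K t a b \<Longrightarrow> skein_eq K d R (t \<otimes> Strands 0) t"
| Tensor_Strands: "skein_eq K d R (Strands a \<otimes> Strands b) (Strands (a + b))"
| interchange: "hom K ((t \<odot> u) \<otimes> (t' \<odot> u')) a b \<Longrightarrow>
    skein_eq K d R ((t \<odot> u) \<otimes> (t' \<odot> u')) ((t \<otimes> t') \<odot> (u \<otimes> u'))"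
| zigzag_left: "skein_eq K d R ((Cap \<otimes> Strands 1) \<odot> (Strands 1 \<otimes> Cup)) (Strands 1)"
| zigzag_right: "skein_eq K d R ((Strands 1 \<otimes> Cap) \<odot> (Cup \<otimes> Strands 1)) (Strands 1)"
| full_turn: "k \<in> K \<Longrightarrow> skein_eq K d R ((bend k ^^ k) (Box k)) (Box k)"

| circle: "skein_eq K d R (Cap \<odot> Cup) (d \<cdot> Strands 0)"
| relation: "(t, u) \<in> R \<Longrightarrow> hom K t a b \<Longrightarrow> hom K u a b \<Longrightarrow> skein_eq K d R t u"

text \<open>Value of a closed diagram, as a multiple of the empty diagram.\<close>

definition skein_value ::
    "nat set \<Rightarrow> complex \<Rightarrow> (tangle \<times> tangle) set \<Rightarrow> tangle \<Rightarrow> complex" where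
  "skein_value K d R t = (THE c. skein_eq K d R t (c \<cdot> Strands 0))"

primrec nested_cups :: "nat \<Rightarrow> tangle" where
  "nested_cups 0 = Strands 0"
| "nested_cups (Suc k) = (Strands k \<otimes> Cup \<otimes> Strands k) \<odot> nested_cups k"

primrec nested_caps :: "nat \<Rightarrow> tangle" where
  "nested_caps 0 = Strands 0"
| "nested_caps (Suc k) = nested_caps k \<odot> (Strands k \<otimes> Cap \<otimes> Strands k)"

text \<open>Rotation of an endomorphism of \<open>k\<close> points by a half turn.\<close>

definition half_turn :: "nat \<Rightarrow> tangle \<Rightarrow> tangle" where
  "half_turn k t = (Strands k \<otimes> nested_caps k) \<odot> (Strands k \<otimes> t \<otimes> Strands k)
     \<odot> (nested_cups k \<otimes> Strands k)"


section \<open>Temperley--Lieb and the Jones--Wenzl projections\<close>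

abbreviation TL_eq :: "complex \<Rightarrow> tangle \<Rightarrow> tangle \<Rightarrow> bool" where
  "TL_eq q \<equiv> skein_eq {} (q + inverse q) {}"

abbreviation TL_value :: "complex \<Rightarrow> tangle \<Rightarrow> complex" where
  "TL_value q \<equiv> skein_value {} (q + inverse q) {}"

definition is_jones_wenzl :: "complex \<Rightarrow> nat \<Rightarrow> tangle \<Rightarrow> bool" where
  "is_jones_wenzl q m f \<longleftrightarrow>
     hom {} f m m \<and> \<not> TL_eq q f (Zero m m) \<and> TL_eq q (f \<odot> f) f \<and>
     (\<forall>i j. i + 2 + j = m \<longrightarrow>
        TL_eq q ((Strands i \<otimes> Cap \<otimes> Strands j) \<odot> f) (Zero m (m - 2)) \<and>
        TL_eq q (f \<odot> (Strands i \<otimes> Cup \<otimes> Strands j)) (Zero (m - 2) m))"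

text \<open>The projection is unique as a morphism, that is up to \<open>TL_eq q\<close>; we pick a representative.\<close>

definition jones_wenzl :: "complex \<Rightarrow> nat \<Rightarrow> tangle" where
  "jones_wenzl q m = (SOME f. is_jones_wenzl q m f)"


section \<open>The \<open>D\<^sub>2\<^sub>n\<close> planar algebra\<close>

definition q_D :: "nat \<Rightarrow> complex" where
  "q_D n = exp (2 * of_real pi * \<i> / of_nat (8 * n - 4))"

definition S_up :: "nat \<Rightarrow> tangle" where
  "S_up n = Box (4 * n - 4)"

text \<open>\<open>S\<close> with all strands pointing down; bending them down on either side gives the same element,
  since the two results differ by a full turn.\<close>

definition S_down :: "nat \<Rightarrow> tangle" where
  "S_down n = nested_caps (4 * n - 4) \<odot> (S_up n \<otimes> Strands (4 * n - 4))"

text \<open>\<open>S\<close> as an endomorphism of \<open>2n - 2\<close> points, marked interval on the left: the last half of its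
  strands is bent down on the right.\<close>

definition S_end :: "nat \<Rightarrow> tangle" where
  "S_end n = (Strands (2 * n - 2) \<otimes> nested_caps (2 * n - 2)) \<odot> (S_up n \<otimes> Strands (2 * n - 2))"

definition D_relations :: "nat \<Rightarrow> (tangle \<times> tangle) set" where
  "D_relations n =
     {(bend (4 * n - 4) (S_up n), \<i> \<cdot> S_up n)}
     \<union> {((Strands i \<otimes> Cap \<otimes> Strands j) \<odot> S_up n, Zero 0 (i + j)) |i j. i + 2 + j = 4 * n - 4}
     \<union> {(S_up n \<odot> S_down n, qnum (q_D n) (2 * n - 1) \<cdot> jones_wenzl (q_D n) (4 * n - 4))}"

abbreviation D_eq :: "nat \<Rightarrow> tangle \<Rightarrow> tangle \<Rightarrow> bool" where
  "D_eq n \<equiv> skein_eq {4 * n - 4} (qnum (q_D n) 2) (D_relations n)"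

abbreviation D_value :: "nat \<Rightarrow> tangle \<Rightarrow> complex" where
  "D_value n \<equiv> skein_value {4 * n - 4} (qnum (q_D n) 2) (D_relations n)"

definition P_D :: "nat \<Rightarrow> tangle" where
  "P_D n = (1 / 2) \<cdot> (jones_wenzl (q_D n) (2 * n - 2) \<oplus> S_end n)"


section \<open>Oriented link diagrams\<close>

text \<open>
  A link diagram in Morse position is a list of slices, read from bottom to top. Between two slices
  there is a row of strands, recorded by the list of their orientations (\<open>True\<close> for upward).
  \<open>CupAt i u\<close> creates two strands at positions \<open>i\<close> and \<open>i + 1\<close>, the left one with orientation \<open>u\<close>.
  In \<open>CrossAt i b\<close> the strand running from lower left to upper right is the over-strand iff \<open>b\<close>.
\<close>

datatype slice = CupAt nat bool | CapAt nat | CrossAt nat bool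

type_synonym diagram = "slice list"

fun fits :: "slice \<Rightarrow> bool list \<Rightarrow> bool" where
  "fits (CupAt i u) w \<longleftrightarrow> i \<le> length w"
| "fits (CapAt i) w \<longleftrightarrow> Suc i < length w \<and> w ! i \<noteq> w ! Suc i"
| "fits (CrossAt i b) w \<longleftrightarrow> Suc i < length w"

fun next_row :: "slice \<Rightarrow> bool list \<Rightarrow> bool list" where
  "next_row (CupAt i u) w = take i w @ [u, \<not> u] @ drop i w"
| "next_row (CapAt i) w = take i w @ drop (i + 2) w"
| "next_row (CrossAt i b) w = take i w @ [w ! Suc i, w ! i] @ drop (i + 2) w"

definition row :: "diagram \<Rightarrow> nat \<Rightarrow> bool list" where
  "row D j = fold next_row (take j D) []"

definition link_diagram :: "diagram \<Rightarrow> bool" where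
  "link_diagram D \<longleftrightarrow> (\<forall>j < length D. fits (D ! j) (row D j)) \<and> row D (length D) = []"

text \<open>The point \<open>(j, p)\<close> lies on the strand at position \<open>p\<close> of row \<open>j\<close>.\<close>

definition points :: "diagram \<Rightarrow> (nat \<times> nat) set" where
  "points D = {(j, p). j \<le> length D \<and> p < length (row D j)}"

fun slice_arc :: "slice \<Rightarrow> nat \<Rightarrow> nat \<times> nat \<Rightarrow> nat \<times> nat \<Rightarrow> bool" where
  "slice_arc (CupAt i u) j x y \<longleftrightarrow>
     x = (Suc j, i) \<and> y = (Suc j, Suc i)
     \<or> (\<exists>p < i. x = (j, p) \<and> y = (Suc j, p))
     \<or> (\<exists>p \<ge> i. x = (j, p) \<and> y = (Suc j, p + 2))"
| "slice_arc (CapAt i) j x y \<longleftrightarrow>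
     x = (j, i) \<and> y = (j, Suc i)
     \<or> (\<exists>p < i. x = (j, p) \<and> y = (Suc j, p))
     \<or> (\<exists>p \<ge> i. x = (j, p + 2) \<and> y = (Suc j, p))"
| "slice_arc (CrossAt i b) j x y \<longleftrightarrow>
     x = (j, i) \<and> y = (Suc j, Suc i)
     \<or> x = (j, Suc i) \<and> y = (Suc j, i)
     \<or> (\<exists>p. p \<noteq> i \<and> p \<noteq> Suc i \<and> x = (j, p) \<and> y = (Suc j, p))"

definition arcs :: "diagram \<Rightarrow> ((nat \<times> nat) \<times> (nat \<times> nat)) set" where
  "arcs D = {(x, y). x \<in> points D \<and> y \<in> points D \<and> (\<exists>j < length D. slice_arc (D ! j) j x y)}"

definition components :: "diagram \<Rightarrow> (nat \<times> nat) set set" where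
  "components D = points D // ((arcs D \<union> (arcs D)\<inverse>)\<^sup>*)"

definition knot_diagram :: "diagram \<Rightarrow> bool" where
  "knot_diagram D \<longleftrightarrow> link_diagram D \<and> card (components D) = 1"

definition base_points :: "diagram \<Rightarrow> (nat \<times> nat) set \<Rightarrow> bool" where
  "base_points D B \<longleftrightarrow> B \<subseteq> points D \<and> (\<forall>C \<in> components D. \<exists>!x. x \<in> B \<inter> C)"

fun crossing_sign :: "slice \<Rightarrow> bool list \<Rightarrow> int" where
  "crossing_sign (CrossAt i b) w = (if b = (w ! i = w ! Suc i) then 1 else - 1)"
| "crossing_sign (CupAt i u) w = 0"
| "crossing_sign (CapAt i) w = 0"

definition writhe :: "diagram \<Rightarrow> int" where
  "writhe D = (\<Sum>j<length D. crossing_sign (D ! j) (row D j))"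


section \<open>Cabled diagrams\<close>

text \<open>The crossing of \<open>TL(s)\<close> whose over-strand runs from lower left to upper right, and its inverse,
  which is also its rotation by a quarter turn.\<close>

definition crossing :: "complex \<Rightarrow> bool \<Rightarrow> tangle" where
  "crossing s b =
     (if b then (\<i> * s) \<cdot> Strands 2 \<oplus> (- \<i> * inverse s) \<cdot> (Cup \<odot> Cap)
      else (- \<i> * inverse s) \<cdot> Strands 2 \<oplus> (\<i> * s) \<cdot> (Cup \<odot> Cap))"

text \<open>\<open>cross_one X k\<close> takes one strand from the left to the right of \<open>k\<close> strands, and
  \<open>cross_cables X l k\<close> takes \<open>l\<close> parallel strands from the left to the right of \<open>k\<close> strands.\<close>

primrec cross_one :: "tangle \<Rightarrow> nat \<Rightarrow> tangle" where
  "cross_one X 0 = Strands 1"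
| "cross_one X (Suc k) = (Strands k \<otimes> X) \<odot> (cross_one X k \<otimes> Strands 1)"

primrec cross_cables :: "tangle \<Rightarrow> nat \<Rightarrow> nat \<Rightarrow> tangle" where
  "cross_cables X 0 k = Strands k"
| "cross_cables X (Suc l) k = (cross_one X k \<otimes> Strands l) \<odot> (Strands 1 \<otimes> cross_cables X l k)"

fun cabled_slice :: "nat \<Rightarrow> complex \<Rightarrow> slice \<Rightarrow> bool list \<Rightarrow> tangle" where
  "cabled_slice k s (CupAt i u) w =
     Strands (k * i) \<otimes> nested_cups k \<otimes> Strands (k * (length w - i))"
| "cabled_slice k s (CapAt i) w =
     Strands (k * i) \<otimes> nested_caps k \<otimes> Strands (k * (length w - (i + 2)))"
| "cabled_slice k s (CrossAt i b) w =
     Strands (k * i) \<otimes> cross_cables (crossing s b) k k \<otimes> Strands (k * (length w - (i + 2)))"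

text \<open>On the \<open>j\<close>-th row, \<open>p\<close> is inserted at the points of \<open>B\<close> in the direction of the orientation.\<close>

definition cabled_row ::
    "nat \<Rightarrow> tangle \<Rightarrow> diagram \<Rightarrow> (nat \<times> nat) set \<Rightarrow> nat \<Rightarrow> tangle" where
  "cabled_row k p D B j =
     foldr (\<otimes>)
       (map (\<lambda>r. if (j, r) \<in> B then if row D j ! r then p else half_turn k p else Strands k)
         [0..<length (row D j)])
       (Strands 0)"

primrec cabled_part ::
    "nat \<Rightarrow> complex \<Rightarrow> tangle \<Rightarrow> diagram \<Rightarrow> (nat \<times> nat) set \<Rightarrow> nat \<Rightarrow> tangle" where
  "cabled_part k s p D B 0 = Strands 0"
| "cabled_part k s p D B (Suc j) =
     cabled_row k p D B (Suc j) \<odot> cabled_slice k s (D ! j) (row D j) \<odot> cabled_part k s p D B j"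

text \<open>The closed diagram obtained from the blackboard \<open>k\<close>-cable of \<open>D\<close> by inserting \<open>p\<close> at the points
  of \<open>B\<close> and resolving all crossings.\<close>

definition cabling ::
    "nat \<Rightarrow> complex \<Rightarrow> tangle \<Rightarrow> diagram \<Rightarrow> (nat \<times> nat) set \<Rightarrow> tangle" where
  "cabling k s p D B = cabled_part k s p D B (length D)"


section \<open>The invariants\<close>

text \<open>Both are computed from a link diagram \<open>D\<close> and a choice \<open>B\<close> of one point on each component, where
  the projection is inserted.\<close>

definition J_sl2 :: "nat \<Rightarrow> complex \<Rightarrow> diagram \<Rightarrow> (nat \<times> nat) set \<Rightarrow> complex" where
  "J_sl2 k s D B =
     (\<i> ^ k\<^sup>2 * s ^ (k\<^sup>2 + 2 * k)) powi (- writhe D) *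
     TL_value (s\<^sup>2) (cabling k s (jones_wenzl (s\<^sup>2) k) D B)"

text \<open>Here \<open>s\<close> is a square root of \<open>q_D n\<close>.\<close>

definition J_D_P :: "nat \<Rightarrow> complex \<Rightarrow> diagram \<Rightarrow> (nat \<times> nat) set \<Rightarrow> complex" where
  "J_D_P n s D B =
     (q_D n ^ (2 * n * (n - 1))) powi (- writhe D) *
     D_value n (cabling (2 * n - 2) s (P_D n) D B)"

end

theory Submission
  imports Defs "HOL-Library.Stream" "HOL-Library.Numeral_Type"
begin

text \<open>
  \<open>P\<close> is linear in the generator \<open>S\<close>, and it is inserted only once on a knot. A closed planar diagram
  with exactly one \<open>S\<close> vanishes, since some two adjacent strands of \<open>S\<close> end up capped off; hence the
  \<open>D\<^sub>4\<close> value of a knot is half its Temperley--Lieb value, and it remains to compute the latter and to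
  see that values are well defined. Both follow from a representation of the skein theory. At
  \<open>q = exp (2 \<pi> \<i> / 12)\<close> a closed circle has value \<open>sqrt 3\<close>, so the transfer operators of the three-state
  Potts model satisfy the Temperley--Lieb relations, and \<open>S\<close> acts on them through the odd function on
  \<open>\<int>/3\<close>. In this model a cabled crossing becomes the braiding of the pointed category with group
  \<open>\<int>/3\<close>: each of its two strands carries the difference of the spins on its two sides, this difference is
  transported unchanged along the whole knot, and a crossing of strands with differences \<open>a\<close>, \<open>b\<close>
  contributes \<open>q\<close> to the power \<open>4 a b\<close> or \<open>- 4 a b\<close>. The projection on two strands selects the
  differences \<open>1\<close> and \<open>2\<close>, each contributing \<open>q\<close> to the power \<open>4 writhe\<close>, which the framing correction cancels.
\<close>

section \<open>The three-state Potts model\<close>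

text \<open>Both values are definite descriptions and the Jones--Wenzl projection is a Hilbert
  choice, so nothing can be read off before existence and uniqueness are settled. Existence of a
  value comes from normal forms: box-free closed tangles reduce to multiples of the empty one.
  Uniqueness is a consistency statement, since the relations might collapse everything to zero; this
  is what a model is needed for. The delicate relation is the one for
  \<open>S_up 2 \<odot> S_down 2\<close>, whose right side contains the chosen projection on four
  strands. Expanding that projection is avoided: it annihilates cups and fixes every vector killed
  by all caps, so splitting an arbitrary vector explicitly into a box part and three cup parts
  determines its operator. In the evaluation the projection constrains the spins at the base point
  only; forcing the same colour at all other points leaves one term per slice, and the state sum
  becomes a product of crossing phases.\<close>

primrec bots :: "tangle \<Rightarrow> nat" where
  "bots (Strands a) = a"
| "bots Cup = 0"
| "bots Cap = 2"
| "bots (Box k) = 0"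
| "bots (t \<odot> u) = bots u"
| "bots (t \<otimes> u) = bots t + bots u"
| "bots (Zero a b) = a"
| "bots (t \<oplus> u) = bots t"
| "bots (c \<cdot> t) = bots t"

primrec tops :: "tangle \<Rightarrow> nat" where
  "tops (Strands a) = a"
| "tops Cup = 2"
| "tops Cap = 0"
| "tops (Box k) = k"
| "tops (t \<odot> u) = tops t"
| "tops (t \<otimes> u) = tops t + tops u"
| "tops (Zero a b) = b"
| "tops (t \<oplus> u) = tops t"
| "tops (c \<cdot> t) = tops t"

primrec typed :: "nat set \<Rightarrow> tangle \<Rightarrow> bool" where
  "typed K (Strands a) = True"
| "typed K Cup = True"
| "typed K Cap = True"
| "typed K (Box k) \<longleftrightarrow> k \<in> K"
| "typed K (t \<odot> u) \<longleftrightarrow> typed K t \<and> typed K u \<and> bots t = tops u"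
| "typed K (t \<otimes> u) \<longleftrightarrow> typed K t \<and> typed K u"
| "typed K (Zero a b) = True"
| "typed K (t \<oplus> u) \<longleftrightarrow> typed K t \<and> typed K u \<and> bots t = bots u \<and> tops t = tops u"
| "typed K (c \<cdot> t) \<longleftrightarrow> typed K t"

text \<open>The syntax determines both boundary numbers, so \<open>hom\<close> reduces to computable
  functions and side conditions on shapes become simplifier goals.\<close>

lemma hom_iff: "hom K t a b \<longleftrightarrow> typed K t \<and> bots t = a \<and> tops t = b"
proof
  show "hom K t a b \<Longrightarrow> typed K t \<and> bots t = a \<and> tops t = b"
    by (induction rule: hom.induct) auto
  have "typed K t \<Longrightarrow> hom K t (bots t) (tops t)"
  proof (induction t)
    case (Comp t u)
    then show ?case by (auto intro: hom_Comp)
  next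
    case (Add t u)
    then show ?case by (auto intro!: hom_Add)
  qed (auto intro: hom.intros)
  then show "typed K t \<and> bots t = a \<and> tops t = b \<Longrightarrow> hom K t a b" by auto
qed

lemma bend_type:
  "typed K t \<Longrightarrow> bots t = 0 \<Longrightarrow> tops t = k \<Longrightarrow> typed K (bend k t) \<and> bots (bend k t) = 0 \<and> tops (bend k t) = k"
  by (simp add: bend_def)

lemma skein_eq_type:
  "skein_eq K d R t u \<Longrightarrow> typed K t \<and> typed K u \<and> bots t = bots u \<and> tops t = tops u"
proof (induction rule: skein_eq.induct)
  case (full_turn k)
  have "typed K ((bend k ^^ n) (Box k)) \<and> bots ((bend k ^^ n) (Box k)) = 0 \<and> tops ((bend k ^^ n) (Box k)) = k" for n
    by (induction n) (use full_turn bend_type in auto)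
  then show ?case using full_turn by auto
qed (auto simp: hom_iff)

text \<open>
  The regions of a row of strands are alternately coloured by a spin in \<open>\<int>/3\<close> and left plain. A stream
  \<open>p\<close> records the spins from left to right. The region at position \<open>m\<close> carries the spin \<open>p !! (m div 2)\<close>
  if \<open>m\<close> is even, and is plain, to the right of that spin, if \<open>m\<close> is odd. \<open>potts t m\<close> is the operator of \<open>t\<close>
  when the region on its left has position \<open>m\<close>; \<open>lift\<close> adds one more spin on the left.
\<close>

definition lift :: "(('a stream \<Rightarrow> complex) \<Rightarrow> 'a stream \<Rightarrow> complex) \<Rightarrow> ('a stream \<Rightarrow> complex) \<Rightarrow> 'a stream \<Rightarrow> complex" where
  "lift F \<psi> p = F (\<lambda>q. \<psi> (shd p ## q)) (stl p)"

fun shifted :: "(('a stream \<Rightarrow> complex) \<Rightarrow> 'a stream \<Rightarrow> complex) \<Rightarrow> (('a stream \<Rightarrow> complex) \<Rightarrow> 'a stream \<Rightarrow> complex)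
    \<Rightarrow> nat \<Rightarrow> ('a stream \<Rightarrow> complex) \<Rightarrow> 'a stream \<Rightarrow> complex" where
  "shifted F G 0 = F"
| "shifted F G (Suc 0) = G"
| "shifted F G (Suc (Suc m)) = lift (shifted F G m)"

definition r3 :: complex where "r3 = complex_of_real (sqrt 3)"
definition fourth_root_3 :: complex where "fourth_root_3 = complex_of_real (sqrt (sqrt 3))"

lemma r3_sq: "r3 * r3 = 3"
  by (simp add: r3_def flip: of_real_mult)

lemma fourth_root_3_sq: "fourth_root_3 * fourth_root_3 = r3"
  by (simp add: r3_def fourth_root_3_def flip: of_real_mult)

lemma r3_nz [simp]: "r3 \<noteq> 0" and fourth_root_3_nz [simp]: "fourth_root_3 \<noteq> 0"
  by (simp_all add: r3_def fourth_root_3_def)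

lemma UNIV_3: "(UNIV :: 3 set) = {0, 1, 2}"
proof -
  have "card {0, 1, 2 :: 3} = 3" by simp
  then have "card {0, 1, 2 :: 3} = card (UNIV :: 3 set)" by simp
  then show ?thesis by (metis card_subset_eq finite subset_UNIV)
qed

lemma sum_3: "(\<Sum>x\<in>UNIV. f (x :: 3)) = f 0 + f 1 + f 2"
  unfolding UNIV_3 by (simp add: add.assoc)

lemma exhaust_3': obtains "x = (0::3)" | "x = 1" | "x = 2"
  by (metis UNIV_3 UNIV_I insertE singletonD)

text \<open>Oddness fits the rotation eigenvalue \<i>: turning the box by two strands reverses the
  difference of spins and must give the square of \<i>, which is -1. As \<open>chi 0 = 0\<close> and
  the three values add up to 0, every cap kills the box.\<close>

definition chi :: "3 \<Rightarrow> complex" where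
  "chi x = (if x = 1 then 1 else if x = 2 then - 1 else 0)"

lemma chi_swap: "chi (y - x) = - chi (x - y)"
proof -
  have "chi (- z) = - chi z" for z
    by (rule exhaust_3'[of z]) (simp_all add: chi_def)
  from this[of "x - y"] show ?thesis by simp
qed

text \<open>The weights are forced: \<open>cap0\<close> after \<open>cup0\<close> must give
  \<open>r3\<close>, \<open>cap1\<close> after \<open>cup1\<close> must give \<open>r3\<close>
  although it sums over three spins, and the zigzags pair \<open>cup0\<close> with
  \<open>cap1\<close> and \<open>cup1\<close> with \<open>cap0\<close>, so that these weights are
  inverse to each other.\<close>

definition cup0 :: "(3 stream \<Rightarrow> complex) \<Rightarrow> 3 stream \<Rightarrow> complex" where
  "cup0 \<psi> p = (if shd p = shd (stl p) then fourth_root_3 * \<psi> (stl p) else 0)"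
definition cup1 :: "(3 stream \<Rightarrow> complex) \<Rightarrow> 3 stream \<Rightarrow> complex" where
  "cup1 \<psi> p = \<psi> (shd p ## stl (stl p)) / fourth_root_3"
definition cap0 :: "(3 stream \<Rightarrow> complex) \<Rightarrow> 3 stream \<Rightarrow> complex" where
  "cap0 \<psi> p = fourth_root_3 * \<psi> (shd p ## p)"
definition cap1 :: "(3 stream \<Rightarrow> complex) \<Rightarrow> 3 stream \<Rightarrow> complex" where
  "cap1 \<psi> p = (\<Sum>x\<in>UNIV. \<psi> (shd p ## x ## stl p)) / fourth_root_3"

text \<open>The ratio \<open>\<i> / r3\<close> of the two weights is forced by the rotation eigenvalue \<open>\<i>\<close> of the box.\<close>

definition box0 :: "(3 stream \<Rightarrow> complex) \<Rightarrow> 3 stream \<Rightarrow> complex" where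
  "box0 \<psi> p = (if shd p = shd (stl (stl p)) then chi (shd (stl p) - shd p) * \<psi> (stl (stl p)) else 0)"
definition box1 :: "(3 stream \<Rightarrow> complex) \<Rightarrow> 3 stream \<Rightarrow> complex" where
  "box1 \<psi> p = \<i> / r3 * chi (shd (stl (stl p)) - shd (stl p)) * \<psi> (shd p ## stl (stl (stl p)))"

lemmas gen_defs = cup0_def cup1_def cap0_def cap1_def box0_def box1_def

primrec potts :: "tangle \<Rightarrow> nat \<Rightarrow> (3 stream \<Rightarrow> complex) \<Rightarrow> 3 stream \<Rightarrow> complex" where
  "potts (Strands a) m = (\<lambda>\<psi>. \<psi>)"
| "potts Cup m = shifted cup0 cup1 m"
| "potts Cap m = shifted cap0 cap1 m"
| "potts (Box k) m = shifted box0 box1 m"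
| "potts (t \<odot> u) m = potts t m \<circ> potts u m"
| "potts (t \<otimes> u) m = potts t m \<circ> potts u (m + bots t)"
| "potts (Zero a b) m = (\<lambda>\<psi> p. 0)"
| "potts (t \<oplus> u) m = (\<lambda>\<psi> p. potts t m \<psi> p + potts u m \<psi> p)"
| "potts (c \<cdot> t) m = (\<lambda>\<psi> p. c * potts t m \<psi> p)"

lemma potts_Suc_Suc: "potts t (Suc (Suc m)) = lift (potts t m)"
  by (induction t arbitrary: m) (simp_all add: lift_def fun_eq_iff)

section \<open>Linearity of the operators and their independence of spins out of reach\<close>

definition lin :: "((3 stream \<Rightarrow> complex) \<Rightarrow> 3 stream \<Rightarrow> complex) \<Rightarrow> bool" where
  "lin F \<longleftrightarrow> (\<forall>a b \<psi> \<phi>. F (\<lambda>p. a * \<psi> p + b * \<phi> p) = (\<lambda>p. a * F \<psi> p + b * F \<phi> p))"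

lemma lin_lift: "lin F \<Longrightarrow> lin (lift F)"
  by (simp add: lin_def lift_def fun_eq_iff)

lemma lin_shifted: "lin F \<Longrightarrow> lin G \<Longrightarrow> lin (shifted F G m)"
  by (induction F G m rule: shifted.induct) (auto intro: lin_lift)

lemma lin_potts: "lin (potts t m)"
proof (induction t arbitrary: m)
  case (Comp t u)
  from Comp(1)[of m] Comp(2)[of m] show ?case by (simp add: lin_def)
next
  case (Tensor t u)
  from Tensor(1)[of m] Tensor(2)[of "m + bots t"] show ?case by (simp add: lin_def)
next
  case (Add t u)
  from Add(1)[of m] Add(2)[of m] show ?case by (simp add: lin_def fun_eq_iff algebra_simps)
next
  case (Scale c t)
  from Scale[of m] show ?case by (simp add: lin_def fun_eq_iff algebra_simps)
qed (auto intro!: lin_shifted, auto simp: lin_def gen_defs fun_eq_iff field_simps sum_3)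

lemma potts_lin: "potts t m (\<lambda>p. a * \<psi> p + b * \<phi> p) = (\<lambda>p. a * potts t m \<psi> p + b * potts t m \<phi> p)"
  using lin_potts unfolding lin_def by blast

lemma potts_add: "potts t m (\<lambda>p. \<psi> p + \<phi> p) = (\<lambda>p. potts t m \<psi> p + potts t m \<phi> p)"
  using potts_lin[of t m 1 \<psi> 1 \<phi>] by simp

lemma potts_scale: "potts t m (\<lambda>p. a * \<psi> p) = (\<lambda>p. a * potts t m \<psi> p)"
  using potts_lin[of t m a \<psi> 0 \<psi>] by simp

lemma potts_zero: "potts t m (\<lambda>p. 0) = (\<lambda>p. 0)"
  using potts_scale[of t m 0 "\<lambda>p. 0"] by simp

text \<open>The head of the stream lies at or beyond the left side of a tangle, so no operator
  changes it and functions of it behave like scalars.\<close>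

definition keeps :: "((3 stream \<Rightarrow> complex) \<Rightarrow> 3 stream \<Rightarrow> complex) \<Rightarrow> bool" where
  "keeps F \<longleftrightarrow> (\<forall>g \<psi>. F (\<lambda>p. g (shd p) * \<psi> p) = (\<lambda>p. g (shd p) * F \<psi> p))"

lemma keeps_shifted:
  assumes "lin F" "lin G" "keeps F" "keeps G"
  shows "keeps (shifted F G m)"
proof -
  have "lin (shifted F G m) \<and> keeps (shifted F G m)"
    using assms
  proof (induction F G m rule: shifted.induct)
    case (3 F G m)
    then have l: "lin (shifted F G m)" by simp
    have "shifted F G m (\<lambda>p. a * \<psi> p) = (\<lambda>p. a * shifted F G m \<psi> p)" for a \<psi>
      using l[unfolded lin_def, rule_format, of a \<psi> 0 \<psi>] by simp
    then show ?case using l by (simp add: lin_lift) (simp add: keeps_def lift_def fun_eq_iff)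
  qed auto
  then show ?thesis ..
qed

lemma keeps_potts: "keeps (potts t m)"
proof (induction t arbitrary: m)
  case (Comp t u)
  from Comp(1)[of m] Comp(2)[of m] show ?case by (simp add: keeps_def)
next
  case (Tensor t u)
  from Tensor(1)[of m] Tensor(2)[of "m + bots t"] show ?case by (simp add: keeps_def)
next
  case (Add t u)
  from Add(1)[of m] Add(2)[of m] show ?case by (simp add: keeps_def fun_eq_iff algebra_simps)
next
  case (Scale c t)
  from Scale[of m] show ?case by (simp add: keeps_def fun_eq_iff algebra_simps)
qed (auto intro!: keeps_shifted, auto simp: lin_def keeps_def gen_defs fun_eq_iff field_simps sum_3)

lemma potts_keeps: "potts t m (\<lambda>p. g (shd p) * \<psi> p) = (\<lambda>p. g (shd p) * potts t m \<psi> p)"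
  using keeps_potts unfolding keeps_def by blast

text \<open>The indicator of one fixed head leaves the operator by \<open>keeps\<close>; hence the
  dependence of the argument on the head can be frozen at the point of evaluation.\<close>

lemma potts_shd: "potts t m (\<lambda>q. \<phi> (shd q) q) p = potts t m (\<lambda>q. \<phi> (shd p) q) p"
proof -
  have "potts t m (\<lambda>q. (if shd p = shd q then 1 else 0) * \<phi> (shd q) q) =
    potts t m (\<lambda>q. (if shd p = shd q then 1 else 0) * \<phi> (shd p) q)"
    by (rule arg_cong[where f = "potts t m"]) auto
  from fun_cong[OF this, of p] show ?thesis
    unfolding potts_keeps[where g = "\<lambda>y. if shd p = y then 1 else 0"] by simp
qed

text \<open>At a plain position the spin to the left is out of reach of the operator.\<close>

lemma potts_forgets: "potts t (Suc m) (\<lambda>q. \<psi> (x ## stl q)) p = potts t (Suc m) \<psi> (x ## stl p)"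
proof (induction t arbitrary: m \<psi> p)
  case (Comp t u)
  have "potts u (Suc m) (\<lambda>q. \<psi> (x ## stl q)) = (\<lambda>q. potts u (Suc m) \<psi> (x ## stl q))"
    using Comp(2) by blast
  then show ?case using Comp(1) by simp
next
  case (Tensor t u)
  have "potts u (Suc m + bots t) (\<lambda>q. \<psi> (x ## stl q)) = (\<lambda>q. potts u (Suc m + bots t) \<psi> (x ## stl q))"
    using Tensor(2)[of "m + bots t"] by auto
  then show ?case using Tensor(1) by simp
next
  case Cup
  show ?case by (cases m) (simp_all add: gen_defs lift_def)
next
  case Cap
  show ?case by (cases m) (simp_all add: gen_defs lift_def)
next
  case (Box k)
  show ?case by (cases m) (simp_all add: gen_defs lift_def)
qed simp_all

section \<open>Operators at disjoint positions commute\<close>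

lemma shifted_far:
  assumes F: "\<And>m \<psi>. F (potts t (m + a) \<psi>) = potts t (m + b) (F \<psi>)"
    and G: "\<And>m \<psi>. G (potts t (m + Suc a) \<psi>) = potts t (m + Suc b) (G \<psi>)"
  shows "shifted F G n (potts t (n + a + m) \<psi>) = potts t (n + b + m) (shifted F G n \<psi>)"
  using assms
proof (induction F G n arbitrary: m \<psi> rule: shifted.induct)
  case (1 F G)
  then show ?case by (simp add: add.commute[of a] add.commute[of b])
next
  case (2 F G)
  then show ?case by (simp add: add.commute[of a] add.commute[of b])
next
  case (3 F G n)
  then show ?case by (simp add: potts_Suc_Suc lift_def fun_eq_iff)
qed

text \<open>At an even position the cup ties two spins together, which is a factor in the head that
  \<open>t\<close> sees, and \<open>potts_keeps\<close> extracts it. At an odd position the new spin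
  replaces the old one as left neighbour of \<open>t\<close>, and \<open>potts_forgets\<close>
  removes the difference.\<close>

lemma cup_far: "shifted cup0 cup1 n (potts t (n + m) \<psi>) = potts t (n + 2 + m) (shifted cup0 cup1 n \<psi>)"
proof -
  have "cup0 (potts t m \<psi>) p = potts t (Suc (Suc m)) (cup0 \<psi>) p" for m \<psi> and p :: "3 stream"
  proof -
    have *: "(\<lambda>q. cup0 \<psi> (shd p ## q)) = (\<lambda>q. (if shd p = shd q then fourth_root_3 else 0) * \<psi> q)"
      by (auto simp: cup0_def)
    show ?thesis unfolding potts_Suc_Suc lift_def *
      by (subst potts_keeps[where g = "\<lambda>y. if shd p = y then fourth_root_3 else 0"]) (simp add: cup0_def)
  qed
  moreover have "cup1 (potts t (Suc m) \<psi>) p = potts t (Suc (Suc (Suc m))) (cup1 \<psi>) p" for m \<psi> and p :: "3 stream"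
  proof -
    have *: "(\<lambda>q. cup1 \<psi> (shd p ## q)) = (\<lambda>q. inverse fourth_root_3 * \<psi> (shd p ## stl q))"
      by (auto simp: cup1_def field_simps)
    show ?thesis unfolding potts_Suc_Suc lift_def * potts_scale potts_forgets by (simp add: cup1_def field_simps)
  qed
  ultimately have "cup0 (potts t (m + 0) \<psi>) = potts t (m + 2) (cup0 \<psi>)"
      "cup1 (potts t (m + Suc 0) \<psi>) = potts t (m + Suc 2) (cup1 \<psi>)" for m \<psi>
    by (simp_all add: fun_eq_iff numeral_eq_Suc)
  from shifted_far[OF this, of n m \<psi>] show ?thesis by (simp add: numeral_eq_Suc)
qed

lemma cap_far: "shifted cap0 cap1 n (potts t (n + 2 + m) \<psi>) = potts t (n + m) (shifted cap0 cap1 n \<psi>)"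
proof -
  have "cap0 (potts t (Suc (Suc m)) \<psi>) p = potts t m (cap0 \<psi>) p" for m \<psi> and p :: "3 stream"
    using potts_shd[of t m "\<lambda>x q. \<psi> (x ## q)" p]
    by (simp add: potts_Suc_Suc lift_def cap0_def[abs_def] potts_scale)
  moreover have "cap1 (potts t (Suc (Suc (Suc m))) \<psi>) p = potts t (Suc m) (cap1 \<psi>) p" for m \<psi> and p :: "3 stream"
  proof -
    have *: "potts t (Suc m) (\<lambda>q. \<psi> (shd p ## q)) (x ## stl p) = potts t (Suc m) (\<lambda>q. \<psi> (shd p ## x ## stl q)) p" for x
      using potts_forgets[of t m "\<lambda>q. \<psi> (shd p ## q)" x p] by simp
    have **: "potts t (Suc m) (\<lambda>q. \<psi> (shd q ## x ## stl q)) p = potts t (Suc m) (\<lambda>q. \<psi> (shd p ## x ## stl q)) p" for x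
      by (rule potts_shd)
    have "cap1 \<psi> = (\<lambda>q. inverse fourth_root_3 * ((\<psi> (shd q ## 0 ## stl q) + \<psi> (shd q ## 1 ## stl q)) + \<psi> (shd q ## 2 ## stl q)))"
      by (auto simp: cap1_def sum_3 field_simps)
    then show ?thesis
      by (simp add: potts_scale potts_add **) (simp add: cap1_def potts_Suc_Suc lift_def sum_3 * field_simps)
  qed
  ultimately have "cap0 (potts t (m + 2) \<psi>) = potts t (m + 0) (cap0 \<psi>)"
      "cap1 (potts t (m + Suc 2) \<psi>) = potts t (m + Suc 0) (cap1 \<psi>)" for m \<psi>
    by (simp_all add: fun_eq_iff numeral_eq_Suc)
  from shifted_far[OF this, of n m \<psi>] show ?thesis by (simp add: numeral_eq_Suc)
qed

lemma box_far: "shifted box0 box1 n (potts t (n + m) \<psi>) = potts t (n + 4 + m) (shifted box0 box1 n \<psi>)"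
proof -
  have "box0 (potts t m \<psi>) p = potts t (m + 4) (box0 \<psi>) p" for m \<psi> and p :: "3 stream"
  proof -
    have *: "(\<lambda>q. box0 \<psi> (x ## y ## q)) = (\<lambda>q. (if x = shd q then chi (y - x) else 0) * \<psi> q)" for x y
      by (auto simp: box0_def)
    show ?thesis
      by (simp add: numeral_eq_Suc potts_Suc_Suc lift_def *
        potts_keeps[where g = "\<lambda>z. if shd p = z then chi (shd (stl p) - shd p) else 0"]) (simp add: box0_def)
  qed
  moreover have "box1 (potts t (Suc m) \<psi>) p = potts t (Suc m + 4) (box1 \<psi>) p" for m \<psi> and p :: "3 stream"
  proof -
    define \<kappa> where "\<kappa> = \<i> / r3"
    have box1: "box1 \<phi> q = (\<kappa> * chi (shd (stl (stl q)) - shd (stl q))) * \<phi> (shd q ## stl (stl (stl q)))" for \<phi> q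
      by (simp add: box1_def \<kappa>_def)
    show ?thesis
      by (simp add: numeral_eq_Suc potts_Suc_Suc lift_def box1[abs_def] potts_forgets
        potts_keeps[where g = "\<lambda>z. \<kappa> * chi (z - shd (stl p))"])
  qed
  ultimately have "box0 (potts t (m + 0) \<psi>) = potts t (m + 4) (box0 \<psi>)"
      "box1 (potts t (m + Suc 0) \<psi>) = potts t (m + Suc 4) (box1 \<psi>)" for m \<psi>
    by (simp_all add: fun_eq_iff numeral_eq_Suc)
  from shifted_far[OF this, of n m \<psi>] show ?thesis by (simp add: numeral_eq_Suc)
qed

text \<open>This is the substance of the interchange law.\<close>

lemma potts_far:
  "typed {4} u \<Longrightarrow> potts u n (potts t (n + bots u + m) \<psi>) = potts t (n + tops u + m) (potts u n \<psi>)"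
proof (induction u arbitrary: n m \<psi>)
  case Cup
  then show ?case using cup_far by simp
next
  case Cap
  then show ?case using cap_far by simp
next
  case (Box k)
  then show ?case using box_far by simp
next
  case (Tensor u v)
  have "potts (u \<otimes> v) n (potts t (n + bots (u \<otimes> v) + m) \<psi>)
    = potts u n (potts v (n + bots u) (potts t (n + bots u + bots v + m) \<psi>))"
    by (simp add: add.assoc)
  also have "\<dots> = potts u n (potts t (n + bots u + (tops v + m)) (potts v (n + bots u) \<psi>))"
    using Tensor.IH(2)[of "n + bots u" m \<psi>] Tensor.prems by (simp add: add.assoc)
  also have "\<dots> = potts t (n + tops u + (tops v + m)) (potts u n (potts v (n + bots u) \<psi>))"
    using Tensor.IH(1)[of n "tops v + m"] Tensor.prems by (simp add: add.assoc)
  finally show ?case by (simp add: add.assoc)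
next
  case (Add u v)
  then show ?case by (simp add: potts_add)
qed (simp_all add: potts_scale potts_zero)

text \<open>Positions of equal parity differ by spectator spins only, so a relation is checked once
  for each of the two shadings.\<close>

lemma potts_eqI: "potts t 0 = potts u 0 \<Longrightarrow> potts t (Suc 0) = potts u (Suc 0) \<Longrightarrow> potts t m = potts u m"
  by (induction m rule: induct_nat_012) (simp_all add: potts_Suc_Suc)

lemma potts_zigzag:
  "potts ((Cap \<otimes> Strands 1) \<odot> (Strands 1 \<otimes> Cup)) m = potts (Strands 1) m"
  "potts ((Strands 1 \<otimes> Cap) \<odot> (Cup \<otimes> Strands 1)) m = potts (Strands 1) m"
  by (rule potts_eqI; force simp: fun_eq_iff lift_def gen_defs sum_divide_distrib)+

lemma potts_circle: "potts (Cap \<odot> Cup) m = potts (r3 \<cdot> Strands 0) m"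
  by (rule potts_eqI)
    (auto simp: fun_eq_iff gen_defs field_simps r3_sq fourth_root_3_sq)

lemma potts_bend: "potts (bend k t) m \<psi> = potts Cap m (potts t (Suc m) (potts Cup m \<psi>))"
  by (simp add: bend_def)

lemma potts_bend_box: "potts (bend 4 (Box 4)) m = potts (\<i> \<cdot> Box 4) m"
proof (rule potts_eqI)
  show "potts (bend 4 (Box 4)) 0 = potts (\<i> \<cdot> Box 4) 0"
    by (auto simp: fun_eq_iff potts_bend gen_defs field_simps r3_sq fourth_root_3_sq)
next
  show "potts (bend 4 (Box 4)) (Suc 0) = potts (\<i> \<cdot> Box 4) (Suc 0)"
    by (auto simp: fun_eq_iff potts_bend gen_defs field_simps r3_sq fourth_root_3_sq lift_def, subst chi_swap, simp)
qed

lemma potts_full_turn: "potts ((bend 4 ^^ 4) (Box 4)) m = potts (Box 4) m"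
proof -
  have "potts ((bend 4 ^^ n) (Box 4)) m \<psi> = (\<lambda>p. \<i> ^ n * potts (Box 4) m \<psi> p)" for n m \<psi>
  proof (induction n arbitrary: m \<psi>)
    case (Suc n)
    have "potts Cap m (potts (Box 4) (Suc m) (potts Cup m \<psi>)) = (\<lambda>p. \<i> * potts (Box 4) m \<psi> p)"
      using fun_cong[OF potts_bend_box[of m], of \<psi>] by (simp add: potts_bend del: potts.simps(2-4))
    with Suc show ?case by (simp add: potts_bend potts_scale mult_ac del: potts.simps(2-4))
  qed simp
  from this[of 4] show ?thesis by (simp add: fun_eq_iff)
qed

theorem potts_sound:
  assumes "skein_eq K r3 R t u" and K: "K \<subseteq> {4}"
    and R: "\<And>t u m. (t, u) \<in> R \<Longrightarrow> typed K t \<Longrightarrow> typed K u \<Longrightarrow> potts t m = potts u m"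
  shows "potts t m = potts u m"
  using assms(1)
proof (induction arbitrary: m rule: skein_eq.induct)
  case (Tensor_cong t t' u u')
  from skein_eq_type[OF Tensor_cong(1)] Tensor_cong(3,4) show ?case by simp
next
  case (Comp_cong t u a b t' u')
  then show ?case by simp
next
  \<comment> \<open>Among the rules of a strict monoidal category only this one has content:
    \<open>u\<close> and \<open>t'\<close> act on disjoint strands and have to change their
    order.\<close>
  case (interchange t u t' u' a b)
  have "typed K v \<Longrightarrow> typed {4} v" for v using K by (induction v) auto
  then have "typed {4} u" "bots t = tops u"
    using interchange K by (auto simp: hom_iff)
  then show ?case
    using potts_far[of u m t' 0] by (intro ext) simp
next
  case zigzag_left
  show ?case by (rule potts_zigzag)
next
  case zigzag_right
  show ?case by (rule potts_zigzag)
next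
  case (full_turn k)
  then show ?case using K potts_full_turn by auto
next
  case circle
  show ?case by (rule potts_circle)
next
  case (relation t u a b)
  then show ?case by (intro R) (auto simp: hom_iff)
qed (auto simp: hom_iff fun_eq_iff algebra_simps potts_add potts_scale potts_zero)

section \<open>Classes of tangles\<close>

text \<open>
  Calculating with classes turns skein equality into equality. The class of an ill-formed tangle is
  empty, which makes most algebraic laws unconditional.
\<close>

locale skein =
  fixes K :: "nat set" and d :: complex and R :: "(tangle \<times> tangle) set"
begin

abbreviation eqv (infix "\<approx>" 50) where "t \<approx> u \<equiv> skein_eq K d R t u"

definition cls :: "tangle \<Rightarrow> tangle set" where "cls t = {u. t \<approx> u}"

lemma typed_refl: "typed K t \<Longrightarrow> t \<approx> t"
  using refl hom_iff by blast

lemma cls_eq_iff: "typed K t \<Longrightarrow> cls t = cls u \<longleftrightarrow> t \<approx> u"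
proof
  assume "typed K t" "cls t = cls u"
  then have "t \<in> cls u" using typed_refl by (auto simp: cls_def)
  then show "t \<approx> u" unfolding cls_def by (simp add: sym)
next
  assume "t \<approx> u"
  then show "cls t = cls u" unfolding cls_def
    using sym trans by (intro Collect_cong) metis
qed

lemma cls_untyped: "\<not> typed K t \<Longrightarrow> cls t = {}"
  unfolding cls_def using skein_eq_type by auto

lemma cls_eqI: "(typed K t \<Longrightarrow> t \<approx> u) \<Longrightarrow> (typed K u \<Longrightarrow> typed K t) \<Longrightarrow> cls t = cls u"
  by (metis cls_eq_iff cls_untyped)

definition comp :: "tangle set \<Rightarrow> tangle set \<Rightarrow> tangle set" (infixr "\<star>" 75) where
  "A \<star> B = {w. \<exists>t\<in>A. \<exists>u\<in>B. t \<odot> u \<approx> w}"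
definition tens :: "tangle set \<Rightarrow> tangle set \<Rightarrow> tangle set" (infixr "\<boxtimes>" 80) where
  "A \<boxtimes> B = {w. \<exists>t\<in>A. \<exists>u\<in>B. t \<otimes> u \<approx> w}"
definition plus :: "tangle set \<Rightarrow> tangle set \<Rightarrow> tangle set" (infixr "\<boxplus>" 65) where
  "A \<boxplus> B = {w. \<exists>t\<in>A. \<exists>u\<in>B. t \<oplus> u \<approx> w}"
definition scale :: "complex \<Rightarrow> tangle set \<Rightarrow> tangle set" (infixr "\<bullet>" 85) where
  "c \<bullet> A = {w. \<exists>t\<in>A. c \<cdot> t \<approx> w}"

abbreviation S where "S a \<equiv> cls (Strands a)"
abbreviation Z where "Z a b \<equiv> cls (Zero a b)"
abbreviation cup where "cup \<equiv> cls Cup"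
abbreviation cap where "cap \<equiv> cls Cap"

lemma cls_lift:
  assumes "\<And>t' u'. t \<approx> t' \<Longrightarrow> u \<approx> u' \<Longrightarrow> f t u \<approx> f t' u'" "typed K t" "typed K u"
  shows "cls (f t u) = {w. \<exists>t'\<in>cls t. \<exists>u'\<in>cls u. f t' u' \<approx> w}"
proof (intro Set.set_eqI iffI)
  fix w assume "w \<in> cls (f t u)"
  then show "w \<in> {w. \<exists>t'\<in>cls t. \<exists>u'\<in>cls u. f t' u' \<approx> w}"
    using typed_refl[OF assms(2)] typed_refl[OF assms(3)] by (auto simp: cls_def)
next
  fix w assume "w \<in> {w. \<exists>t'\<in>cls t. \<exists>u'\<in>cls u. f t' u' \<approx> w}"
  then obtain t' u' where "t \<approx> t'" "u \<approx> u'" "f t' u' \<approx> w" by (auto simp: cls_def)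
  then show "w \<in> cls (f t u)" using assms(1) trans unfolding cls_def by blast
qed

lemma cls_comp: "cls (t \<odot> u) = cls t \<star> cls u"
proof (cases "typed K (t \<odot> u)")
  case True
  then have "t \<odot> u \<approx> t' \<odot> u'" if "t \<approx> t'" "u \<approx> u'" for t' u'
    using Comp_cong that hom_iff by blast
  from cls_lift[of t u "\<lambda>t u. t \<odot> u", OF this] show ?thesis
    using True by (simp add: comp_def)
next
  case False
  have "\<not> t' \<odot> u' \<approx> w" if "t \<approx> t'" "u \<approx> u'" for t' u' w
    using False skein_eq_type[OF that(1)] skein_eq_type[OF that(2)] skein_eq_type[of K d R "t' \<odot> u'" w] by auto
  with False show ?thesis
    by (simp add: cls_untyped) (auto simp: cls_def comp_def)
qed

lemma cls_tens: "cls (t \<otimes> u) = cls t \<boxtimes> cls u"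
proof (cases "typed K (t \<otimes> u)")
  case True
  then have "t \<otimes> u \<approx> t' \<otimes> u'" if "t \<approx> t'" "u \<approx> u'" for t' u'
    using Tensor_cong that by blast
  from cls_lift[of t u "\<lambda>t u. t \<otimes> u", OF this] show ?thesis
    using True by (simp add: tens_def)
next
  case False
  have "\<not> t' \<otimes> u' \<approx> w" if "t \<approx> t'" "u \<approx> u'" for t' u' w
    using False skein_eq_type[OF that(1)] skein_eq_type[OF that(2)] skein_eq_type[of K d R "t' \<otimes> u'" w] by auto
  with False show ?thesis
    by (simp add: cls_untyped) (auto simp: cls_def tens_def)
qed

lemma cls_plus: "cls (t \<oplus> u) = cls t \<boxplus> cls u"
proof (cases "typed K (t \<oplus> u)")
  case True
  then have "t \<oplus> u \<approx> t' \<oplus> u'" if "t \<approx> t'" "u \<approx> u'" for t' u'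
    using Add_cong that hom_iff by blast
  from cls_lift[of t u "\<lambda>t u. t \<oplus> u", OF this] show ?thesis
    using True by (simp add: plus_def)
next
  case False
  have "\<not> t' \<oplus> u' \<approx> w" if "t \<approx> t'" "u \<approx> u'" for t' u' w
    using False skein_eq_type[OF that(1)] skein_eq_type[OF that(2)] skein_eq_type[of K d R "t' \<oplus> u'" w] by auto
  with False show ?thesis
    by (simp add: cls_untyped) (auto simp: cls_def plus_def)
qed

lemma cls_scale: "cls (c \<cdot> t) = c \<bullet> cls t"
proof (cases "typed K t")
  case True
  have "c \<cdot> t \<approx> c \<cdot> t'" if "t \<approx> t'" for t'
    using Scale_cong that by blast
  \<comment> \<open>Scaling has one argument, so the binary lemma is used with a second argument
    that is ignored.\<close>
  from cls_lift[of t t "\<lambda>t u. c \<cdot> t", OF this] show ?thesis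
    using True typed_refl by (auto simp: scale_def cls_def)
next
  case False
  have "\<not> c \<cdot> t' \<approx> w" if "t \<approx> t'" for t' w
    using False skein_eq_type[OF that(1)] by auto
  with False show ?thesis
    by (simp add: cls_untyped) (auto simp: cls_def scale_def)
qed

definition ok :: "tangle set \<Rightarrow> bool" where "ok A \<longleftrightarrow> (\<exists>t. typed K t \<and> A = cls t)"
text \<open>Any representative serves, since skein equality preserves both boundary numbers.\<close>

definition dm :: "tangle set \<Rightarrow> nat" where "dm A = bots (SOME t. t \<in> A)"
definition cd :: "tangle set \<Rightarrow> nat" where "cd A = tops (SOME t. t \<in> A)"

lemma ok_cls: "typed K t \<Longrightarrow> ok (cls t)"
  by (auto simp: ok_def)

lemma dm_cls [simp]: "typed K t \<Longrightarrow> dm (cls t) = bots t"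
  and cd_cls [simp]: "typed K t \<Longrightarrow> cd (cls t) = tops t"
proof -
  assume "typed K t"
  then have "t \<in> cls t" by (simp add: cls_def typed_refl)
  then have "(SOME t'. t' \<in> cls t) \<in> cls t" by (rule someI)
  then have "t \<approx> (SOME t'. t' \<in> cls t)" by (simp add: cls_def)
  from skein_eq_type[OF this] show "dm (cls t) = bots t" "cd (cls t) = tops t"
    by (simp_all add: dm_def cd_def)
qed

lemma okE: assumes "ok A" obtains t where "typed K t" "A = cls t" "dm A = bots t" "cd A = tops t"
  using assms unfolding ok_def by auto

lemma ok_gens [simp]: "ok (S a)" "ok cup" "ok cap" "ok (Z a b)"
  by (auto intro: ok_cls)

lemma ok_comp [simp]: "ok A \<Longrightarrow> ok B \<Longrightarrow> dm A = cd B \<Longrightarrow> ok (A \<star> B)"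
  and dm_comp [simp]: "ok A \<Longrightarrow> ok B \<Longrightarrow> dm A = cd B \<Longrightarrow> dm (A \<star> B) = dm B"
  and cd_comp [simp]: "ok A \<Longrightarrow> ok B \<Longrightarrow> dm A = cd B \<Longrightarrow> cd (A \<star> B) = cd A"
  by (auto elim!: okE intro!: ok_cls simp flip: cls_comp)

lemma ok_tens [simp]: "ok A \<Longrightarrow> ok B \<Longrightarrow> ok (A \<boxtimes> B)"
  and dm_tens [simp]: "ok A \<Longrightarrow> ok B \<Longrightarrow> dm (A \<boxtimes> B) = dm A + dm B"
  and cd_tens [simp]: "ok A \<Longrightarrow> ok B \<Longrightarrow> cd (A \<boxtimes> B) = cd A + cd B"
  by (auto elim!: okE intro!: ok_cls simp flip: cls_tens)

lemma ok_plus [simp]: "ok A \<Longrightarrow> ok B \<Longrightarrow> dm A = dm B \<Longrightarrow> cd A = cd B \<Longrightarrow> ok (A \<boxplus> B)"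
  and dm_plus [simp]: "ok A \<Longrightarrow> ok B \<Longrightarrow> dm A = dm B \<Longrightarrow> cd A = cd B \<Longrightarrow> dm (A \<boxplus> B) = dm B"
  and cd_plus [simp]: "ok A \<Longrightarrow> ok B \<Longrightarrow> dm A = dm B \<Longrightarrow> cd A = cd B \<Longrightarrow> cd (A \<boxplus> B) = cd B"
  by (auto elim!: okE intro!: ok_cls simp flip: cls_plus)

lemma ok_scale [simp]: "ok A \<Longrightarrow> ok (c \<bullet> A)"
  and dm_scale [simp]: "ok A \<Longrightarrow> dm (c \<bullet> A) = dm A"
  and cd_scale [simp]: "ok A \<Longrightarrow> cd (c \<bullet> A) = cd A"
  by (auto elim!: okE intro!: ok_cls simp flip: cls_scale)

lemma comp_assoc: "ok A \<Longrightarrow> ok B \<Longrightarrow> ok C \<Longrightarrow> (A \<star> B) \<star> C = A \<star> B \<star> C"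
  by (elim okE, simp flip: cls_comp, intro cls_eqI Comp_assoc) (auto simp: hom_iff)

lemma tens_assoc: "ok A \<Longrightarrow> ok B \<Longrightarrow> ok C \<Longrightarrow> (A \<boxtimes> B) \<boxtimes> C = A \<boxtimes> B \<boxtimes> C"
  by (elim okE, simp flip: cls_tens, intro cls_eqI Tensor_assoc) (auto simp: hom_iff)

lemma S_comp [simp]: "ok A \<Longrightarrow> cd A = b \<Longrightarrow> S b \<star> A = A"
  by (elim okE, simp flip: cls_comp, intro cls_eqI Comp_Strands_left) (auto simp: hom_iff)

lemma comp_S [simp]: "ok A \<Longrightarrow> dm A = a \<Longrightarrow> A \<star> S a = A"
  by (elim okE, simp flip: cls_comp, intro cls_eqI Comp_Strands_right) (auto simp: hom_iff)

lemma S_0_tens [simp]: "ok A \<Longrightarrow> S 0 \<boxtimes> A = A"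
  by (elim okE, simp flip: cls_tens, intro cls_eqI Tensor_empty_left) (auto simp: hom_iff)

lemma tens_S_0 [simp]: "ok A \<Longrightarrow> A \<boxtimes> S 0 = A"
  by (elim okE, simp flip: cls_tens, intro cls_eqI Tensor_empty_right) (auto simp: hom_iff)

lemma S_tens_S: "S a \<boxtimes> S b = S (a + b)"
  by (simp flip: cls_tens, intro cls_eqI Tensor_Strands) auto

lemma interchange':
  "ok A \<Longrightarrow> ok B \<Longrightarrow> ok A' \<Longrightarrow> ok B' \<Longrightarrow> dm A = cd B \<Longrightarrow> dm A' = cd B' \<Longrightarrow>
    (A \<star> B) \<boxtimes> (A' \<star> B') = (A \<boxtimes> A') \<star> (B \<boxtimes> B')"
  by (elim okE, simp flip: cls_tens cls_comp, intro cls_eqI interchange) (auto simp: hom_iff)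

lemma zigzag1: "(cap \<boxtimes> S 1) \<star> (S 1 \<boxtimes> cup) = S 1"
  unfolding cls_tens[symmetric] cls_comp[symmetric] by (intro cls_eqI zigzag_left) auto

lemma zigzag2: "(S 1 \<boxtimes> cap) \<star> (cup \<boxtimes> S 1) = S 1"
  unfolding cls_tens[symmetric] cls_comp[symmetric] by (intro cls_eqI zigzag_right) auto

lemma cap_cup: "cap \<star> cup = d \<bullet> S 0"
  by (simp flip: cls_scale cls_comp, intro cls_eqI circle) auto

lemma scale_scale [simp]: "ok A \<Longrightarrow> c \<bullet> c' \<bullet> A = (c * c') \<bullet> A"
  by (elim okE, simp flip: cls_scale, intro cls_eqI Scale_Scale) (auto simp: hom_iff)

lemma scale_1 [simp]: "ok A \<Longrightarrow> 1 \<bullet> A = A"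
  by (elim okE, simp flip: cls_scale, intro cls_eqI Scale_1) (auto simp: hom_iff)

lemma scale_0 [simp]: "ok A \<Longrightarrow> 0 \<bullet> A = Z (dm A) (cd A)"
  by (elim okE, simp flip: cls_scale, intro cls_eqI Scale_0) (auto simp: hom_iff)

lemma add_scale: "ok A \<Longrightarrow> (c + c') \<bullet> A = c \<bullet> A \<boxplus> c' \<bullet> A"
  by (elim okE, simp flip: cls_scale cls_plus, intro cls_eqI Scale_add) (auto simp: hom_iff)

lemma scale_plus: "ok A \<Longrightarrow> ok B \<Longrightarrow> c \<bullet> (A \<boxplus> B) = c \<bullet> A \<boxplus> c \<bullet> B"
  by (elim okE, simp flip: cls_scale cls_plus, intro cls_eqI Scale_Add) (auto simp: hom_iff)

lemma plus_Z [simp]: "ok A \<Longrightarrow> dm A = a \<Longrightarrow> cd A = b \<Longrightarrow> A \<boxplus> Z a b = A"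
  by (elim okE, simp flip: cls_plus, intro cls_eqI Add_Zero) (auto simp: hom_iff)

lemma plus_comp: "ok A \<Longrightarrow> ok A' \<Longrightarrow> ok B \<Longrightarrow> (A \<boxplus> A') \<star> B = A \<star> B \<boxplus> A' \<star> B"
  by (elim okE, simp flip: cls_plus cls_comp, intro cls_eqI Comp_Add_left) (auto simp: hom_iff)

lemma comp_plus: "ok A \<Longrightarrow> ok B \<Longrightarrow> ok B' \<Longrightarrow> A \<star> (B \<boxplus> B') = A \<star> B \<boxplus> A \<star> B'"
  by (elim okE, simp flip: cls_plus cls_comp, intro cls_eqI Comp_Add_right) (auto simp: hom_iff)

lemma plus_tens: "ok A \<Longrightarrow> ok A' \<Longrightarrow> ok B \<Longrightarrow> (A \<boxplus> A') \<boxtimes> B = A \<boxtimes> B \<boxplus> A' \<boxtimes> B"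
  by (elim okE, simp flip: cls_plus cls_tens, intro cls_eqI Tensor_Add_left) (auto simp: hom_iff)

lemma tens_plus: "ok A \<Longrightarrow> ok B \<Longrightarrow> ok B' \<Longrightarrow> A \<boxtimes> (B \<boxplus> B') = A \<boxtimes> B \<boxplus> A \<boxtimes> B'"
  by (elim okE, simp flip: cls_plus cls_tens, intro cls_eqI Tensor_Add_right) (auto simp: hom_iff)

lemma scale_comp [simp]: "ok A \<Longrightarrow> ok B \<Longrightarrow> (c \<bullet> A) \<star> B = c \<bullet> (A \<star> B)"
  by (elim okE, simp flip: cls_scale cls_comp, intro cls_eqI Comp_Scale_left) (auto simp: hom_iff)

lemma comp_scale [simp]: "ok A \<Longrightarrow> ok B \<Longrightarrow> A \<star> c \<bullet> B = c \<bullet> (A \<star> B)"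
  by (elim okE, simp flip: cls_scale cls_comp, intro cls_eqI Comp_Scale_right) (auto simp: hom_iff)

lemma scale_tens [simp]: "ok A \<Longrightarrow> ok B \<Longrightarrow> (c \<bullet> A) \<boxtimes> B = c \<bullet> (A \<boxtimes> B)"
  by (elim okE, simp flip: cls_scale cls_tens, intro cls_eqI Tensor_Scale_left) (auto simp: hom_iff)

lemma tens_scale [simp]: "ok A \<Longrightarrow> ok B \<Longrightarrow> A \<boxtimes> c \<bullet> B = c \<bullet> (A \<boxtimes> B)"
  by (elim okE, simp flip: cls_scale cls_tens, intro cls_eqI Tensor_Scale_right) (auto simp: hom_iff)

text \<open>Zero as a multiple by the scalar 0: the absorption laws for zero then follow from the
  scalar laws.\<close>

lemma Z_scale: "Z a b = 0 \<bullet> Z a b"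
  by simp

lemma scale_Z [simp]: "c \<bullet> Z a b = Z a b"
  by (subst Z_scale, subst scale_scale) auto

lemma Z_comp [simp]: "ok A \<Longrightarrow> cd A = b \<Longrightarrow> Z b c \<star> A = Z (dm A) c"
  by (subst Z_scale, subst scale_comp) auto

lemma comp_Z [simp]: "ok A \<Longrightarrow> dm A = b \<Longrightarrow> A \<star> Z a b = Z a (cd A)"
  by (subst Z_scale, subst comp_scale) auto

lemma Z_tens [simp]: "ok A \<Longrightarrow> Z a b \<boxtimes> A = Z (a + dm A) (b + cd A)"
  by (subst Z_scale, subst scale_tens) auto

lemma tens_Z [simp]: "ok A \<Longrightarrow> A \<boxtimes> Z a b = Z (dm A + a) (cd A + b)"
  by (subst Z_scale, subst tens_scale) auto

text \<open>Whiskering by identity strands. Tangles are treated as composites of whiskered pieces,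
  so that planar isotopy amounts to sliding distant pieces, the zigzags and the circle.\<close>

definition w :: "nat \<Rightarrow> tangle set \<Rightarrow> nat \<Rightarrow> tangle set" where "w i A j = S i \<boxtimes> A \<boxtimes> S j"

lemma ok_w [simp]: "ok A \<Longrightarrow> ok (w i A j)"
  and dm_w [simp]: "ok A \<Longrightarrow> dm (w i A j) = i + dm A + j"
  and cd_w [simp]: "ok A \<Longrightarrow> cd (w i A j) = i + cd A + j"
  by (auto simp: w_def)

lemma w_0_0 [simp]: "ok A \<Longrightarrow> w 0 A 0 = A"
  by (simp add: w_def)

lemma w_w [simp]: "ok A \<Longrightarrow> w i (w i' A j') j = w (i + i') A (j' + j)"
  unfolding w_def by (simp add: tens_assoc S_tens_S flip: tens_assoc[of "S i" "S i'"])

lemma w_S [simp]: "w i (S n) j = S (i + n + j)"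
  by (simp add: w_def S_tens_S add.assoc)

lemma w_Z [simp]: "w i (Z a b) j = Z (i + a + j) (i + b + j)"
  by (simp add: w_def add.assoc)

lemma w_plus: "ok A \<Longrightarrow> ok B \<Longrightarrow> dm A = dm B \<Longrightarrow> cd A = cd B \<Longrightarrow> w i (A \<boxplus> B) j = w i A j \<boxplus> w i B j"
  by (simp add: w_def plus_tens tens_plus)

lemma w_scale [simp]: "ok A \<Longrightarrow> w i (c \<bullet> A) j = c \<bullet> w i A j"
  by (simp add: w_def)

lemma w_comp: "ok A \<Longrightarrow> ok B \<Longrightarrow> dm A = cd B \<Longrightarrow> w i (A \<star> B) j = w i A j \<star> w i B j"
  using interchange'[of A B "S j" "S j"] interchange'[of "S i" "S i" "A \<boxtimes> S j" "B \<boxtimes> S j"]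
  by (simp add: w_def)

lemma tens_w: "ok A \<Longrightarrow> ok B \<Longrightarrow> A \<boxtimes> B = w 0 A (cd B) \<star> w (dm A) B 0"
  using interchange'[of A "S (dm A)" "S (cd B)" B] by (simp add: w_def)

lemma tens_w': "ok A \<Longrightarrow> ok B \<Longrightarrow> A \<boxtimes> B = w (cd A) B 0 \<star> w 0 A (dm B)"
  using interchange'[of "S (cd A)" A B "S (dm B)"] by (simp add: w_def)

text \<open>This is the interchange law with \<open>j\<close> strands between the two pieces. The
  remaining widths are equational premises, so that arithmetic never obstructs matching.\<close>

lemma far:
  assumes "ok A" "ok B"
    "j1 = j + cd B + k" "i1 = i + dm A + j" "i2 = i + cd A + j" "j2 = j + dm B + k"
  shows "w i A j1 \<star> w i1 B k = w i2 B k \<star> w i A j2"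
proof -
  have "w i (w 0 A (cd (w j B k)) \<star> w (dm A) (w j B k) 0) 0 = w i (w (cd A) (w j B k) 0 \<star> w 0 A (dm (w j B k))) 0"
    using assms tens_w[of A "w j B k"] tens_w'[of A "w j B k"] by simp
  then show ?thesis using assms by (simp add: w_comp add.assoc)
qed

lemma comp_eq_comp:
  "A \<star> B = C \<Longrightarrow> ok A \<Longrightarrow> ok B \<Longrightarrow> ok X \<Longrightarrow> A \<star> B \<star> X = C \<star> X"
  by (simp add: comp_assoc[symmetric])

lemma w_0_left: "ok A \<Longrightarrow> w 0 A j = A \<boxtimes> S j" and w_0_right: "ok A \<Longrightarrow> w i A 0 = S i \<boxtimes> A"
  by (simp_all add: w_def)

lemma zigzag_left': "i' = Suc i \<Longrightarrow> j' = Suc j \<Longrightarrow> w i cap j' \<star> w i' cup j = S (i + 1 + j)"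
proof -
  have "w i (w 0 cap 1 \<star> w 1 cup 0) j = w i (S 1) j"
    using zigzag1 by (simp add: w_0_left w_0_right del: One_nat_def)
  then show "i' = Suc i \<Longrightarrow> j' = Suc j \<Longrightarrow> w i cap j' \<star> w i' cup j = S (i + 1 + j)"
    by (simp add: w_comp)
qed

lemma zigzag_right': "i' = Suc i \<Longrightarrow> j' = Suc j \<Longrightarrow> w i' cap j \<star> w i cup j' = S (i + 1 + j)"
proof -
  have "w i (w 1 cap 0 \<star> w 0 cup 1) j = w i (S 1) j"
    using zigzag2 by (simp add: w_0_left w_0_right del: One_nat_def)
  then show "i' = Suc i \<Longrightarrow> j' = Suc j \<Longrightarrow> w i' cap j \<star> w i cup j' = S (i + 1 + j)"
    by (simp add: w_comp)
qed

lemma circle': "w i cap j \<star> w i cup j = d \<bullet> S (i + j)"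
  using w_comp[of cap cup i j] by (simp add: cap_cup)

end

section \<open>Normal forms of Temperley--Lieb tangles\<close>

lemma typed_mono: "typed {} t \<Longrightarrow> typed K t"
  by (induction t) auto

context skein begin

text \<open>In a normal form all cups lie above all caps. It is built from below, so the outermost
  constructor is the topmost piece, the one that an added cap meets first.\<close>

inductive caps_only :: "nat \<Rightarrow> nat \<Rightarrow> tangle set \<Rightarrow> bool" where
  caps_only_S: "caps_only a a (S a)"
| caps_only_cap: "caps_only a (i + 2 + j) A \<Longrightarrow> caps_only a (i + j) (w i cap j \<star> A)"

inductive normal_form :: "nat \<Rightarrow> nat \<Rightarrow> tangle set \<Rightarrow> bool" where
  normal_form_pc: "caps_only a b A \<Longrightarrow> normal_form a b A"
| normal_form_cup: "normal_form a (i + j) A \<Longrightarrow> normal_form a (i + 2 + j) (w i cup j \<star> A)"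

inductive span :: "nat \<Rightarrow> nat \<Rightarrow> tangle set \<Rightarrow> bool" where
  span_nf: "normal_form a b A \<Longrightarrow> span a b A"
| span_Z: "span a b (Z a b)"
| span_plus: "span a b A \<Longrightarrow> span a b B \<Longrightarrow> span a b (A \<boxplus> B)"
| span_scale: "span a b A \<Longrightarrow> span a b (c \<bullet> A)"

text \<open>Box-free classes, in a skein theory that may have boxes: the normal forms then also
  apply to the part of a diagram around a box.\<close>

definition TL :: "tangle set \<Rightarrow> bool" where "TL A \<longleftrightarrow> (\<exists>t. typed {} t \<and> A = cls t)"

lemma TL_ok: "TL A \<Longrightarrow> ok A"
  unfolding TL_def ok_def using typed_mono by blast

lemma TL_cls: "typed {} t \<Longrightarrow> TL (cls t)"
  by (auto simp: TL_def)

lemma TL_S [simp]: "TL (S a)" "TL cup" "TL cap" "TL (Z a b)"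
  by (auto intro: TL_cls)

lemma TL_comp [simp]:
  assumes "TL A" "TL B" "dm A = cd B" shows "TL (A \<star> B)"
proof -
  obtain t u where "typed {} t" "A = cls t" "typed {} u" "B = cls u"
    using assms by (auto simp: TL_def)
  with assms(3) have "typed {} (t \<odot> u)" "A \<star> B = cls (t \<odot> u)"
    by (simp_all add: cls_comp typed_mono)
  then show ?thesis by (metis TL_cls)
qed

lemma TL_tens [simp]: "TL A \<Longrightarrow> TL B \<Longrightarrow> TL (A \<boxtimes> B)"
  unfolding TL_def using cls_tens by (metis typed.simps(6))

lemma TL_w [simp]: "TL A \<Longrightarrow> TL (w i A j)"
  by (simp add: w_def)

lemma caps_only_type: "caps_only a b A \<Longrightarrow> TL A \<and> ok A \<and> dm A = a \<and> cd A = b"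
  by (induction rule: caps_only.induct) auto

lemma normal_form_type: "normal_form a b A \<Longrightarrow> TL A \<and> ok A \<and> dm A = a \<and> cd A = b"
  by (induction rule: normal_form.induct) (auto simp: caps_only_type)

lemma span_type: "span a b A \<Longrightarrow> ok A \<and> dm A = a \<and> cd A = b"
  by (induction rule: span.induct) (auto simp: normal_form_type)

lemma span_cup: "span a (i + j) A \<Longrightarrow> span a (i + 2 + j) (w i cup j \<star> A)"
proof (induction a "i + j" A rule: span.induct)
  case (span_nf a A)
  then show ?case by (intro span.span_nf normal_form_cup)
next
  case (span_Z a)
  then show ?case using span.span_Z by simp
next
  case (span_plus a A B)
  then show ?case using span.span_plus span_type by (simp add: comp_plus)
next
  case (span_scale a A c)
  then show ?case using span.span_scale span_type by simp
qed

text \<open>The added cap meets the topmost cup. At the same position they close a circle, at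
  neighbouring positions they straighten, and otherwise the cap slides below the cup and the
  induction takes over.\<close>

lemma normal_form_cap: "normal_form a n A \<Longrightarrow> n = i + 2 + j \<Longrightarrow> span a (i + j) (w i cap j \<star> A)"
proof (induction arbitrary: i j rule: normal_form.induct)
  case (normal_form_pc a b A)
  then show ?case by (intro span.span_nf normal_form.normal_form_pc caps_only_cap) simp
next
  case (normal_form_cup a k l A)
  note A = normal_form_type[OF normal_form_cup.hyps]
  consider "i = k" | "i = Suc k" | "k = Suc i" | "k + 2 \<le> i" | "i + 2 \<le> k" by linarith
  then show ?case
  proof cases
    case 1
    then have "j = l" using normal_form_cup by simp
    then show ?thesis using 1 A normal_form_cup.hyps comp_eq_comp[OF circle'[of i j], of A]
      by (auto intro: span.intros)
  next
    case 2
    then have "l = Suc j" using normal_form_cup by simp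
    then show ?thesis using 2 A normal_form_cup.hyps comp_eq_comp[OF zigzag_right'[of i k l j], of A]
      by (auto intro: span.intros)
  next
    case 3
    then have "j = Suc l" using normal_form_cup by simp
    then show ?thesis using 3 A normal_form_cup.hyps comp_eq_comp[OF zigzag_left'[of k i j l], of A]
      by (auto intro: span.intros)
  next
    case 4
    then obtain m where i: "i = k + 2 + m" using le_iff_add by blast
    then have l: "l = m + 2 + j" using normal_form_cup by simp
    have "w k cup (m + j) \<star> w (k + m) cap j = w i cap j \<star> w k cup l"
      by (rule far[where j = m]) (simp_all add: i l)
    from comp_eq_comp[OF this[symmetric], of A]
    have "w i cap j \<star> w k cup l \<star> A = w k cup (m + j) \<star> w (k + m) cap j \<star> A"
      using A i l by (simp add: comp_assoc)
    moreover have "span a (k + m + j) (w (k + m) cap j \<star> A)"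
      using normal_form_cup.IH[of "k + m" j] l by simp
    ultimately show ?thesis
      using span_cup[of a k "m + j" "w (k + m) cap j \<star> A"] i l by (simp add: add.assoc)
  next
    case 5
    then obtain m where k: "k = i + 2 + m" using le_iff_add by blast
    then have j: "j = m + 2 + l" using normal_form_cup by simp
    have "w i cap j \<star> w k cup l = w (i + m) cup l \<star> w i cap (m + l)"
      by (rule far[where j = m]) (simp_all add: k j)
    from comp_eq_comp[OF this, of A]
    have "w i cap j \<star> w k cup l \<star> A = w (i + m) cup l \<star> w i cap (m + l) \<star> A"
      using A k j by (simp add: comp_assoc)
    moreover have "span a (i + (m + l)) (w i cap (m + l) \<star> A)"
      using normal_form_cup.IH[of i "m + l"] k by simp
    ultimately show ?thesis
      using span_cup[of a "i + m" l "w i cap (m + l) \<star> A"] k j by (simp add: add.assoc)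
  qed
qed

lemma span_cap: "span a (i + 2 + j) A \<Longrightarrow> span a (i + j) (w i cap j \<star> A)"
proof (induction a "i + 2 + j" A rule: span.induct)
  case (span_nf a A)
  then show ?case by (intro normal_form_cap) auto
next
  case (span_Z a)
  then show ?case using span.span_Z by simp
next
  case (span_plus a A B)
  then show ?case using span.span_plus span_type by (simp add: comp_plus)
next
  case (span_scale a A c)
  then show ?case using span.span_scale span_type by simp
qed

lemma span_w:
  "typed {} t \<Longrightarrow> span a (i + bots t + j) A \<Longrightarrow> span a (i + tops t + j) (w i (cls t) j \<star> A)"
proof (induction t arbitrary: i j A)
  case (Strands n)
  then show ?case using span_type by simp
next
  case Cup
  then show ?case using span_cup by simp
next
  case Cap
  then show ?case using span_cap by simp
next
  case (Comp t u)
  then have "span a (i + tops t + j) (w i (cls t) j \<star> w i (cls u) j \<star> A)" by simp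
  then show ?case using Comp.prems span_type[OF Comp.prems(2)]
    by (simp add: cls_comp w_comp comp_assoc typed_mono ok_cls)
next
  case (Tensor t u)
  have "span a (i + bots t + tops u + j) (w (i + bots t) (cls u) j \<star> A)"
    using Tensor.prems Tensor.IH(2)[of "i + bots t" j A] by (simp add: add.assoc)
  then have "span a (i + tops t + (tops u + j)) (w i (cls t) (tops u + j) \<star> w (i + bots t) (cls u) j \<star> A)"
    using Tensor.prems Tensor.IH(1)[of i "tops u + j"] by (simp add: add.assoc)
  then show ?case using Tensor.prems span_type[OF Tensor.prems(2)]
    by (simp add: cls_tens tens_w w_comp comp_assoc typed_mono ok_cls add.assoc)
next
  case (Zero a b)
  then show ?case using span_type span_Z by simp
next
  case (Add t u)
  then show ?case using span_type[OF Add.prems(2)] span_plus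
    by (simp add: cls_plus w_plus plus_comp typed_mono ok_cls)
next
  case (Scale c t)
  then show ?case using span_type[OF Scale.prems(2)] span_scale
    by (simp add: cls_scale typed_mono ok_cls)
qed simp

lemma TL_span: assumes "TL A" shows "span (dm A) (cd A) A"
proof -
  obtain t where t: "typed {} t" "A = cls t" using assms by (auto simp: TL_def)
  have "span (bots t) (0 + bots t + 0) (S (bots t))"
    using span_nf[OF normal_form_pc[OF caps_only_S]] by simp
  from span_w[OF t(1) this] show ?thesis using t by (simp add: typed_mono ok_cls)
qed

lemma caps_only_0: "caps_only a b A \<Longrightarrow> a = 0 \<Longrightarrow> b = 0 \<and> A = S 0"
  by (induction rule: caps_only.induct) auto

text \<open>A closed normal form is empty: a topmost cup would leave endpoints, and without bottom
  points there is nothing to cap. This provides the existence of values.\<close>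

lemma span_closed:
  assumes "span 0 0 A" shows "\<exists>c. A = c \<bullet> S 0"
  using assms
proof (induction a\<equiv>"0 :: nat" b\<equiv>"0 :: nat" A rule: span.induct)
  case (span_nf A)
  then have "A = S 0"
    by (cases rule: normal_form.cases) (auto dest: caps_only_0)
  then show ?case by (metis ok_gens(1) scale_1)
next
  case span_Z
  show ?case by (metis Z_scale ok_gens(1) scale_0 dm_cls cd_cls typed.simps(1) bots.simps(1) tops.simps(1))
next
  case (span_plus A B)
  then show ?case by (metis add_scale ok_gens(1))
next
  case (span_scale A c)
  then show ?case by (metis scale_scale ok_gens(1))
qed

text \<open>The \<open>k\<close> strands on the right are exempt. Wenzl's recursion adds a strand,
  and a tangle killed on one more strand has to be absorbed by the smaller projection, for which
  that strand is exempt.\<close>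

definition killed :: "nat \<Rightarrow> nat \<Rightarrow> tangle set \<Rightarrow> bool" where
  "killed n k F \<longleftrightarrow> ok F \<and> cd F = n + k \<and>
     (\<forall>i j. i + 2 + j = n \<longrightarrow> w i cap (j + k) \<star> F = Z (dm F) (i + j + k))"

definition cokilled :: "nat \<Rightarrow> nat \<Rightarrow> tangle set \<Rightarrow> bool" where
  "cokilled n k F \<longleftrightarrow> ok F \<and> dm F = n + k \<and>
     (\<forall>i j. i + 2 + j = n \<longrightarrow> F \<star> w i cup (j + k) = Z (i + j + k) (cd F))"

lemma caps_only_killed: "caps_only a b A \<Longrightarrow> A = S a \<or> (\<forall>F. killed a 0 F \<longrightarrow> A \<star> F = Z (dm F) b)"
proof (induction rule: caps_only.induct)
  case (caps_only_cap a i j A)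
  note A = caps_only_type[OF caps_only_cap.hyps]
  have "(w i cap j \<star> A) \<star> F = Z (dm F) (i + j)" if F: "killed a 0 F" for F
  proof (cases "A = S a")
    case True
    then have "a = i + 2 + j" using A by simp
    then show ?thesis using F True by (auto simp: killed_def)
  next
    case False
    then have "A \<star> F = Z (dm F) (i + 2 + j)" using caps_only_cap.IH F by blast
    then show ?thesis using F A by (simp add: comp_assoc killed_def)
  qed
  then show ?case by blast
qed simp

text \<open>A normal form that is not the identity and does not raise the number of strands has a
  cap at its bottom, which annihilates \<open>F\<close>. The exception \<open>a < b\<close> makes
  room for normal forms with cups only.\<close>

lemma normal_form_killed: "normal_form a b A \<Longrightarrow> A = S a \<or> a < b \<or> (\<forall>F. killed a 0 F \<longrightarrow> A \<star> F = Z (dm F) b)"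
proof (induction rule: normal_form.induct)
  case (normal_form_pc a b A)
  then show ?case using caps_only_killed by blast
next
  case (normal_form_cup a i j A)
  note A = normal_form_type[OF normal_form_cup.hyps]
  show ?case
  proof (cases "a < i + 2 + j")
    case False
    have "A \<noteq> S a"
    proof
      assume "A = S a"
      then have "cd A = a" by (metis cd_cls typed.simps(1) tops.simps(1))
      then show False using A False by simp
    qed
    then have "A \<star> F = Z (dm F) (i + j)" if "killed a 0 F" for F
      using normal_form_cup.IH that False by auto
    then have "(w i cup j \<star> A) \<star> F = Z (dm F) (i + 2 + j)" if "killed a 0 F" for F
      using that A by (simp add: comp_assoc killed_def)
    then show ?thesis by blast
  qed simp
qed

text \<open>Only the identity among the normal forms survives on killed tangles, so \<alpha>
  collects its coefficient.\<close>

lemma span_killed: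
  "span a b A \<Longrightarrow> a = b \<Longrightarrow> \<exists>\<alpha>. \<forall>F. killed a 0 F \<longrightarrow> A \<star> F = \<alpha> \<bullet> F"
proof (induction rule: span.induct)
  case (span_nf a b A)
  consider "A = S a" | "\<forall>F. killed a 0 F \<longrightarrow> A \<star> F = Z (dm F) b"
    using normal_form_killed[OF span_nf.hyps] span_nf.prems by auto
  then show ?case
  proof cases
    case 1
    then show ?thesis by (intro exI[of _ 1]) (auto simp: killed_def)
  next
    case 2
    then show ?thesis using span_nf.prems by (intro exI[of _ 0]) (auto simp: killed_def)
  qed
next
  case (span_Z a b)
  then show ?case by (intro exI[of _ 0]) (auto simp: killed_def)
next
  case (span_plus a b A B)
  then obtain \<alpha> \<beta> where "\<forall>F. killed a 0 F \<longrightarrow> A \<star> F = \<alpha> \<bullet> F" "\<forall>F. killed a 0 F \<longrightarrow> B \<star> F = \<beta> \<bullet> F"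
    by blast
  then show ?case using span_type[OF span_plus.hyps(1)] span_type[OF span_plus.hyps(2)]
    by (intro exI[of _ "\<alpha> + \<beta>"]) (auto simp: killed_def plus_comp add_scale)
next
  case (span_scale a b A c)
  then obtain \<alpha> where "\<forall>F. killed a 0 F \<longrightarrow> A \<star> F = \<alpha> \<bullet> F" by blast
  then show ?case using span_type[OF span_scale.hyps(1)]
    by (intro exI[of _ "c * \<alpha>"]) (auto simp: killed_def)
qed

end

section \<open>Jones--Wenzl projections\<close>

text \<open>Wenzl's recursion from \<open>n + 1\<close> to \<open>n + 2\<close> strands; the
  intended \<tau> is the ratio [n+2]/[n+1] of quantum integers.\<close>

definition wenzl :: "nat \<Rightarrow> complex \<Rightarrow> tangle \<Rightarrow> tangle" where
  "wenzl n \<tau> f = f \<otimes> Strands 1 \<oplus>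
     (- inverse \<tau>) \<cdot> ((f \<otimes> Strands 1) \<odot> (Strands n \<otimes> Cup) \<odot> (Strands n \<otimes> Cap) \<odot> (f \<otimes> Strands 1))"

context skein begin

lemma plus_uminus: "ok A \<Longrightarrow> A \<boxplus> (-1) \<bullet> A = Z (dm A) (cd A)"
  using add_scale[of A 1 "-1"] by simp

text \<open>
  \<open>f\<close> is the projection on \<open>n + 1\<close> strands, \<open>E\<close> the one on \<open>n\<close> strands, and \<open>\<tau>\<close> is the ratio of quantum
  integers appearing in the partial trace of \<open>f\<close> and in Wenzl's recursion.
\<close>

definition jw_data :: "nat \<Rightarrow> complex \<Rightarrow> tangle \<Rightarrow> tangle set \<Rightarrow> bool" where
  "jw_data n \<tau> f E \<longleftrightarrow>
     typed {} f \<and> bots f = Suc n \<and> tops f = Suc n \<and> ok E \<and> dm E = n \<and> cd E = n \<and>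
     killed (Suc n) 0 (cls f) \<and> cokilled (Suc n) 0 (cls f) \<and>
     (\<forall>k F. killed (Suc n) k F \<longrightarrow> w 0 (cls f) k \<star> F = F) \<and>
     (\<forall>k F. cokilled (Suc n) k F \<longrightarrow> F \<star> w 0 (cls f) k = F) \<and>
     w n cap 0 \<star> w 0 (cls f) 1 \<star> w n cup 0 = \<tau> \<bullet> E \<and>
     w 0 E 1 \<star> cls f = cls f \<and> cls f \<star> w 0 E 1 = cls f \<and>
     (\<forall>m \<psi>. (\<forall>i<n. potts Cap (m + i) \<psi> = (\<lambda>p. 0)) \<longrightarrow> potts f m \<psi> = \<psi>)"

lemma jw_data_0: "jw_data 0 d (Strands 1) (S 0)"
  using circle'[of 0 0] by (auto simp: jw_data_def killed_def cokilled_def)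

text \<open>The new ratio reflects [n+3]/[n+2] = [2] - [n+1]/[n+2]. Division by \<tau> is the point
  at which the recursion stops at a root of unity.\<close>

lemma jw_data_step:
  assumes jw: "jw_data n \<tau> f E" and \<tau>: "\<tau> \<noteq> 0"
  shows "jw_data (Suc n) (d - inverse \<tau>) (wenzl n \<tau> f) (cls f)"
proof -
  define g where "g = cls (wenzl n \<tau> f)"
  define F where "F = cls f"
  define c where "c = - inverse \<tau>"
  have f: "typed {} f" "bots f = Suc n" "tops f = Suc n"
    and E [simp]: "ok E" "dm E = n" "cd E = n"
    and kil: "killed (Suc n) 0 F" and cokil: "cokilled (Suc n) 0 F"
    and absl: "\<And>k X. killed (Suc n) k X \<Longrightarrow> w 0 F k \<star> X = X"
    and absr: "\<And>k X. cokilled (Suc n) k X \<Longrightarrow> X \<star> w 0 F k = X"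
    and tr: "w n cap 0 \<star> w 0 F 1 \<star> w n cup 0 = \<tau> \<bullet> E"
    and EF: "w 0 E 1 \<star> F = F" "F \<star> w 0 E 1 = F"
    and sem: "\<And>m \<psi>. (\<And>i. i < n \<Longrightarrow> potts Cap (m + i) \<psi> = (\<lambda>p. 0)) \<Longrightarrow> potts f m \<psi> = \<psi>"
    using jw unfolding jw_data_def F_def by auto
  have F [simp]: "ok F" "dm F = Suc n" "cd F = Suc n"
    unfolding F_def using f by (simp_all add: typed_mono ok_cls)
  have FF: "F \<star> F = F" using absl[OF kil] by simp
  define F1 C U where "F1 = w 0 F 1" and "C = w n cap 0" and "U = w n cup 0"
  have T1 [simp]: "ok F1" "dm F1 = n + 2" "cd F1 = n + 2" "ok C" "dm C = n + 2" "cd C = n"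
    "ok U" "dm U = n" "cd U = n + 2" by (simp_all add: F1_def C_def U_def)
  have typed_w: "typed {} (wenzl n \<tau> f)" "bots (wenzl n \<tau> f) = Suc (Suc n)" "tops (wenzl n \<tau> f) = Suc (Suc n)"
    using f by (simp_all add: wenzl_def)
  then have g [simp]: "ok g" "dm g = Suc (Suc n)" "cd g = Suc (Suc n)"
    unfolding g_def by (simp_all add: typed_mono ok_cls)
  have g_eq: "g = F1 \<boxplus> c \<bullet> (F1 \<star> U \<star> C \<star> F1)"
    by (simp add: g_def wenzl_def cls_plus cls_scale cls_comp cls_tens comp_assoc F1_def U_def C_def
        w_0_left w_0_right c_def del: One_nat_def flip: F_def)
  have CF1U: "C \<star> F1 \<star> U = \<tau> \<bullet> E" using tr by (simp add: C_def F1_def U_def)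
  have EC: "E \<star> C = C \<star> w 0 E 2"
  proof -
    have "w 0 E 0 \<star> w n cap 0 = w n cap 0 \<star> w 0 E 2" by (rule far[where j = 0]) simp_all
    then show ?thesis unfolding C_def by (simp only: w_0_0 E)
  qed
  have UE: "U \<star> E = w 0 E 2 \<star> U"
  proof -
    have "w 0 E 2 \<star> w n cup 0 = w n cup 0 \<star> w 0 E 0" by (rule far[where j = 0]) simp_all
    then show ?thesis unfolding U_def by (simp only: w_0_0 E)
  qed
  have E2F1: "w 0 E 2 \<star> F1 = F1" "F1 \<star> w 0 E 2 = F1"
    using arg_cong[OF EF(1), of "\<lambda>X. w 0 X 1"] arg_cong[OF EF(2), of "\<lambda>X. w 0 X 1"]
    by (simp_all add: w_comp F1_def numeral_2_eq_2)
  have ECF1: "E \<star> C \<star> F1 = C \<star> F1"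
    using comp_eq_comp[OF EC, of F1] E2F1 by (simp add: comp_assoc numeral_2_eq_2)
  have F1UE: "F1 \<star> U \<star> E = F1 \<star> U"
    using UE E2F1 by (simp add: numeral_2_eq_2 flip: comp_assoc)
  \<comment> \<open>Inside the correction term the cap closes the last strand of a copy of
    \<open>f\<close>, a partial trace worth \<tau> times \<open>E\<close>. \<open>E\<close> is
    absorbed, and the two terms cancel.\<close>
  have Cg: "C \<star> g = Z (n + 2) n"
  proof -
    have "C \<star> (F1 \<star> U \<star> C \<star> F1) = (C \<star> F1 \<star> U) \<star> C \<star> F1"
      by (simp add: comp_assoc)
    also have "\<dots> = \<tau> \<bullet> (C \<star> F1)" by (simp add: CF1U ECF1)
    finally show ?thesis
      using \<tau> plus_uminus[of "C \<star> F1"] by (simp add: g_eq comp_plus c_def)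
  qed
  have gU: "g \<star> U = Z n (n + 2)"
  proof -
    have "(F1 \<star> U \<star> C \<star> F1) \<star> U = F1 \<star> U \<star> (C \<star> F1 \<star> U)"
      by (simp add: comp_assoc)
    also have "\<dots> = \<tau> \<bullet> (F1 \<star> U)" by (simp add: CF1U F1UE)
    finally show ?thesis
      using \<tau> plus_uminus[of "F1 \<star> U"] by (simp add: g_eq plus_comp c_def)
  qed
  have capF1: "w i cap (Suc j) \<star> F1 = Z (n + 2) (i + Suc j)" if "i + 2 + j = Suc n" for i j
  proof -
    have "w i cap j \<star> F = Z (Suc n) (i + j)" using kil that by (simp add: killed_def)
    from arg_cong[OF this, of "\<lambda>X. w 0 X 1"] show ?thesis using that by (simp add: w_comp F1_def)
  qed
  have F1cup: "F1 \<star> w i cup (Suc j) = Z (i + Suc j) (n + 2)" if "i + 2 + j = Suc n" for i j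
  proof -
    have "F \<star> w i cup j = Z (i + j) (Suc n)" using cokil that by (simp add: cokilled_def)
    from arg_cong[OF this, of "\<lambda>X. w 0 X 1"] show ?thesis using that by (simp add: w_comp F1_def)
  qed
  have killed_g: "killed (Suc (Suc n)) 0 g"
    unfolding killed_def
  proof (intro conjI allI impI)
    fix i j assume ij: "i + 2 + j = Suc (Suc n)"
    show "w i cap (j + 0) \<star> g = Z (dm g) (i + j + 0)"
    proof (cases j)
      case 0
      then show ?thesis using Cg ij by (simp add: C_def)
    next
      case (Suc j')
      then have c: "w i cap j \<star> F1 = Z (n + 2) (i + j)" using capF1[of i j'] ij by simp
      show ?thesis using comp_eq_comp[OF c, of "U \<star> C \<star> F1"] c ij by (simp add: g_eq comp_plus)
    qed
  qed auto
  have cokilled_g: "cokilled (Suc (Suc n)) 0 g"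
    unfolding cokilled_def
  proof (intro conjI allI impI)
    fix i j assume ij: "i + 2 + j = Suc (Suc n)"
    show "g \<star> w i cup (j + 0) = Z (i + j + 0) (cd g)"
    proof (cases j)
      case 0
      then show ?thesis using gU ij by (simp add: U_def)
    next
      case (Suc j')
      then have c: "F1 \<star> w i cup j = Z (i + j) (n + 2)" using F1cup[of i j'] ij by simp
      show ?thesis using c ij by (simp add: g_eq plus_comp comp_assoc)
    qed
  qed auto
  have wg: "w 0 g k = w 0 F (Suc k) \<boxplus> c \<bullet> (w 0 F (Suc k) \<star> w n cup k \<star> w n cap k \<star> w 0 F (Suc k))" for k
    by (simp add: g_eq w_plus w_comp F1_def U_def C_def)
  have absl_g: "w 0 g k \<star> X = X" if X: "killed (Suc (Suc n)) k X" for k X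
  proof -
    have X': "ok X" "cd X = Suc (Suc n) + k" using X by (simp_all add: killed_def)
    \<comment> \<open>With one more strand exempt the hypothesis concerns \<open>f\<close>, which
      therefore fixes \<open>X\<close>; the cap on the last pair then annihilates the correction
      term.\<close>
    have "killed (Suc n) (Suc k) X"
      unfolding killed_def
    proof (intro conjI allI impI)
      fix i j assume "i + 2 + j = Suc n"
      then show "w i cap (j + Suc k) \<star> X = Z (dm X) (i + j + Suc k)"
        using X unfolding killed_def by (metis add_Suc_right add_Suc_shift)
    qed (use X' in auto)
    then have 1: "w 0 F (Suc k) \<star> X = X" by (rule absl)
    have 2: "w n cap k \<star> X = Z (dm X) (n + k)"
      using X unfolding killed_def by (metis add_0 add_0_right add_2_eq_Suc')
    show ?thesis using X' by (simp add: wg plus_comp comp_assoc 1 2)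
  qed
  have absr_g: "X \<star> w 0 g k = X" if X: "cokilled (Suc (Suc n)) k X" for k X
  proof -
    have X': "ok X" "dm X = Suc (Suc n) + k" using X by (simp_all add: cokilled_def)
    have "cokilled (Suc n) (Suc k) X"
      unfolding cokilled_def
    proof (intro conjI allI impI)
      fix i j assume "i + 2 + j = Suc n"
      then show "X \<star> w i cup (j + Suc k) = Z (i + j + Suc k) (cd X)"
        using X unfolding cokilled_def by (metis add_Suc_right add_Suc_shift)
    qed (use X' in auto)
    then have 1: "X \<star> w 0 F (Suc k) = X" by (rule absr)
    have 2: "X \<star> w n cup k = Z (n + k) (cd X)"
      using X unfolding cokilled_def by (metis add_0 add_0_right add_2_eq_Suc')
    have 3: "X \<star> (w 0 F (Suc k) \<star> Y) = X \<star> Y" if "ok Y" "cd Y = Suc (Suc n) + k" for Y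
      using comp_eq_comp[OF 1, of Y] X' that by simp
    have 4: "X \<star> (w n cup k \<star> Y) = Z (dm Y) (cd X)" if "ok Y" "cd Y = n + k" for Y
      using comp_eq_comp[OF 2, of Y] X' that by simp
    show ?thesis using X' by (simp add: wg comp_plus 1 3 4)
  qed
  \<comment> \<open>The first term closes a free circle; the second straightens by two zigzags to
    \<open>F \<star> F\<close>.\<close>
  have tr_g: "w (Suc n) cap 0 \<star> w 0 g 1 \<star> w (Suc n) cup 0 = (d - inverse \<tau>) \<bullet> F"
  proof -
    have F2C: "w (Suc n) cap 0 \<star> w 0 F 2 = F \<star> w (Suc n) cap 0"
    proof -
      have "w 0 F 0 \<star> w (Suc n) cap 0 = w (Suc n) cap 0 \<star> w 0 F 2" by (rule far[where j = 0]) simp_all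
      then show ?thesis by (simp only: w_0_0 F)
    qed
    have F2U: "w 0 F 2 \<star> w (Suc n) cup 0 = w (Suc n) cup 0 \<star> F"
    proof -
      have "w 0 F 2 \<star> w (Suc n) cup 0 = w (Suc n) cup 0 \<star> w 0 F 0" by (rule far[where j = 0]) simp_all
      then show ?thesis by (simp only: w_0_0 F)
    qed
    have z1: "w (Suc n) cap 0 \<star> w n cup 1 = S (Suc n)"
      using zigzag_right'[of "Suc n" n 1 0] by simp
    have z2: "w n cap 1 \<star> w (Suc n) cup 0 = S (Suc n)"
      using zigzag_left'[of "Suc n" n 1 0] by simp
    have "w (Suc n) cap 0 \<star> w 0 F 2 \<star> w (Suc n) cup 0 = F \<star> (w (Suc n) cap 0 \<star> w (Suc n) cup 0)"
      using comp_eq_comp[OF F2C, of "w (Suc n) cup 0"] by (simp add: comp_assoc)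
    then have 1: "w (Suc n) cap 0 \<star> w 0 F 2 \<star> w (Suc n) cup 0 = d \<bullet> F"
      using circle'[of "Suc n" 0] by simp
    have "w (Suc n) cap 0 \<star> w 0 F 2 \<star> w n cup 1 \<star> w n cap 1 \<star> w 0 F 2 \<star> w (Suc n) cup 0
      = F \<star> (w (Suc n) cap 0 \<star> w n cup 1) \<star> (w n cap 1 \<star> w (Suc n) cup 0) \<star> F"
      using comp_eq_comp[OF F2C, of "w n cup 1 \<star> w n cap 1 \<star> w 0 F 2 \<star> w (Suc n) cup 0"] F2U
      by (simp add: comp_assoc)
    then have 2: "w (Suc n) cap 0 \<star> w 0 F 2 \<star> w n cup 1 \<star> w n cap 1 \<star> w 0 F 2 \<star> w (Suc n) cup 0 = F"
      by (simp only: z1 z2) (simp add: FF)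
    have "w (Suc n) cap 0 \<star> w 0 g 1 \<star> w (Suc n) cup 0 = d \<bullet> F \<boxplus> c \<bullet> F"
      using 1 2 by (simp add: wg comp_plus plus_comp comp_assoc numeral_2_eq_2)
    then show ?thesis using add_scale[of F d c] by (simp add: c_def)
  qed
  have "killed (Suc n) 1 g"
    unfolding killed_def
  proof (intro conjI allI impI)
    fix i j assume "i + 2 + j = Suc n"
    then show "w i cap (j + 1) \<star> g = Z (dm g) (i + j + 1)"
      using killed_g unfolding killed_def by (metis add_Suc_right Suc_eq_plus1 add_0_right)
  qed auto
  then have Fg: "w 0 F 1 \<star> g = g" by (rule absl)
  have "cokilled (Suc n) 1 g"
    unfolding cokilled_def
  proof (intro conjI allI impI)
    fix i j assume "i + 2 + j = Suc n"
    then show "g \<star> w i cup (j + 1) = Z (i + j + 1) (cd g)"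
      using cokilled_g unfolding cokilled_def by (metis add_Suc_right Suc_eq_plus1 add_0_right)
  qed auto
  then have gF: "g \<star> w 0 F 1 = g" by (rule absr)
  \<comment> \<open>The first \<open>n\<close> caps make \<open>f\<close> act as the identity, after
    which the last cap removes the correction term.\<close>
  have sem_g: "potts (wenzl n \<tau> f) m \<psi> = \<psi>" if k: "\<And>i. i < Suc n \<Longrightarrow> potts Cap (m + i) \<psi> = (\<lambda>p. 0)" for m \<psi>
  proof -
    have 1: "potts f m \<psi> = \<psi>" by (rule sem) (use k in auto)
    have 2: "potts Cap (m + n) \<psi> = (\<lambda>p. 0)" by (rule k) simp
    show ?thesis
      using potts_zero[of Cup "m + n"] potts_zero[of f m]
      by (simp add: wenzl_def 1 2[simplified])
  qed
  show ?thesis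
    unfolding jw_data_def
    using typed_w killed_g cokilled_g absl_g absr_g tr_g Fg gF sem_g
    unfolding g_def F_def[symmetric] by auto
qed

end

context skein begin

text \<open>By the normal forms \<open>h\<close> acts on killed tangles as a scalar \<alpha>. Being
  cokilled, \<open>h\<close> absorbs \<open>f\<close>, so it is \<alpha> times the class of
  \<open>f\<close>; idempotence and \<open>h\<close> being nonzero give \<alpha> = 1.\<close>

lemma jw_unique:
  assumes jw: "jw_data n \<tau> f E"
    and h: "TL h" "dm h = Suc n" "cd h = Suc n" "killed (Suc n) 0 h" "cokilled (Suc n) 0 h"
      "h \<star> h = h" "h \<noteq> Z (Suc n) (Suc n)"
  shows "h = cls f"
proof -
  have f: "killed (Suc n) 0 (cls f)" "ok (cls f)"
    using jw unfolding jw_data_def by (auto simp: killed_def)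
  have okh: "ok h" using h TL_ok by blast
  obtain \<alpha> where \<alpha>: "\<And>F. killed (Suc n) 0 F \<Longrightarrow> h \<star> F = \<alpha> \<bullet> F"
    using span_killed[OF TL_span[OF h(1)]] h by auto
  have "h \<star> w 0 (cls f) 0 = h"
    using jw h(5) unfolding jw_data_def by blast
  then have hf: "h = \<alpha> \<bullet> cls f" using \<alpha>[OF f(1)] f(2) by simp
  have hh: "h = \<alpha> \<bullet> h" using \<alpha>[OF h(4)] h(6) by simp
  have "\<alpha> = 1"
  proof (rule ccontr)
    assume "\<alpha> \<noteq> 1"
    have "(1 - \<alpha>) \<bullet> h = h \<boxplus> (- \<alpha>) \<bullet> h"
      using add_scale[of h 1 "- \<alpha>"] okh by simp
    also have "\<dots> = h \<boxplus> (- 1) \<bullet> (\<alpha> \<bullet> h)" using okh by simp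
    also have "\<dots> = Z (Suc n) (Suc n)" using hh plus_uminus[OF okh] h by simp
    finally have "(inverse (1 - \<alpha>)) \<bullet> (1 - \<alpha>) \<bullet> h = Z (Suc n) (Suc n)" by simp
    then show False using h okh \<open>\<alpha> \<noteq> 1\<close> by simp
  qed
  then show ?thesis using hf f by simp
qed

lemma comp_swap:
  "A \<star> B = C \<star> D \<Longrightarrow> ok A \<Longrightarrow> ok B \<Longrightarrow> ok C \<Longrightarrow> ok D \<Longrightarrow> ok X \<Longrightarrow> A \<star> B \<star> X = C \<star> D \<star> X"
  by (simp add: comp_assoc[symmetric])

text \<open>The inductive definition exposes the topmost cap, but a box below meets the lowest one,
  which is split off here.\<close>

lemma caps_only_bottom:
  "caps_only a b A \<Longrightarrow> A = S a \<or> (\<exists>k l B. TL B \<and> dm B = k + l \<and> cd B = b \<and> a = k + 2 + l \<and> A = B \<star> w k cap l)"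
proof (induction rule: caps_only.induct)
  case (caps_only_cap a i j A)
  note A = caps_only_type[OF caps_only_cap.hyps]
  from caps_only_cap.IH show ?case
  proof
    assume "A = S a"
    moreover from this have "a = i + 2 + j" using A by (metis cd_cls typed.simps(1) tops.simps(1))
    ultimately show ?thesis
      by (intro disjI2 exI[of _ i] exI[of _ j] exI[of _ "S (i + j)"]) simp
  next
    assume "\<exists>k l B. TL B \<and> dm B = k + l \<and> cd B = i + 2 + j \<and> a = k + 2 + l \<and> A = B \<star> w k cap l"
    then obtain k l B where "TL B" "dm B = k + l" "cd B = i + 2 + j" "a = k + 2 + l" "A = B \<star> w k cap l"
      by blast
    then show ?thesis
      by (intro disjI2 exI[of _ k] exI[of _ l] exI[of _ "w i cap j \<star> B"]) (simp add: comp_assoc TL_ok)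
  qed
qed simp

lemma span_to_0_induct [consumes 2, case_names cap zero plus scale]:
  assumes "span n 0 A" "0 < n"
    and "\<And>B k l. TL B \<Longrightarrow> ok B \<Longrightarrow> dm B = k + l \<Longrightarrow> cd B = 0 \<Longrightarrow> n = k + 2 + l \<Longrightarrow> P (B \<star> w k cap l)"
    and "P (Z n 0)"
    and "\<And>A B. ok A \<Longrightarrow> ok B \<Longrightarrow> dm A = n \<Longrightarrow> dm B = n \<Longrightarrow> cd A = 0 \<Longrightarrow> cd B = 0 \<Longrightarrow> P A \<Longrightarrow> P B \<Longrightarrow> P (A \<boxplus> B)"
    and "\<And>A c. ok A \<Longrightarrow> dm A = n \<Longrightarrow> cd A = 0 \<Longrightarrow> P A \<Longrightarrow> P (c \<bullet> A)"
  shows "P A"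
  using assms(1)
proof (induction a\<equiv>n b\<equiv>"0 :: nat" A rule: span.induct)
  case (span_nf A)
  then have caps_only: "caps_only n 0 A" by (cases rule: normal_form.cases) auto
  have "A \<noteq> S n"
    using caps_only_type[OF caps_only] \<open>0 < n\<close> by (metis cd_cls typed.simps(1) tops.simps(1) less_irrefl)
  then obtain k l B where "TL B" "dm B = k + l" "cd B = 0" "n = k + 2 + l" "A = B \<star> w k cap l"
    using caps_only_bottom[OF caps_only] by blast
  then show ?case using assms(3) TL_ok by blast
qed (use assms(4-) span_type in auto)

lemma span_from_0_induct [consumes 2, case_names cup zero plus scale]:
  assumes "span 0 n A" "0 < n"
    and "\<And>B k l. TL B \<Longrightarrow> ok B \<Longrightarrow> dm B = 0 \<Longrightarrow> cd B = k + l \<Longrightarrow> n = k + 2 + l \<Longrightarrow> P (w k cup l \<star> B)"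
    and "P (Z 0 n)"
    and "\<And>A B. ok A \<Longrightarrow> ok B \<Longrightarrow> dm A = 0 \<Longrightarrow> dm B = 0 \<Longrightarrow> cd A = n \<Longrightarrow> cd B = n \<Longrightarrow> P A \<Longrightarrow> P B \<Longrightarrow> P (A \<boxplus> B)"
    and "\<And>A c. ok A \<Longrightarrow> dm A = 0 \<Longrightarrow> cd A = n \<Longrightarrow> P A \<Longrightarrow> P (c \<bullet> A)"
  shows "P A"
  using assms(1)
proof (induction a\<equiv>"0 :: nat" b\<equiv>n A rule: span.induct)
  case (span_nf A)
  then show ?case
  proof (cases rule: normal_form.cases)
    case normal_form_pc
    then show ?thesis using caps_only_0 \<open>0 < n\<close> by blast
  next
    case (normal_form_cup i j B)
    then show ?thesis using assms(3)[of B i j] normal_form_type[of 0 "i + j" B] by simp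
  qed
qed (use assms(4-) span_type in auto)

end

section \<open>Closed tangles with one box\<close>

locale one_box = skein +
  assumes K4: "4 \<in> K"
    and rot: "bend 4 (Box 4) \<approx> \<i> \<cdot> Box 4"
    and cap_Box: "\<And>i j. i + 2 + j = 4 \<Longrightarrow> (Strands i \<otimes> Cap \<otimes> Strands j) \<odot> Box 4 \<approx> Zero 0 (i + j)"
begin

text \<open>\<open>B y\<close> is the box with its last \<open>y\<close> strands bent down on the right.\<close>

primrec B :: "nat \<Rightarrow> tangle set" where
  "B 0 = cls (Box 4)"
| "B (Suc y) = w (3 - y) cap 0 \<star> w 0 (B y) 1"

lemma B_type_aux: "y \<le> 4 \<Longrightarrow> ok (B y) \<and> dm (B y) = y \<and> cd (B y) = 4 - y"
  by (induction y) (use K4 in \<open>auto intro: ok_cls\<close>)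

lemma B_type: assumes "x + y = 4" shows "ok (B y)" "dm (B y) = y" "cd (B y) = x"
  using B_type_aux[of y] assms by auto

lemma cap_right: assumes "Suc x + y = 4" shows "w x cap 0 \<star> w 0 (B y) 1 = B (Suc y)"
proof -
  have "x = 3 - y" using assms by simp
  then show ?thesis by simp
qed

lemma cup_right: assumes xy: "Suc x + y = 4" shows "w 0 (B (Suc y)) 1 \<star> w y cup 0 = B y"
proof -
  note T = B_type[OF xy]
  have "w 0 (B (Suc y)) 1 = w x cap 1 \<star> w 0 (B y) 2"
    using T by (simp add: cap_right[OF xy, symmetric] w_comp numeral_2_eq_2 del: B.simps)
  moreover have "w 0 (B y) 2 \<star> w y cup 0 = w (Suc x) cup 0 \<star> w 0 (B y) 0"
    by (rule far[where j = 0]) (use T in simp_all)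
  moreover have "w x cap 1 \<star> w (Suc x) cup 0 = S (x + 1 + 0)"
    by (rule zigzag_left') simp_all
  ultimately show ?thesis
    using T comp_eq_comp[of "w x cap 1" "w (Suc x) cup 0" _ "B y"] by (simp add: comp_assoc)
qed

text \<open>Bend one more strand down on the right in the rotation relation and straighten the
  zigzag that arises: what remains compares bending down on the left with bending down on the
  right.\<close>

lemma cap_left_0: "w 0 cap 3 \<star> w 1 (B 0) 0 = \<i> \<bullet> B 1"
proof -
  note T = B_type[of 4 0, OF add_0_right]
  have "w 0 cap 4 \<star> w 1 (B 0) 1 \<star> cup = \<i> \<bullet> B 0"
  proof -
    have "cls (bend 4 (Box 4)) = cls (\<i> \<cdot> Box 4)"
      using rot skein_eq_type[OF rot] cls_eq_iff by blast
    then show ?thesis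
      using K4 by (simp add: bend_def cls_comp cls_tens cls_scale w_def tens_assoc comp_assoc ok_cls)
  qed
  then have "w 3 cap 0 \<star> w 0 (w 0 cap 4 \<star> w 1 (B 0) 1 \<star> cup) 1 = w 3 cap 0 \<star> w 0 (\<i> \<bullet> B 0) 1"
    by simp
  then have 1: "w 3 cap 0 \<star> w 0 cap 5 \<star> w 1 (B 0) 2 \<star> w 0 cup 1 = \<i> \<bullet> B 1"
    using T cap_right[of 3 0] by (simp add: w_comp numeral_2_eq_2 del: B.simps)
  have "w 3 cap 0 \<star> w 0 cap 5 \<star> w 1 (B 0) 2 \<star> w 0 cup 1 = w 0 cap 3 \<star> w 5 cap 0 \<star> w 1 (B 0) 2 \<star> w 0 cup 1"
    by (intro comp_swap far[symmetric, where j = 3]) (use T in simp_all)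
  also have "w 5 cap 0 \<star> w 1 (B 0) 2 \<star> w 0 cup 1 = w 1 (B 0) 0 \<star> w 1 cap 0 \<star> w 0 cup 1"
    by (intro comp_swap far[symmetric, where j = 0]) (use T in simp_all)
  also have "w 1 cap 0 \<star> w 0 cup 1 = S (0 + 1 + 0)"
    by (rule zigzag_right') simp_all
  finally have "w 3 cap 0 \<star> w 0 cap 5 \<star> w 1 (B 0) 2 \<star> w 0 cup 1 = w 0 cap 3 \<star> w 1 (B 0) 0"
    using T by (simp del: B.simps)
  with 1 show ?thesis by simp
qed

lemma cap_left: "Suc x + y = 4 \<Longrightarrow> w 0 cap x \<star> w 1 (B y) 0 = \<i> \<bullet> B (Suc y)"
proof (induction y arbitrary: x)
  case 0
  then have "x = 3" by simp
  then show ?case using cap_left_0 by (simp del: B.simps)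
next
  case (Suc y)
  then have xy: "Suc (Suc x) + y = 4" "Suc x + Suc y = 4" by simp_all
  note T = B_type[OF xy(1)] B_type[OF xy(2)]
  have "w 1 (B (Suc y)) 0 = w (x + 2) cap 0 \<star> w 1 (B y) 1"
    using T by (simp add: cap_right[OF xy(1), symmetric] w_comp del: B.simps)
  moreover have "w 0 cap x \<star> w (x + 2) cap 0 = w x cap 0 \<star> w 0 cap (x + 2)"
    by (rule far[where j = x]) simp_all
  moreover have "w 0 cap (x + 2) \<star> w 1 (B y) 1 = w 0 (\<i> \<bullet> B (Suc y)) 1"
    using T Suc.IH[OF xy(1), symmetric] by (simp add: w_comp del: B.simps)
  ultimately show ?case
    using T comp_eq_comp[of "w 0 cap x" "w (x + 2) cap 0" _ "w 1 (B y) 1"] cap_right[OF xy(2)]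
    by (simp add: comp_assoc del: B.simps)
qed

text \<open>A zigzag undoes \<open>cap_left\<close>, hence the factor \<open>- \<i>\<close>, the
  inverse of \<i>.\<close>

lemma cup_left: assumes xy: "Suc x + y = 4" shows "w 1 (B (Suc y)) 0 \<star> w 0 cup y = (- \<i>) \<bullet> B y"
proof -
  have xy': "x + Suc y = 4" using xy by simp
  note T = B_type[OF xy] B_type[OF xy']
  have "B (Suc y) = (- \<i>) \<bullet> (w 0 cap x \<star> w 1 (B y) 0)"
    using cap_left[OF xy] T by (simp del: B.simps)
  then have "w 1 (B (Suc y)) 0 = (- \<i>) \<bullet> (w 1 cap x \<star> w 2 (B y) 0)"
    using T by (simp add: w_comp numeral_2_eq_2 del: B.simps)
  moreover have "w 0 cup (Suc x) \<star> w 0 (B y) 0 = w 2 (B y) 0 \<star> w 0 cup y"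
    by (rule far[where j = 0]) (use T in simp_all)
  moreover have "w 1 cap x \<star> w 0 cup (Suc x) = S (0 + 1 + x)"
    by (rule zigzag_right') simp_all
  ultimately show ?thesis
    using T comp_eq_comp[of "w 1 cap x" "w 0 cup (Suc x)" _ "B y"] by (simp add: comp_assoc del: B.simps)
qed

lemma cap_inside: "i + 2 + j + y = 4 \<Longrightarrow> w i cap j \<star> B y = Z y (i + j)"
proof (induction y arbitrary: i j)
  case 0
  then have "cls ((Strands i \<otimes> Cap \<otimes> Strands j) \<odot> Box 4) = cls (Zero 0 (i + j))"
    using cap_Box[of i j] skein_eq_type[OF cap_Box[of i j]] cls_eq_iff by (metis add_0_right)
  then show ?case using K4 by (simp add: cls_comp cls_tens w_def tens_assoc ok_cls)
next
  case (Suc y)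
  then have xy: "Suc (i + 2 + j) + y = 4" by simp
  note T = B_type[OF xy]
  have "w i cap j \<star> w (i + 2 + j) cap 0 = w (i + j) cap 0 \<star> w i cap (j + 2)"
    by (rule far[where j = j]) simp_all
  moreover have "w i cap (j + 2) \<star> w 0 (B y) 1 = w 0 (Z y (i + Suc j)) 1"
    using T Suc.IH[of i "Suc j", symmetric] Suc.prems by (simp add: w_comp del: B.simps)
  ultimately show ?case
    using T comp_eq_comp[of "w i cap j" "w (i + 2 + j) cap 0" _ "w 0 (B y) 1"] cap_right[OF xy, symmetric]
    by (simp add: comp_assoc del: B.simps)
qed

text \<open>A cup on the last two lower strands undoes one bend and turns into a cap on two upper
  strands. For a cup further to the left, the \<open>l\<close> strands on its right are unbent one
  at a time.\<close>

lemma cup_inside: "x + (k + 2 + l) = 4 \<Longrightarrow> B (k + 2 + l) \<star> w k cup l = Z (k + l) x"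
proof (induction l arbitrary: x)
  case 0
  then have xy: "Suc x + Suc k = 4" "Suc (Suc x) + k = 4" by simp_all
  note T = B_type[OF xy(1)] B_type[OF xy(2)]
  have "B (k + 2 + 0) = w x cap 0 \<star> w 0 (B (Suc k)) 1"
    using cap_right[OF xy(1)] by (simp del: B.simps)
  then show ?case
    using T cup_right[OF xy(2)] cap_inside[of x 0 k] 0 by (simp add: comp_assoc del: B.simps)
next
  case (Suc l)
  then have xy: "Suc x + (k + 2 + l) = 4" by simp
  note T = B_type[OF xy]
  have "B (k + 2 + Suc l) = w x cap 0 \<star> w 0 (B (k + 2 + l)) 1"
    using cap_right[OF xy] by (simp del: B.simps)
  moreover have "w 0 (B (k + 2 + l)) 1 \<star> w k cup (Suc l) = w 0 (Z (k + l) (Suc x)) 1"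
    using T arg_cong[OF Suc.IH[OF xy], of "\<lambda>X. w 0 X 1"] by (simp add: w_comp del: B.simps)
  ultimately show ?case
    using T by (simp add: comp_assoc del: B.simps)
qed

declare B.simps [simp del]

text \<open>The cases are the ways in which a cap on strands \<open>k\<close> and
  \<open>k + 1\<close> can meet a box on the \<open>x\<close> strands from \<open>i\<close> on: left
  of it, across its left edge, inside, across its right edge, right of it.\<close>

lemma around:
  fixes i k x :: nat
  assumes "0 < x"
  obtains m where "i = k + 2 + m" | "i = Suc k" | m where "k = i + m" "m + 2 \<le> x"
    | "Suc k = i + x" | m where "k = i + x + m"
proof -
  consider "k + 2 \<le> i" | "i = Suc k" | "i \<le> k" "k + 2 \<le> i + x" | "Suc k = i + x" | "i + x \<le> k"
    using assms by linarith
  then show thesis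
  proof cases
    case 3
    then have "k = i + (k - i)" "(k - i) + 2 \<le> x" by simp_all
    then show ?thesis by (rule that(3))
  qed (use that le_iff_add in metis)+
qed

text \<open>
  Absorb the lowest cap of \<open>a\<close> if some strand of the box points up, else the highest cup of \<open>c\<close>. It
  slides past the box, bends one of its strands, or kills it; in each surviving case fewer strands
  pass by the box.
\<close>

lemma one_box_vanishes:
  assumes "x + y = 4" "TL a" "dm a = i + x + j" "cd a = 0" "TL c" "dm c = 0" "cd c = i + y + j"
  shows "a \<star> w i (B y) j \<star> c = Z 0 0"
  using assms
proof (induction "i + j" arbitrary: i j x y a c rule: less_induct)
  case less
  note T = B_type[OF less.prems(1)]
  note ok = TL_ok[OF less.prems(2)] TL_ok[OF less.prems(5)]
  note IH = less.hyps
  show ?case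
  proof (cases x)
    case (Suc x')
    have "span (i + x + j) 0 a" using TL_span[OF less.prems(2)] less.prems by simp
    have "0 < x" "0 < i + x + j" using Suc by simp_all
    from \<open>span (i + x + j) 0 a\<close> \<open>0 < i + x + j\<close> show ?thesis
    proof (induction rule: span_to_0_induct)
      case (cap a' k l)
      have assoc: "(a' \<star> w k cap l) \<star> w i (B y) j \<star> c = a' \<star> (w k cap l \<star> w i (B y) j) \<star> c"
        using cap T ok less.prems by (simp add: comp_assoc)
      consider m where "i = k + 2 + m" | "i = Suc k" | m where "k = i + m" "m + 2 \<le> x"
        | "Suc k = i + x" | m where "k = i + x + m"
        using around[of x i k thesis] \<open>0 < x\<close> by blast
      then show ?case
      proof cases
        case 1
        then have l: "l = m + x + j" using cap by simp
        have eq: "w k cap l \<star> w i (B y) j = w (k + m) (B y) j \<star> w k cap (m + y + j)"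
          by (rule far[where j = m]) (use T 1 l in simp_all)
        have "(a' \<star> w k cap l) \<star> w i (B y) j \<star> c = a' \<star> w (k + m) (B y) j \<star> w k cap (m + y + j) \<star> c"
          unfolding assoc eq using T ok cap less.prems 1 l by (simp add: comp_assoc)
        also have "\<dots> = Z 0 0"
          by (rule IH) (use 1 l cap less.prems in \<open>simp_all add: T ok\<close>)
        finally show ?thesis .
      next
        \<comment> \<open>One end of the cap is on the box, so the strand passing on its left
          becomes a lower strand of the box and \<open>i\<close> drops by one.\<close>
        case 2
        then have l: "l = x' + j" using cap Suc by simp
        have xy: "Suc x' + y = 4" using less.prems Suc by simp
        have "w k cap l \<star> w i (B y) j = w k (w 0 cap x' \<star> w 1 (B y) 0) j"
          using 2 l T Suc by (simp add: w_comp)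
        also have "\<dots> = \<i> \<bullet> w k (B (Suc y)) j"
          using cap_left[OF xy] B_type[of x' "Suc y"] xy by simp
        finally have "(a' \<star> w k cap l) \<star> w i (B y) j \<star> c = \<i> \<bullet> (a' \<star> w k (B (Suc y)) j \<star> c)"
          unfolding assoc using B_type[of x' "Suc y"] xy ok cap less.prems 2 l by simp
        also have "a' \<star> w k (B (Suc y)) j \<star> c = Z 0 0"
          by (rule IH[of _ _ x']) (use 2 l cap less.prems Suc in \<open>simp_all add: T ok\<close>)
        finally show ?thesis by simp
      next
        case 3
        then obtain n where n: "x = m + 2 + n" using le_iff_add by blast
        then have "l = n + j" using 3 cap by simp
        then have "w k cap l \<star> w i (B y) j = w i (w m cap n \<star> B y) j"
          using 3 n T by (simp add: w_comp)
        also have "\<dots> = Z (i + y + j) (k + l)"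
          using cap_inside[of m n y] less.prems n 3 cap by (simp add: add.assoc)
        finally show ?thesis unfolding assoc using cap ok less.prems by simp
      next
        case 4
        then have k: "k = i + x'" and j: "j = Suc l" using cap Suc by simp_all
        have xy: "Suc x' + y = 4" using less.prems Suc by simp
        have "w k cap l \<star> w i (B y) j = w i (w x' cap 0 \<star> w 0 (B y) 1) l"
          using k j T Suc by (simp add: w_comp)
        also have "\<dots> = w i (B (Suc y)) l"
          using cap_right[OF xy] by simp
        finally have "(a' \<star> w k cap l) \<star> w i (B y) j \<star> c = a' \<star> w i (B (Suc y)) l \<star> c"
          unfolding assoc by simp
        also have "\<dots> = Z 0 0"
          by (rule IH[of _ _ x']) (use k j cap less.prems Suc in \<open>simp_all add: T ok\<close>)
        finally show ?thesis .
      next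
        case 5
        then have j: "j = m + 2 + l" using cap by simp
        have eq: "w k cap l \<star> w i (B y) j = w i (B y) (m + l) \<star> w (i + y + m) cap l"
          by (rule far[symmetric, where j = m]) (use T 5 j in simp_all)
        have "(a' \<star> w k cap l) \<star> w i (B y) j \<star> c = a' \<star> w i (B y) (m + l) \<star> w (i + y + m) cap l \<star> c"
          unfolding assoc eq using T ok cap less.prems j by (simp add: comp_assoc)
        also have "\<dots> = Z 0 0"
          by (rule IH) (use j cap less.prems in \<open>simp_all add: T ok 5\<close>)
        finally show ?thesis .
      qed
    qed (use less.prems T ok in \<open>simp_all add: plus_comp\<close>)
  next
    case 0
    then obtain y' where y: "y = Suc y'" using less.prems by (cases y) auto
    have xy': "Suc x + y' = 4" using less.prems y by simp
    have "span 0 (i + y + j) c" using TL_span[OF less.prems(5)] less.prems by simp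
    have "0 < y" "0 < i + y + j" using y by simp_all
    from \<open>span 0 (i + y + j) c\<close> \<open>0 < i + y + j\<close> show ?thesis
    proof (induction rule: span_from_0_induct)
      case (cup c' k l)
      have assoc: "a \<star> w i (B y) j \<star> w k cup l \<star> c' = a \<star> (w i (B y) j \<star> w k cup l) \<star> c'"
        using cup T ok less.prems by (simp add: comp_assoc)
      consider m where "i = k + 2 + m" | "i = Suc k" | m where "k = i + m" "m + 2 \<le> y"
        | "Suc k = i + y" | m where "k = i + y + m"
        using around[of y i k thesis] \<open>0 < y\<close> by blast
      then show ?case
      proof cases
        case 1
        then have l: "l = m + y + j" using cup by simp
        have eq: "w i (B y) j \<star> w k cup l = w k cup (m + x + j) \<star> w (k + m) (B y) j"
          by (rule far[symmetric, where j = m]) (use T 1 l in simp_all)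
        have "a \<star> w i (B y) j \<star> w k cup l \<star> c' = (a \<star> w k cup (m + x + j)) \<star> w (k + m) (B y) j \<star> c'"
          unfolding assoc eq using T ok less.prems 1 cup by (simp add: comp_assoc)
        also have "\<dots> = Z 0 0"
          by (rule IH) (use 1 l cup less.prems in \<open>simp_all add: T ok\<close>)
        finally show ?thesis .
      next
        case 2
        then have l: "l = y' + j" using cup y by simp
        have "w i (B y) j \<star> w k cup l = w k (w 1 (B y) 0 \<star> w 0 cup y') j"
          using 2 l T y by (simp add: w_comp)
        also have "\<dots> = (- \<i>) \<bullet> w k (B y') j"
          using cup_left[OF xy'] B_type[OF xy'] y by simp
        finally have "a \<star> w i (B y) j \<star> w k cup l \<star> c' = (- \<i>) \<bullet> (a \<star> w k (B y') j \<star> c')"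
          unfolding assoc using B_type[OF xy'] ok cup less.prems 2 l y by simp
        also have "a \<star> w k (B y') j \<star> c' = Z 0 0"
          by (rule IH[of _ _ "Suc x"]) (use 2 l cup less.prems y in \<open>simp_all add: T ok\<close>)
        finally show ?thesis by simp
      next
        case 3
        then obtain n where n: "y = m + 2 + n" using le_iff_add by blast
        then have "l = n + j" using 3 cup by simp
        then have "w i (B y) j \<star> w k cup l = w i (B y \<star> w m cup n) j"
          using 3 n T by (simp add: w_comp)
        also have "\<dots> = Z (k + l) (i + x + j)"
          using cup_inside[of x m n] less.prems n 3 cup by (simp add: add.assoc)
        finally show ?thesis unfolding assoc using cup ok less.prems by simp
      next
        case 4
        then have k: "k = i + y'" and j: "j = Suc l" using cup y by simp_all
        have "w i (B y) j \<star> w k cup l = w i (w 0 (B y) 1 \<star> w y' cup 0) l"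
          using k j T y by (simp add: w_comp)
        also have "\<dots> = w i (B y') l"
          using cup_right[OF xy'] y by simp
        finally have "a \<star> w i (B y) j \<star> w k cup l \<star> c' = a \<star> w i (B y') l \<star> c'"
          unfolding assoc by simp
        also have "\<dots> = Z 0 0"
          by (rule IH[of _ _ "Suc x"]) (use k j cup less.prems y in \<open>simp_all add: T ok\<close>)
        finally show ?thesis .
      next
        case 5
        then have j: "j = m + 2 + l" using cup by simp
        have eq: "w i (B y) j \<star> w k cup l = w (i + x + m) cup l \<star> w i (B y) (m + l)"
          by (rule far[where j = m]) (use T 5 j in simp_all)
        have "a \<star> w i (B y) j \<star> w k cup l \<star> c' = (a \<star> w (i + x + m) cup l) \<star> w i (B y) (m + l) \<star> c'"
          unfolding assoc eq using T ok less.prems j cup 5 by (simp add: comp_assoc)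
        also have "\<dots> = Z 0 0"
          by (rule IH) (use j cup less.prems in \<open>simp_all add: T ok 5\<close>)
        finally show ?thesis .
      qed
    qed (use less.prems T ok in \<open>simp_all add: comp_plus\<close>)
  qed
qed

end

context skein begin

lemma cls_w: "typed K t \<Longrightarrow> cls (Strands i \<otimes> t \<otimes> Strands j) = w i (cls t) j"
  by (simp add: cls_tens w_def tens_assoc ok_cls)

end

section \<open>The relations of \<open>D\<^sub>4\<close> in the Potts model\<close>

definition q0 :: complex where "q0 = q_D 2"

lemma q0_cis: "q0 = cis (pi / 6)"
  by (simp add: q0_def q_D_def cis_conv_exp mult.commute)

lemma q0_exp: "q0 = exp (2 * of_real pi * \<i> / 12)"
  by (simp add: q0_def q_D_def)

lemma q0_sum: "q0 + inverse q0 = r3"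
  unfolding q0_cis by (simp add: complex_eq_iff cos_30 sin_30 r3_def)

lemma q0_diff: "q0 - inverse q0 = \<i>"
  unfolding q0_cis by (simp add: complex_eq_iff cos_30 sin_30)

lemma q0_nz [simp]: "q0 \<noteq> 0"
  by (simp add: q0_cis)

lemma q0_sq: "q0 * q0 = r3 * q0 - 1"
  using arg_cong[OF q0_sum, of "\<lambda>z. z * q0"] by (simp add: algebra_simps)

lemma qnum_2: "qnum q0 2 = r3"
proof -
  have "q0 ^ 2 - inverse q0 ^ 2 = (q0 + inverse q0) * (q0 - inverse q0)"
    by (simp add: power2_eq_square algebra_simps)
  then show ?thesis
    unfolding qnum_def q0_sum q0_diff by (simp only: nonzero_mult_div_cancel_right[OF complex_i_not_zero])
qed

lemma qnum_3: "qnum q0 3 = 2"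
proof -
  have "q0 ^ 3 - inverse q0 ^ 3 = ((q0 + inverse q0)\<^sup>2 - 1) * (q0 - inverse q0)"
    by (simp add: power2_eq_square power3_eq_cube algebra_simps)
  then show ?thesis
    unfolding qnum_def q0_sum q0_diff
    by (simp only: nonzero_mult_div_cancel_right[OF complex_i_not_zero] power2_eq_square r3_sq) simp
qed

text \<open>The parameters are [2]/[1], [3]/[2] and [4]/[3] at \<open>q0\<close>, where [2] and [4]
  equal \<open>r3\<close> and [3] equals 2.\<close>

definition jw2 where "jw2 = wenzl 0 r3 (Strands 1)"
definition jw3 where "jw3 = wenzl 1 (2 / r3) jw2"
definition jw4 where "jw4 = wenzl 2 (r3 / 2) jw3"



lemma jw_data_1: "skein.jw_data {} r3 {} 1 (2 / r3) jw2 (skein.cls {} r3 {} (Strands 1))"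
proof -
  have "r3 - inverse r3 = 2 / r3" using r3_sq by (simp add: field_simps)
  then show ?thesis using skein.jw_data_step[OF skein.jw_data_0[of "{}" r3 "{}"] r3_nz] by (simp add: jw2_def)
qed

lemma jw_data_3: "skein.jw_data {} r3 {} 3 (r3 - inverse (r3 / 2)) jw4 (skein.cls {} r3 {} jw3)"
proof -
  have "r3 - inverse (2 / r3) = r3 / 2" by (simp add: field_simps)
  then have "skein.jw_data {} r3 {} (Suc 1) (r3 / 2) jw3 (skein.cls {} r3 {} jw2)"
    using skein.jw_data_step[OF jw_data_1] by (simp add: jw3_def)
  from skein.jw_data_step[OF this] show ?thesis
    by (simp add: jw4_def numeral_eq_Suc)
qed

lemma (in skein) is_jones_wenzl_iff:
  assumes "K = {}" "R = {}" "d = q + inverse q"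
  shows "is_jones_wenzl q (Suc n) h \<longleftrightarrow>
    typed {} h \<and> bots h = Suc n \<and> tops h = Suc n \<and> cls h \<noteq> Z (Suc n) (Suc n)
    \<and> cls h \<star> cls h = cls h \<and> killed (Suc n) 0 (cls h) \<and> cokilled (Suc n) 0 (cls h)"
proof (cases "typed {} h \<and> bots h = Suc n \<and> tops h = Suc n")
  case True
  then have t: "typed K h" "ok (cls h)" by (auto intro: typed_mono ok_cls)
  have "h \<approx> Zero (Suc n) (Suc n) \<longleftrightarrow> cls h = Z (Suc n) (Suc n)"
    "h \<odot> h \<approx> h \<longleftrightarrow> cls h \<star> cls h = cls h"
    using t True by (simp_all add: cls_eq_iff flip: cls_comp)
  moreover have "((Strands i \<otimes> Cap \<otimes> Strands j) \<odot> h \<approx> Zero (Suc n) (Suc n - 2)) \<longleftrightarrow> w i cap j \<star> cls h = Z (Suc n) (i + j)"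
    "(h \<odot> (Strands i \<otimes> Cup \<otimes> Strands j) \<approx> Zero (Suc n - 2) (Suc n)) \<longleftrightarrow> cls h \<star> w i cup j = Z (i + j) (Suc n)"
    if ij: "i + 2 + j = Suc n" for i j
  proof -
    have ty: "typed K ((Strands i \<otimes> Cap \<otimes> Strands j) \<odot> h)" "typed K (h \<odot> (Strands i \<otimes> Cup \<otimes> Strands j))"
      using t True ij by auto
    have n: "Suc n - 2 = i + j" using ij by simp
    show "((Strands i \<otimes> Cap \<otimes> Strands j) \<odot> h \<approx> Zero (Suc n) (Suc n - 2)) \<longleftrightarrow> w i cap j \<star> cls h = Z (Suc n) (i + j)"
      unfolding cls_eq_iff[OF ty(1), symmetric] n by (simp add: cls_comp cls_w)
    show "(h \<odot> (Strands i \<otimes> Cup \<otimes> Strands j) \<approx> Zero (Suc n - 2) (Suc n)) \<longleftrightarrow> cls h \<star> w i cup j = Z (i + j) (Suc n)"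
      unfolding cls_eq_iff[OF ty(2), symmetric] n by (simp add: cls_comp cls_w)
  qed
  moreover have "killed (Suc n) 0 (cls h) \<longleftrightarrow> (\<forall>i j. i + 2 + j = Suc n \<longrightarrow> w i cap j \<star> cls h = Z (Suc n) (i + j))"
    "cokilled (Suc n) 0 (cls h) \<longleftrightarrow> (\<forall>i j. i + 2 + j = Suc n \<longrightarrow> cls h \<star> w i cup j = Z (i + j) (Suc n))"
    using True t by (simp_all add: killed_def cokilled_def)
  moreover have "skein_eq {} (q + inverse q) {} = skein_eq K d R" using assms by simp
  moreover have "hom {} h (Suc n) (Suc n)" using True by (simp add: hom_iff)
  ultimately show ?thesis
    unfolding is_jones_wenzl_def using True by (simp only: simp_thms cong: imp_cong) blast
qed (auto simp: is_jones_wenzl_def hom_iff)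

text \<open>The chosen representative has no known shape. That \<open>f\<close> is nonzero is
  detected by the Potts vector \<psi>, which \<open>f\<close> fixes; hence the choice succeeds, and
  uniqueness makes it skein equal to \<open>f\<close>, so that both have the same operator.\<close>

lemma (in skein) jones_wenzl_facts:
  assumes par: "K = {}" "d = r3" "R = {}"
    and jw: "jw_data n \<tau> f E"
    and \<psi>: "\<And>i. i < n \<Longrightarrow> potts Cap i \<psi> = (\<lambda>p. 0)" "\<psi> \<noteq> (\<lambda>p. 0)"
  shows "is_jones_wenzl q0 (Suc n) (jones_wenzl q0 (Suc n)) \<and>
    potts (jones_wenzl q0 (Suc n)) m = potts f m"
proof -
  have d: "d = q0 + inverse q0" using par q0_sum by simp
  note iff = is_jones_wenzl_iff[OF par(1,3) d, of n]
  have sound: "t \<approx> u \<Longrightarrow> potts t m = potts u m" for t u m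
    using potts_sound[of "{}" "{}" t u m] par by simp
  have *: "killed (Suc n) 0 (cls f)" "cokilled (Suc n) 0 (cls f)" "typed {} f" "bots f = Suc n" "tops f = Suc n"
    "\<And>m \<psi>. (\<And>i. i < n \<Longrightarrow> potts Cap (m + i) \<psi> = (\<lambda>p. 0)) \<Longrightarrow> potts f m \<psi> = \<psi>"
    "\<And>X. cokilled (Suc n) 0 X \<Longrightarrow> X \<star> w 0 (cls f) 0 = X"
    using jw unfolding jw_data_def by auto
  have ok: "ok (cls f)" using *(3) by (simp add: typed_mono ok_cls)
  have "cls f \<noteq> Z (Suc n) (Suc n)"
  proof
    assume "cls f = Z (Suc n) (Suc n)"
    then have "f \<approx> Zero (Suc n) (Suc n)" using *(3) by (simp add: typed_mono flip: cls_eq_iff)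
    from sound[OF this, of 0] have "potts f 0 \<psi> = (\<lambda>p. 0)" by simp
    moreover have "potts f 0 \<psi> = \<psi>" by (rule *) (use \<psi> in simp)
    ultimately show False using \<psi> by simp
  qed
  then have "is_jones_wenzl q0 (Suc n) f"
    unfolding iff using * *(7)[OF *(2)] ok by simp
  then have h: "is_jones_wenzl q0 (Suc n) (jones_wenzl q0 (Suc n))"
    unfolding jones_wenzl_def by (rule someI)
  then have "cls (jones_wenzl q0 (Suc n)) = cls f"
    by (intro jw_unique[OF jw]) (auto simp: iff TL_cls typed_mono)
  then have "jones_wenzl q0 (Suc n) \<approx> f"
    using h by (auto simp: iff cls_eq_iff typed_mono)
  from sound[OF this] show ?thesis using h by simp
qed

lemma jw2_killed: "potts Cap 0 (\<lambda>p. if shd p = shd (stl p) then 0 else 1) = (\<lambda>p. 0)"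
  by (simp add: fun_eq_iff cap0_def)

lemma jones_wenzl_2:
  "is_jones_wenzl q0 2 (jones_wenzl q0 2)" "potts (jones_wenzl q0 2) m = potts jw2 m"
proof -
  have "(\<lambda>p :: 3 stream. if shd p = shd (stl p) then 0 else 1 :: complex) \<noteq> (\<lambda>p. 0)"
    by (auto dest!: fun_cong[of _ _ "0 ## 1 ## sconst (0 :: 3)"])
  with skein.jones_wenzl_facts[OF HOL.refl HOL.refl HOL.refl jw_data_1, of "\<lambda>p. if shd p = shd (stl p) then 0 else 1" m]
  show "is_jones_wenzl q0 2 (jones_wenzl q0 2)" "potts (jones_wenzl q0 2) m = potts jw2 m"
    using jw2_killed by (simp_all add: numeral_2_eq_2)
qed

lemma potts_cap_box:
  assumes "i < 3" shows "potts Cap (m + i) (potts (Box 4) m \<psi>) = (\<lambda>p. 0)"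
proof -
  have "potts ((Strands i \<otimes> Cap) \<odot> Box 4) m = potts (Zero 0 0) m"
  proof (rule potts_eqI)
    have "potts ((Strands i \<otimes> Cap) \<odot> Box 4) 0 \<phi> p = 0 \<and> potts ((Strands i \<otimes> Cap) \<odot> Box 4) (Suc 0) \<phi> p = 0" for \<phi> p
      by (rule exhaust_3'[of "shd p"]; rule exhaust_3'[of "shd (stl p)"]; rule exhaust_3'[of "shd (stl (stl p))"])
        (use assms in \<open>auto simp: numeral_eq_Suc less_Suc_eq lift_def gen_defs chi_def sum_3\<close>)
    then show "potts ((Strands i \<otimes> Cap) \<odot> Box 4) 0 = potts (Zero 0 0) 0"
      "potts ((Strands i \<otimes> Cap) \<odot> Box 4) (Suc 0) = potts (Zero 0 0) (Suc 0)"
      by (auto simp: fun_eq_iff)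
  qed
  from fun_cong[OF this, of \<psi>] show ?thesis by simp
qed

lemma potts_S_down:
  "potts (S_down 2) 0 \<psi> p = (\<Sum>x\<in>UNIV. chi (x - shd p) * \<psi> (shd p ## x ## p))"
  "potts (S_down 2) (Suc 0) \<psi> p = \<i> / r3 * (\<Sum>x\<in>UNIV. \<Sum>y\<in>UNIV. chi (x - y) * \<psi> (shd p ## x ## y ## stl p))"
  by (rule exhaust_3'[of "shd p"]; simp add: S_down_def S_up_def numeral_eq_Suc lift_def gen_defs sum_3 field_simps)+

lemma jones_wenzl_4:
  "is_jones_wenzl q0 4 (jones_wenzl q0 4)" "potts (jones_wenzl q0 4) m = potts jw4 m"
proof -
  \<comment> \<open>The image of a constant under the box serves as a nonzero vector killed by all
    three caps.\<close>
  have 1: "(\<lambda>p :: 3 stream. potts (Box 4) 0 (\<lambda>p. 1) p) \<noteq> (\<lambda>p. 0)"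
    by (auto dest!: fun_cong[of _ _ "0 ## 1 ## sconst (0 :: 3)"] simp: box0_def chi_def)
  have 2: "potts Cap i (potts (Box 4) 0 (\<lambda>p. 1)) = (\<lambda>p. 0)" if "i < 3" for i
    using potts_cap_box[OF that, of 0] by simp
  from skein.jones_wenzl_facts[OF HOL.refl HOL.refl HOL.refl jw_data_3 2 1]
  show "is_jones_wenzl q0 4 (jones_wenzl q0 4)" "potts (jones_wenzl q0 4) m = potts jw4 m"
    by (simp_all add: numeral_eq_Suc)
qed

text \<open>
  A vector is the sum of its projection to the span of the box and of vectors in the images of cups,
  and the latter are killed by the Jones--Wenzl projection.
\<close>

lemma potts_jw4:
  assumes dec: "\<phi> = (\<lambda>p. c * potts (Box 4) m \<psi> p + (potts Cup m Y0 p + (potts Cup (m + 1) Y1 p + potts Cup (m + 2) Y2 p)))"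
  shows "potts (jones_wenzl q0 4) m \<phi> = (\<lambda>p. c * potts (Box 4) m \<psi> p)"
proof -
  let ?h = "jones_wenzl q0 4"
  have box: "potts ?h m (potts (Box 4) m \<psi>) = potts (Box 4) m \<psi>"
  proof -
    have "\<forall>m \<psi>. (\<forall>i<3. potts Cap (m + i) \<psi> = (\<lambda>p. 0)) \<longrightarrow> potts jw4 m \<psi> = \<psi>"
      using jw_data_3 unfolding skein.jw_data_def by (elim conjE)
    from this[rule_format, OF potts_cap_box] have "potts jw4 m (potts (Box 4) m \<psi>) = potts (Box 4) m \<psi>" .
    then show ?thesis by (simp only: jones_wenzl_4)
  qed
  have cup: "potts ?h m (potts Cup (m + i) Y) = (\<lambda>p. 0)" if "i < 3" for i Y
  proof -
    have "TL_eq q0 (?h \<odot> (Strands i \<otimes> Cup \<otimes> Strands (2 - i))) (Zero 2 4)"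
      using jones_wenzl_4(1) that unfolding is_jones_wenzl_def by force
    then have "potts (?h \<odot> (Strands i \<otimes> Cup \<otimes> Strands (2 - i))) m = potts (Zero 2 4) m"
      unfolding q0_sum by (rule potts_sound) auto
    from fun_cong[OF this, of Y] show ?thesis by simp
  qed
  show ?thesis
    unfolding dec potts_add potts_scale box using cup[of 0 Y0] cup[of 1 Y1] cup[of 2 Y2] by simp
qed

lemma numerals_3: "(3 :: 3) = 0" "(4 :: 3) = 1" "(- 1 :: 3) = 2" "(- 2 :: 3) = 1" "(- 3 :: 3) = 0"
  by simp_all

lemma SS_even: "potts (S_up 2 \<odot> S_down 2) 0 = potts (2 \<cdot> jones_wenzl q0 4) 0"
proof
  fix \<phi> :: "3 stream \<Rightarrow> complex"
  \<comment> \<open>The \<open>Y1\<close> term is constant in the middle spin, and \<open>Bf\<close>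
    is this constant: the value at the middle spin different from both outer ones (three distinct
    spins add up to 0), or, if \<open>a = c\<close>, the average over two such spins, whose
    antisymmetric rest is the box part. \<open>Y0\<close> and \<open>Y2\<close> correct the values
    where the middle spin equals an outer one.\<close>
  define Bf where "Bf a c s = (if a = c then (\<phi> (a ## (a + 1) ## a ## s) + \<phi> (a ## (a + 2) ## a ## s)) / 2
    else \<phi> (a ## (- a - c) ## c ## s))" for a c s
  define Y0 where "Y0 p = (\<phi> (shd p ## p) - Bf (shd p) (shd (stl p)) (stl (stl p))) / fourth_root_3" for p
  define Y1 where "Y1 p = fourth_root_3 * Bf (shd p) (shd (stl p)) (stl (stl p))" for p
  define Y2 where "Y2 p = (if shd p = shd (stl p) then 0 else
    (\<phi> (shd p ## shd (stl p) ## stl p) - Bf (shd p) (shd (stl p)) (stl (stl p))) / fourth_root_3)" for p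
  show "potts (S_up 2 \<odot> S_down 2) 0 \<phi> = potts (2 \<cdot> jones_wenzl q0 4) 0 \<phi>"
  proof -
    have "\<phi> (a ## b ## c ## s) = 1 / 2 * potts (Box 4) 0 (potts (S_down 2) 0 \<phi>) (a ## b ## c ## s)
      + (potts Cup 0 Y0 (a ## b ## c ## s) + (potts Cup (0 + 1) Y1 (a ## b ## c ## s) + potts Cup (0 + 2) Y2 (a ## b ## c ## s)))" for a b c s
      by (rule exhaust_3'[of a]; rule exhaust_3'[of b]; rule exhaust_3'[of c])
        (simp_all add: potts_S_down gen_defs lift_def Y0_def Y1_def Y2_def Bf_def chi_def sum_3 numerals_3 field_simps)
    from this[of "shd p" "shd (stl p)" "shd (stl (stl p))" "stl (stl (stl p))" for p]
    have "\<phi> = (\<lambda>p. 1 / 2 * potts (Box 4) 0 (potts (S_down 2) 0 \<phi>) p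
      + (potts Cup 0 Y0 p + (potts Cup (0 + 1) Y1 p + potts Cup (0 + 2) Y2 p)))" by (intro ext) (simp only: stream.collapse)
    from potts_jw4[OF this] show ?thesis by (simp add: S_up_def)
  qed
qed

lemma SS_odd: "potts (S_up 2 \<odot> S_down 2) (Suc 0) = potts (2 \<cdot> jones_wenzl q0 4) (Suc 0)"
proof
  fix \<phi> :: "3 stream \<Rightarrow> complex"
  define f where "f z a b s = \<phi> (z ## a ## b ## s)" for z a b s
  \<comment> \<open>Regard \<open>f z a b s\<close> as a matrix in \<open>a\<close> and
    \<open>b\<close>. The diagonal is left to \<open>Y1\<close>. Off the diagonal,
    \<open>g1 b + g2 a\<close> is the additive fit with the same row sums \<open>ro\<close> and
    column sums \<open>co\<close>; a remainder whose row and column sums vanish is a multiple of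
    \<open>chi (b - a)\<close>, the box part.\<close>
  define ro where "ro z a s = f z a (a + 1) s + f z a (a + 2) s" for z a s
  define co where "co z a s = f z (a + 1) a s + f z (a + 2) a s" for z a s
  define U where "U z s = ro z 0 s + ro z 1 s + ro z 2 s" for z s
  define g1 where "g1 z b s = (2 * co z b s + ro z b s) / 3 - U z s / 4" for z b s
  define g2 where "g2 z a s = (2 * ro z a s + co z a s) / 3 - U z s / 4" for z a s
  define Y0 where "Y0 p = fourth_root_3 * g1 (shd p) (shd (stl p)) (stl (stl p))" for p
  define Y2 where "Y2 p = fourth_root_3 * g2 (shd p) (shd (stl p)) (stl (stl p))" for p
  define Y1 where "Y1 p = (f (shd p) (shd (stl p)) (shd (stl p)) (stl (stl p))
    - g1 (shd p) (shd (stl p)) (stl (stl p)) - g2 (shd p) (shd (stl p)) (stl (stl p))) / fourth_root_3" for p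
  show "potts (S_up 2 \<odot> S_down 2) (Suc 0) \<phi> = potts (2 \<cdot> jones_wenzl q0 4) (Suc 0) \<phi>"
  proof -
    have "\<phi> (z ## a ## b ## s) = 1 / 2 * potts (Box 4) (Suc 0) (potts (S_down 2) (Suc 0) \<phi>) (z ## a ## b ## s)
      + (potts Cup (Suc 0) Y0 (z ## a ## b ## s) + (potts Cup (Suc 0 + 1) Y1 (z ## a ## b ## s) + potts Cup (Suc 0 + 2) Y2 (z ## a ## b ## s)))" for z a b s
    proof -
      have r3: "\<i> / r3 * x * (\<i> / r3 * y) = - x * y / 3" for x y
        using r3_sq by (simp add: field_simps)
      have box: "potts (Box 4) (Suc 0) (potts (S_down 2) (Suc 0) \<phi>) (z ## a ## b ## s) =
        - chi (b - a) * (\<Sum>x\<in>UNIV. \<Sum>y\<in>UNIV. chi (x - y) * f z x y s) / 3"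
        by (simp only: potts.simps shifted.simps box1_def potts_S_down r3 stream.sel f_def)
      show ?thesis
        unfolding box f_def[symmetric]
        by (rule exhaust_3'[of a]; rule exhaust_3'[of b])
          (simp_all add: gen_defs lift_def Y0_def Y1_def Y2_def g1_def g2_def U_def ro_def co_def
            chi_def sum_3 numerals_3 field_simps)
    qed
    from this[of "shd p" "shd (stl p)" "shd (stl (stl p))" "stl (stl (stl p))" for p]
    have "\<phi> = (\<lambda>p. 1 / 2 * potts (Box 4) (Suc 0) (potts (S_down 2) (Suc 0) \<phi>) p
      + (potts Cup (Suc 0) Y0 p + (potts Cup (Suc 0 + 1) Y1 p + potts Cup (Suc 0 + 2) Y2 p)))" by (intro ext) (simp only: stream.collapse)
    from potts_jw4[OF this] show ?thesis by (simp add: S_up_def)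
  qed
qed

lemma D_relations_sound:
  assumes "(t, u) \<in> D_relations 2"
  shows "potts t m = potts u m"
proof -
  consider "t = bend 4 (Box 4)" "u = \<i> \<cdot> Box 4"
    | i j where "i + 2 + j = 4" "t = (Strands i \<otimes> Cap \<otimes> Strands j) \<odot> Box 4" "u = Zero 0 (i + j)"
    | "t = S_up 2 \<odot> S_down 2" "u = 2 \<cdot> jones_wenzl q0 4"
    using assms by (auto simp: D_relations_def S_up_def qnum_3 simp flip: q0_def)
  then show ?thesis
  proof cases
    case 1
    then show ?thesis using potts_bend_box by simp
  next
    case 2
    then show ?thesis using potts_cap_box[of i m] by (auto simp: fun_eq_iff)
  next
    case 3
    then show ?thesis using potts_eqI[OF SS_even SS_odd] by simp
  qed
qed

lemma D_sound: "D_eq 2 t u \<Longrightarrow> potts t m = potts u m"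
  using potts_sound[of "{4}" "D_relations 2" t u m] D_relations_sound
  by (simp add: qnum_2 flip: q0_def)

section \<open>Cabled diagrams in the Potts model\<close>

lemma potts_even: "potts t (2 * i) \<psi> p = potts t 0 (\<lambda>q. \<psi> (stake i p @- q)) (sdrop i p)"
  by (induction i arbitrary: \<psi> p) (simp_all add: potts_Suc_Suc lift_def)

text \<open>For \<open>e = - q0\<close> and \<open>e = - inverse q0\<close> this is the power \<open>x\<close> of \<open>q0 ^ 4\<close> and of its inverse.\<close>

definition braid_phase :: "complex \<Rightarrow> 3 \<Rightarrow> complex" where
  "braid_phase e x = (if x = 0 then 1 else if x = 1 then - r3 * e - 2 else r3 * e + 1)"

text \<open>Matrix entry of a 2-cabled crossing between fixed outer spins \<open>l\<close> and
  \<open>r\<close>, stripped of scalar prefactors. Of its four crossings the first and the last move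
  the middle spin, and the two between them are diagonal.\<close>

definition crossing_kernel :: "complex \<Rightarrow> 3 \<Rightarrow> 3 \<Rightarrow> 3 \<Rightarrow> 3 \<Rightarrow> complex" where
  "crossing_kernel e l r m' m = (\<Sum>x\<in>UNIV. ((if m' = x then 1 else 0) + (- 1 - e * r3 / 3)) * (e + (if l = x then r3 else 0))
     * (e + (if x = r then r3 else 0)) * ((if x = m then 1 else 0) + (- 1 - e * r3 / 3)))"

text \<open>A finite check over four spins from the quadratic equations of \<open>e\<close> and
  \<open>r3\<close>. Reflection of the middle spin means that the differences on the two strands
  change places.\<close>

lemma crossing_kernel_eq:
  assumes e: "e * e = - (r3 * e) - 1"
  shows "crossing_kernel e l r m' m = (if m' + m = l + r then braid_phase e ((m' - l) * (r - m')) else 0)"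
proof -
  have e': "e * (e * x) = - (r3 * (e * x)) - x" for x
    using arg_cong[OF e, of "\<lambda>y. y * x"] by (simp add: algebra_simps)
  have r': "r3 * (r3 * x) = 3 * x" for x
    using arg_cong[OF r3_sq, of "\<lambda>y. y * x"] by (simp add: algebra_simps)
  show ?thesis
    unfolding crossing_kernel_def sum_3
    by (rule exhaust_3'[of l]; rule exhaust_3'[of r]; rule exhaust_3'[of m']; rule exhaust_3'[of m])
      (simp_all add: braid_phase_def numerals_3 algebra_simps e e' r3_sq r' add_divide_distrib diff_divide_distrib)
qed

lemma potts_crossing_ops:
  assumes X: "X = \<alpha> \<cdot> Strands 2 \<oplus> \<beta> \<cdot> (Cup \<odot> Cap)" and ab: "\<alpha> * \<beta> = 1"
    and e: "\<alpha> * \<alpha> = e" "e * e = - (r3 * e) - 1"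
  shows "potts (cross_cables X 2 2) 0 \<psi> p =
    braid_phase e ((shd (stl p) - shd p) * (shd (stl (stl p)) - shd (stl p)))
      * \<psi> (shd p ## (shd p + shd (stl (stl p)) - shd (stl p)) ## stl (stl p))"
proof -
  obtain l m r z where p: "p = l ## m ## r ## z" by (metis stream.collapse)
  have h: "\<beta> * \<beta> = - r3 - e"
  proof -
    have "e * (\<beta> * \<beta>) = 1" using ab e(1) by (metis mult.assoc mult.commute mult.left_neutral)
    moreover have "e * (- r3 - e) = 1" using e(2) by (simp add: algebra_simps)
    ultimately show ?thesis by (metis mult_cancel_left mult_zero_left zero_neq_one)
  qed
  have X1: "potts X (Suc 0) \<phi> (a ## b ## q) = (\<Sum>x\<in>UNIV. \<alpha> * ((if b = x then 1 else 0) + (- 1 - e * r3 / 3)) * \<phi> (a ## x ## q))" for \<phi> a b q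
  proof -
    have "\<beta> / r3 = \<alpha> * (- 1 - e * r3 / 3)"
    proof -
      have "\<beta> = \<alpha> * (\<beta> * \<beta>)" using ab by (simp add: mult.assoc[symmetric])
      then have "\<beta> / r3 = \<alpha> * ((- r3 - e) / r3)" by (simp add: h)
      also have "(- r3 - e) / r3 = - 1 - e * r3 / 3" using r3_sq by (simp add: field_simps)
      finally show ?thesis .
    qed
    moreover have "potts X (Suc 0) \<phi> (a ## b ## q) = \<alpha> * \<phi> (a ## b ## q) + \<beta> / r3 * (\<Sum>x\<in>UNIV. \<phi> (a ## x ## q))"
      by (simp add: X gen_defs fourth_root_3_sq sum_3 field_simps)
    ultimately have "potts X (Suc 0) \<phi> (a ## b ## q) = \<alpha> * \<phi> (a ## b ## q) + \<alpha> * (- 1 - e * r3 / 3) * (\<Sum>x\<in>UNIV. \<phi> (a ## x ## q))"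
      by simp
    also have "\<dots> = (\<Sum>x\<in>UNIV. \<alpha> * ((if b = x then 1 else 0) + (- 1 - e * r3 / 3)) * \<phi> (a ## x ## q))"
    proof -
      have "\<alpha> * \<phi> (a ## b ## q) + \<alpha> * \<delta> * (\<Sum>x\<in>UNIV. \<phi> (a ## x ## q))
        = (\<Sum>x\<in>UNIV. \<alpha> * ((if b = x then 1 else 0) + \<delta>) * \<phi> (a ## x ## q))" for \<delta>
        by (rule exhaust_3'[of b]) (simp_all add: sum_3 algebra_simps)
      then show ?thesis .
    qed
    finally show ?thesis .
  qed
  \<comment> \<open>The odd crossings are normalized by \<alpha> and the even ones by \<beta>; with
    two of each, the prefactors multiply to 1.\<close>
  have be: "\<alpha> = \<beta> * e" using ab e(1) by (metis mult.assoc mult.commute mult.left_neutral)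
  have X0: "potts X 0 \<phi> (a ## b ## q) = \<beta> * (e + (if a = b then r3 else 0)) * \<phi> (a ## b ## q)" for \<phi> a b q
    by (simp add: X gen_defs be fourth_root_3_sq[symmetric] algebra_simps)
  have X2: "potts X 2 \<phi> (a ## b ## c ## q) = \<beta> * (e + (if b = c then r3 else 0)) * \<phi> (a ## b ## c ## q)" for \<phi> a b c q
    using potts_Suc_Suc[of X 0] by (simp add: numeral_2_eq_2 lift_def X0)
  have "potts (cross_cables X 2 2) 0 \<psi> p = potts X (Suc 0) (potts X 0 (potts X 2 (potts X (Suc 0) \<psi>))) p"
    by (simp add: numeral_2_eq_2)
  also have "\<dots> = (\<Sum>x\<in>UNIV. \<Sum>y\<in>UNIV. \<alpha> * ((if m = x then 1 else 0) + (- 1 - e * r3 / 3))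
      * (\<beta> * (e + (if l = x then r3 else 0)) * (\<beta> * (e + (if x = r then r3 else 0))
        * (\<alpha> * ((if x = y then 1 else 0) + (- 1 - e * r3 / 3)) * \<psi> (l ## y ## r ## z)))))"
    unfolding p X1 X0 X2 by (simp add: sum_distrib_left)
  also have "\<dots> = (\<Sum>y\<in>UNIV. (\<alpha> * \<beta>) * (\<alpha> * \<beta>) * crossing_kernel e l r m y * \<psi> (l ## y ## r ## z))"
    unfolding crossing_kernel_def sum_distrib_left sum_distrib_right
    by (subst sum.swap) (simp add: mult_ac)
  also have "\<dots> = braid_phase e ((m - l) * (r - m)) * \<psi> (l ## (l + r - m) ## r ## z)"
  proof -
    have "(\<alpha> * \<beta>) * (\<alpha> * \<beta>) * crossing_kernel e l r m y * \<psi> (l ## y ## r ## z) =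
      (if l + r - m = y then braid_phase e ((m - l) * (r - m)) * \<psi> (l ## (l + r - m) ## r ## z) else 0)" for y
      by (auto simp: crossing_kernel_eq[OF e(2)] ab algebra_simps)
    then show ?thesis by simp
  qed
  finally show ?thesis by (simp add: p)
qed

text \<open>
  A slice maps the value at the spins \<open>below sl x p\<close> to the value at the spins \<open>p\<close>. The spin \<open>x\<close> is
  created by a cap; in the other cases it is a dummy, fixed to \<open>0\<close> by \<open>coef\<close>.
\<close>

fun below :: "slice \<Rightarrow> 3 \<Rightarrow> 3 stream \<Rightarrow> 3 stream" where
  "below (CupAt i u) x p = stake i p @- sdrop (i + 2) p"
| "below (CapAt i) x p = stake i p @- p !! i ## x ## sdrop i p"
| "below (CrossAt i b) x p = stake i p @- p !! i ## (p !! i + p !! (i + 2) - p !! (i + 1)) ## sdrop (i + 2) p"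

fun coef :: "slice \<Rightarrow> 3 \<Rightarrow> 3 stream \<Rightarrow> complex" where
  "coef (CupAt i u) x p = (if x = 0 \<and> p !! i = p !! (i + 2) then 1 else 0)"
| "coef (CapAt i) x p = 1"
| "coef (CrossAt i b) x p = (if x = 0 then
     braid_phase (if b then - q0 else - inverse q0) ((p !! (i + 1) - p !! i) * (p !! (i + 2) - p !! (i + 1))) else 0)"

text \<open>A doubled cup or cap contains one of each shading, so the fourth roots cancel and no
  local weight remains. At a crossing, \<open>e\<close> is the square of the coefficient of the
  identity.\<close>

lemma potts_slice:
  assumes s: "s * s = q0"
  shows "potts (cabled_slice 2 s sl w) 0 \<psi> p = (\<Sum>x\<in>UNIV. coef sl x p * \<psi> (below sl x p))"
proof (cases sl)
  case (CupAt i u)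
  have 1: "potts (nested_cups 2) 0 \<phi> q = (if shd q = shd (stl (stl q)) then \<phi> (sdrop 2 q) else 0)" for \<phi> q
    by (auto simp: numeral_2_eq_2 gen_defs)
  have 2: "potts (cabled_slice 2 s sl w) 0 \<psi> p = potts (nested_cups 2) (2 * i) \<psi> p" by (simp add: CupAt)
  show ?thesis
    unfolding 2 potts_even 1 by (simp add: CupAt numeral_2_eq_2 sum_3)
next
  case (CapAt i)
  have 1: "potts (nested_caps 2) 0 \<phi> q = (\<Sum>x\<in>UNIV. \<phi> (shd q ## x ## q))" for \<phi> q
    by (auto simp: numeral_2_eq_2 gen_defs sum_3 field_simps)
  have 2: "potts (cabled_slice 2 s sl w) 0 \<psi> p = potts (nested_caps 2) (2 * i) \<psi> p" by (simp add: CapAt)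
  show ?thesis
    unfolding 2 potts_even 1 by (simp add: CapAt)
next
  case (CrossAt i b)
  have e1: "- q0 * - q0 = - (r3 * - q0) - 1"
    by (simp add: q0_sq)
  have e2: "- inverse q0 * - inverse q0 = - (r3 * - inverse q0) - 1"
  proof -
    have "(q0 + inverse q0) * inverse q0 = 1 + inverse q0 * inverse q0" by (simp only: distrib_right) simp
    then show ?thesis unfolding q0_sum by simp
  qed
  have snz: "s \<noteq> 0" using s by auto
  have 1: "potts (cross_cables (crossing s b) 2 2) 0 \<phi> q = braid_phase (if b then - q0 else - inverse q0)
      ((shd (stl q) - shd q) * (shd (stl (stl q)) - shd (stl q)))
      * \<phi> (shd q ## (shd q + shd (stl (stl q)) - shd (stl q)) ## stl (stl q))" for \<phi> q
  proof (cases b)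
    case True
    have "\<i> * s * (\<i> * s) = (\<i> * \<i>) * (s * s)" by (simp only: mult_ac)
    then have 2: "\<i> * s * (\<i> * s) = - q0" using s by simp
    have 1: "\<i> * s * (- \<i> * inverse s) = 1" using snz by (simp add: field_simps)
    show ?thesis
      using potts_crossing_ops[OF _ 1 2 e1, of "crossing s b"] True by (simp add: crossing_def)
  next
    case False
    have "- \<i> * inverse s * (- \<i> * inverse s) = (\<i> * \<i>) * inverse (s * s)"
      by (simp add: mult_ac)
    then have 2: "- \<i> * inverse s * (- \<i> * inverse s) = - inverse q0" using s by simp
    have 1: "- \<i> * inverse s * (\<i> * s) = 1" using snz by (simp add: field_simps)
    show ?thesis
      using potts_crossing_ops[OF _ 1 2 e2, of "crossing s b"] False by (simp add: crossing_def)
  qed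
  have 2: "potts (cabled_slice 2 s sl w) 0 \<psi> p = potts (cross_cables (crossing s b) 2 2) (2 * i) \<psi> p" by (simp add: CrossAt)
  show ?thesis
    unfolding 2 potts_even 1 by (simp add: CrossAt sum_3 numeral_2_eq_2)
qed

lemma nested_cups_type [simp]: "bots (nested_cups k) = 0" "tops (nested_cups k) = 2 * k" "typed K (nested_cups k)"
  by (induction k) auto

lemma nested_caps_type [simp]: "tops (nested_caps k) = 0" "bots (nested_caps k) = 2 * k" "typed K (nested_caps k)"
  by (induction k) auto

text \<open>The weights are left general so that the projection can be split into colours and colour
  conditions can be added at further points.\<close>

primrec state_sum :: "(nat \<times> nat \<Rightarrow> 3 \<Rightarrow> complex) \<Rightarrow> diagram \<Rightarrow> nat \<Rightarrow> 3 stream \<Rightarrow> complex" where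
  "state_sum W D 0 = (\<lambda>p. 1)"
| "state_sum W D (Suc j) = (\<lambda>p. (\<Prod>r<length (row D (Suc j)). W (Suc j, r) (p !! Suc r - p !! r)) *
     (\<Sum>x\<in>UNIV. coef (D ! j) x p * state_sum W D j (below (D ! j) x p)))"

lemma potts_foldr_diag:
  assumes "\<And>r k \<psi> p. r < length ts \<Longrightarrow> potts (ts ! r) (2 * k) \<psi> p = g r (p !! Suc k - p !! k) * \<psi> p"
    and "\<And>r. r < length ts \<Longrightarrow> bots (ts ! r) = 2"
  shows "potts (foldr (\<otimes>) ts (Strands 0)) (2 * i) \<psi> p = (\<Prod>r<length ts. g r (p !! Suc (i + r) - p !! (i + r))) * \<psi> p"
  using assms
proof (induction ts arbitrary: i g \<psi> p)
  case (Cons t ts)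
  have "potts (foldr (\<otimes>) ts (Strands 0)) (2 * Suc i) \<psi> p = (\<Prod>r<length ts. g (Suc r) (p !! Suc (Suc i + r) - p !! (Suc i + r))) * \<psi> p" for \<psi> p
    by (rule Cons.IH[of "\<lambda>r. g (Suc r)"]) (use Cons.prems(1)[of "Suc r" for r] Cons.prems(2)[of "Suc r" for r] in auto)
  moreover have "potts t (2 * i) \<psi> p = g 0 (p !! Suc i - p !! i) * \<psi> p" for \<psi> p
    using Cons.prems(1)[of 0] by simp
  moreover have "bots t = 2" using Cons.prems(2)[of 0] by simp
  ultimately show ?case
    by (simp add: prod.lessThan_Suc_shift del: prod.lessThan_Suc)
qed simp

abbreviation f2 :: tangle where "f2 \<equiv> jones_wenzl q0 2"

lemma f2_type: "typed {} f2" "bots f2 = 2" "tops f2 = 2"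
  using jones_wenzl_2(1) by (auto simp: is_jones_wenzl_def hom_iff)

text \<open>At an even position, a cup above a cap is \<open>r3\<close> times the indicator of equal
  spins; subtracting it divided by \<open>r3\<close> leaves the unequal ones.\<close>

lemma potts_f2_0: "potts f2 0 \<psi> p = (if shd (stl p) - shd p = 0 then 0 else 1) * \<psi> p"
  unfolding jones_wenzl_2(2) jw2_def wenzl_def
  by (simp add: gen_defs fourth_root_3_sq)

lemma potts_f2: "potts f2 (2 * k) \<psi> p = (if p !! Suc k - p !! k = 0 then 0 else 1) * \<psi> p"
  by (simp add: potts_even potts_f2_0 stake_sdrop) 

text \<open>A half turn reverses the difference of the two spins, and being nonzero is symmetric.
  Hence the inserted projection does not see the orientation.\<close>

lemma potts_half_turn_f2: "potts (half_turn 2 f2) (2 * k) \<psi> p = (if p !! Suc k - p !! k = 0 then 0 else 1) * \<psi> p"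
proof -
  have lift2: "potts t 2 = lift (potts t 0)" for t using potts_Suc_Suc[of t 0] by (simp add: numeral_2_eq_2)
  have ncups: "potts (nested_cups 2) 0 \<phi> q = (if shd q = shd (stl (stl q)) then \<phi> (stl (stl q)) else 0)" for \<phi> q
    by (auto simp: numeral_2_eq_2 gen_defs)
  have ncaps: "potts (nested_caps 2) 0 \<phi> q = (\<Sum>x\<in>UNIV. \<phi> (shd q ## x ## q))" for \<phi> q
    by (auto simp: numeral_2_eq_2 gen_defs sum_3 field_simps)
  have "potts (half_turn 2 f2) 0 \<psi> p = potts (nested_caps 2) 2 (potts f2 2 (potts (nested_cups 2) 0 \<psi>)) p" for \<psi> p
    by (simp add: half_turn_def f2_type flip: numeral_2_eq_2)
  then have 0: "potts (half_turn 2 f2) 0 \<psi> p = (if shd (stl p) - shd p = 0 then 0 else 1) * \<psi> p" for \<psi> p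
  proof -
    assume *: "\<And>\<psi> p. potts (half_turn 2 f2) 0 \<psi> p = potts (nested_caps 2) 2 (potts f2 2 (potts (nested_cups 2) 0 \<psi>)) p"
    have "potts (half_turn 2 f2) 0 \<psi> p = (\<Sum>x\<in>UNIV. if shd p = x then (if x = shd (stl p) then 0 else \<psi> (x ## stl p)) else 0)"
      unfolding * lift2 lift_def ncaps ncups potts_f2_0 by (intro sum.cong HOL.refl) auto
    then show ?thesis by simp
  qed
  then show ?thesis
    by (simp add: potts_even 0 stake_sdrop)
qed

lemma potts_cabled_part:
  assumes s: "s * s = q0"
  shows "potts (cabled_part 2 s f2 D B j) 0 (\<lambda>p. 1) =
    state_sum (\<lambda>x v. if x \<in> B then (if v = 0 then 0 else 1) else 1) D j"
proof (induction j)
  case (Suc j)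
  have "potts (cabled_row 2 f2 D B j) (2 * 0) \<psi> p = (\<Prod>r<length (row D j).
      if (j, r) \<in> B then (if p !! Suc r - p !! r = 0 then 0 else 1) else 1) * \<psi> p" for j \<psi> p
  proof -
    let ?ts = "map (\<lambda>r. if (j, r) \<in> B then if row D j ! r then f2 else half_turn 2 f2 else Strands 2)
      [0..<length (row D j)]"
    have "bots (half_turn 2 f2) = 2" by (simp add: half_turn_def f2_type)
    then have "potts (foldr (\<otimes>) ?ts (Strands 0)) (2 * 0) \<psi> p = (\<Prod>r<length ?ts.
      (if (j, r) \<in> B then (if p !! Suc (0 + r) - p !! (0 + r) = 0 then 0 else 1) else 1)) * \<psi> p"
      by (intro potts_foldr_diag[where g = "\<lambda>r v. if (j, r) \<in> B then (if v = 0 then 0 else 1) else 1"])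
        (auto simp: potts_f2 potts_half_turn_f2 f2_type simp del: snth.simps(2) right_minus_eq)
    then show ?thesis unfolding cabled_row_def by (simp cong: if_cong)
  qed
  from this[of "Suc j"] show ?case
    using Suc by (simp add: potts_slice[OF s] fun_eq_iff)
qed simp

section \<open>Transport of colours along a knot\<close>

lemma stake_shift_snth: "(stake i p @- q) !! r = (if r < i then p !! r else q !! (r - i))"
  by (induction i arbitrary: p r) (auto simp: less_Suc_eq_0_disj nth_Cons' Suc_less_eq2 gr0_conv_Suc split: nat.splits)

lemma below_Cup_snth: "below (CupAt i u) x p !! r = (if r < i then p !! r else p !! (r + 2))"
  by (simp only: below.simps stake_shift_snth sdrop_snth) (auto intro: arg_cong[where f = "snth p"])

lemma below_Cap_snth: "below (CapAt i) x p !! r =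
  (if r \<le> i then p !! r else if r = Suc i then x else p !! (r - 2))"
proof -
  consider "r < i" | "r = i" | "r = Suc i" | "r - i = Suc (Suc (r - i - 2))" "i + 2 \<le> r" by linarith
  then show ?thesis
  proof cases
    case 4
    have "sdrop i p !! (r - i - 2) = p !! (i + (r - i - 2))" by (rule sdrop_snth)
    also have "i + (r - i - 2) = r - 2" using 4 by simp
    finally show ?thesis using 4 by (simp only: below.simps stake_shift_snth snth.simps stream.sel) auto
  qed (simp_all only: below.simps stake_shift_snth, simp_all)
qed

lemma below_Cross_snth: "below (CrossAt i b) x p !! r =
  (if r = Suc i then p !! i + p !! (i + 2) - p !! (i + 1) else p !! r)"
proof -
  consider "r < i" | "r = i" | "r = Suc i" | "r - i = Suc (Suc (r - i - 2))" "i + 2 \<le> r" by linarith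
  then show ?thesis
  proof cases
    case 4
    have "sdrop (i + 2) p !! (r - i - 2) = p !! ((i + 2) + (r - i - 2))" by (rule sdrop_snth)
    also have "i + 2 + (r - i - 2) = r" using 4 by simp
    finally show ?thesis using 4 by (simp only: below.simps stake_shift_snth snth.simps stream.sel) auto
  qed (simp_all only: below.simps stake_shift_snth, simp_all)
qed

text \<open>Through a cup or cap both the difference and the vertical direction are reversed; the
  sign makes the colour constant along the strand.\<close>

definition color :: "bool list \<Rightarrow> nat \<Rightarrow> 3 stream \<Rightarrow> 3" where
  "color v r p = (if v ! r then p !! Suc r - p !! r else - (p !! Suc r - p !! r))"

lemma nth_next_row_Cup:
  assumes "i \<le> length v"
  shows "r < i \<Longrightarrow> next_row (CupAt i u) v ! r = v ! r" "next_row (CupAt i u) v ! i = u"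
    "next_row (CupAt i u) v ! Suc i = (\<not> u)" "i \<le> r \<Longrightarrow> next_row (CupAt i u) v ! Suc (Suc r) = v ! r"
  using assms by (auto simp: nth_append min_def)

lemma nth_next_row_Cap:
  assumes "Suc i < length v"
  shows "r < i \<Longrightarrow> next_row (CapAt i) v ! r = v ! r"
    "i \<le> r \<Longrightarrow> next_row (CapAt i) v ! r = v ! Suc (Suc r)"
  using assms by (auto simp: nth_append min_def)

lemma nth_next_row_Cross:
  assumes "Suc i < length v"
  shows "r \<noteq> i \<Longrightarrow> r \<noteq> Suc i \<Longrightarrow> next_row (CrossAt i b) v ! r = v ! r"
    "next_row (CrossAt i b) v ! i = v ! Suc i" "next_row (CrossAt i b) v ! Suc i = v ! i"
proof -
  assume "r \<noteq> i" "r \<noteq> Suc i"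
  then consider "r < i" | m where "r = Suc (Suc (i + m))"
    by (metis Suc_lessI less_iff_Suc_add linorder_neqE_nat)
  then show "next_row (CrossAt i b) v ! r = v ! r"
    by cases (use assms in \<open>auto simp: nth_append min_def\<close>)
qed (use assms in \<open>auto simp: nth_append min_def\<close>)

text \<open>The regions on both sides of a cup are one region, which only \<open>coef\<close>
  records. The strand just left of the cup has this region on its right, hence the premise on
  \<open>coef\<close> in the second claim.\<close>

lemma color_Cup:
  assumes "i \<le> length v"
  shows "p !! i = p !! (i + 2) \<Longrightarrow> color (next_row (CupAt i u) v) i p = color (next_row (CupAt i u) v) (Suc i) p"
    "r < i \<Longrightarrow> coef (CupAt i u) x p \<noteq> 0 \<Longrightarrow> color v r (below (CupAt i u) x p) = color (next_row (CupAt i u) v) r p"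
    "i \<le> r \<Longrightarrow> color v r (below (CupAt i u) x p) = color (next_row (CupAt i u) v) (Suc (Suc r)) p"
proof -
  assume "p !! i = p !! (i + 2)"
  then show "color (next_row (CupAt i u) v) i p = color (next_row (CupAt i u) v) (Suc i) p"
    unfolding color_def nth_next_row_Cup(2,3)[OF assms] by (simp add: numeral_2_eq_2 del: snth.simps)
next
  assume r: "r < i" and "coef (CupAt i u) x p \<noteq> 0"
  then have "p !! i = p !! (i + 2)" by (auto split: if_splits)
  then have "below (CupAt i u) x p !! Suc r = p !! Suc r" "below (CupAt i u) x p !! r = p !! r"
    using r by (auto simp: below_Cup_snth simp del: below.simps snth.simps) (metis Suc_lessI add_2_eq_Suc')
  then show "color v r (below (CupAt i u) x p) = color (next_row (CupAt i u) v) r p"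
    unfolding color_def nth_next_row_Cup(1)[OF assms r] by (simp del: below.simps snth.simps)
next
  assume r: "i \<le> r"
  then show "color v r (below (CupAt i u) x p) = color (next_row (CupAt i u) v) (Suc (Suc r)) p"
    unfolding color_def nth_next_row_Cup(4)[OF assms r] by (simp add: below_Cup_snth numeral_2_eq_2 del: below.simps snth.simps)
qed

lemma color_Cap:
  assumes "Suc i < length v" "v ! i \<noteq> v ! Suc i"
  shows "color v i (below (CapAt i) x p) = color v (Suc i) (below (CapAt i) x p)"
    "r < i \<Longrightarrow> color (next_row (CapAt i) v) r p = color v r (below (CapAt i) x p)"
    "i \<le> r \<Longrightarrow> color (next_row (CapAt i) v) r p = color v (Suc (Suc r)) (below (CapAt i) x p)"
proof -
  show "color v i (below (CapAt i) x p) = color v (Suc i) (below (CapAt i) x p)"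
    using assms(2) by (auto simp: color_def below_Cap_snth simp del: below.simps snth.simps)
next
  assume r: "r < i"
  then show "color (next_row (CapAt i) v) r p = color v r (below (CapAt i) x p)"
    unfolding color_def nth_next_row_Cap(1)[OF assms(1) r] by (simp add: below_Cap_snth del: below.simps snth.simps)
next
  assume r: "i \<le> r"
  then show "color (next_row (CapAt i) v) r p = color v (Suc (Suc r)) (below (CapAt i) x p)"
    unfolding color_def nth_next_row_Cap(2)[OF assms(1) r] by (simp add: below_Cap_snth numeral_2_eq_2 del: below.simps snth.simps)
qed

lemma color_Cross:
  assumes "Suc i < length v"
  shows "color v i (below (CrossAt i b) x p) = color (next_row (CrossAt i b) v) (Suc i) p"
    "color v (Suc i) (below (CrossAt i b) x p) = color (next_row (CrossAt i b) v) i p"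
    "r \<noteq> i \<Longrightarrow> r \<noteq> Suc i \<Longrightarrow> color v r (below (CrossAt i b) x p) = color (next_row (CrossAt i b) v) r p"
proof -
  show "color v i (below (CrossAt i b) x p) = color (next_row (CrossAt i b) v) (Suc i) p"
    "color v (Suc i) (below (CrossAt i b) x p) = color (next_row (CrossAt i b) v) i p"
    unfolding color_def nth_next_row_Cross(2,3)[OF assms(1)]
    by (auto simp: below_Cross_snth numeral_2_eq_2 simp del: below.simps snth.simps)
next
  assume r: "r \<noteq> i" "r \<noteq> Suc i"
  then show "color v r (below (CrossAt i b) x p) = color (next_row (CrossAt i b) v) r p"
    unfolding color_def nth_next_row_Cross(1)[OF assms(1) r]
    by (auto simp: below_Cross_snth simp del: below.simps snth.simps)
qed

text \<open>The spins are \<open>p\<close> on the upper row and \<open>below sl x p\<close> on the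
  lower one. The case distinctions arise since an arc may have both ends on one row.\<close>

lemma color_arc:
  assumes "fits sl v" "coef sl x p \<noteq> 0" "slice_arc sl j (a, r) (a', r')"
  shows "(if a = Suc j then color (next_row sl v) r p else color v r (below sl x p)) =
    (if a' = Suc j then color (next_row sl v) r' p else color v r' (below sl x p))"
proof (cases sl)
  case (CupAt i u)
  then have i: "i \<le> length v" and p: "p !! i = p !! (i + 2)" using assms(1,2) by (auto split: if_splits)
  from assms(3) consider "a = Suc j" "a' = Suc j" "r = i" "r' = Suc i"
    | "a = j" "a' = Suc j" "r < i" "r' = r" | "a = j" "a' = Suc j" "i \<le> r" "r' = r + 2"
    unfolding CupAt by auto
  then show ?thesis
    by cases (use color_Cup(1)[OF i p, of u] color_Cup(2)[OF i, of r u x p] color_Cup(3)[OF i, of r u x p] assms(2) CupAt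
      in \<open>simp_all del: below.simps coef.simps next_row.simps\<close>)
next
  case (CapAt i)
  then have i: "Suc i < length v" "v ! i \<noteq> v ! Suc i" using assms(1) by auto
  from assms(3) consider "a = j" "a' = j" "r = i" "r' = Suc i"
    | "a = j" "a' = Suc j" "r < i" "r' = r" | "a = j" "a' = Suc j" "i \<le> r'" "r = r' + 2"
    unfolding CapAt by auto
  then show ?thesis
    by cases (use color_Cap(1)[OF i, of x p] color_Cap(2)[OF i, of r p x] color_Cap(3)[OF i, of r' p x] CapAt in \<open>simp_all del: below.simps next_row.simps\<close>)
next
  case (CrossAt i b)
  then have i: "Suc i < length v" using assms(1) by auto
  from assms(3) consider "a = j" "a' = Suc j" "r = i" "r' = Suc i"
    | "a = j" "a' = Suc j" "r = Suc i" "r' = i" | "a = j" "a' = Suc j" "r \<noteq> i" "r \<noteq> Suc i" "r' = r"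
    unfolding CrossAt by auto
  then show ?thesis
    by cases (use color_Cross(1,2)[OF i, of b x p] color_Cross(3)[OF i, of r b x p] CrossAt in \<open>simp_all del: below.simps next_row.simps\<close>)
qed

definition color_weight :: "diagram \<Rightarrow> 3 \<Rightarrow> (nat \<times> nat) set \<Rightarrow> nat \<times> nat \<Rightarrow> 3 \<Rightarrow> complex" where
  "color_weight D c I x v = (if x \<in> I then (if (if row D (fst x) ! snd x then v else - v) = c then 1 else 0) else 1)"

definition good :: "diagram \<Rightarrow> 3 \<Rightarrow> (nat \<times> nat) set \<Rightarrow> nat \<Rightarrow> 3 stream \<Rightarrow> bool" where
  "good D c I j p \<longleftrightarrow> (\<forall>r < length (row D j). (j, r) \<in> I \<longrightarrow> color (row D j) r p = c)"

lemma row_0 [simp]: "row D 0 = []"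
  by (simp add: row_def)

lemma row_Suc: "j < length D \<Longrightarrow> row D (Suc j) = next_row (D ! j) (row D j)"
  by (simp add: row_def take_Suc_conv_app_nth)

lemma prod_indicator: "finite A \<Longrightarrow> (\<Prod>x\<in>A. if P x then 1 else (0 :: complex)) = (if \<forall>x\<in>A. P x then 1 else 0)"
  by (induction A rule: finite_induct) auto

lemma state_sum_Wc_Suc:
  "state_sum (color_weight D c I) D (Suc j) p = (if good D c I (Suc j) p
     then \<Sum>x\<in>UNIV. coef (D ! j) x p * state_sum (color_weight D c I) D j (below (D ! j) x p) else 0)"
proof -
  have "color_weight D c I (Suc j, r) (p !! Suc r - p !! r) = (if (Suc j, r) \<in> I \<longrightarrow> color (row D (Suc j)) r p = c then 1 else 0)" for r
    by (simp add: color_weight_def color_def)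
  then show ?thesis
    by (simp add: prod_indicator good_def del: snth.simps) auto
qed

lemma state_sum_good: "state_sum (color_weight D c I) D j p \<noteq> 0 \<Longrightarrow> good D c I j p"
  by (cases j) (auto simp: state_sum_Wc_Suc good_def simp del: state_sum.simps(2) split: if_splits)

lemma state_sum_cong:
  assumes "\<And>k r v. k \<le> j \<Longrightarrow> W (k, r) v = W' (k, r) v"
  shows "state_sum W D j = state_sum W' D j"
  using assms by (induction j) simp_all

lemma state_sum_cong_from:
  assumes "state_sum W D j = state_sum W' D j" "j \<le> k" "\<And>k r v. j < k \<Longrightarrow> W (k, r) v = W' (k, r) v"
  shows "state_sum W D k = state_sum W' D k"
  using assms(2)
proof (induction k rule: dec_induct)
  case base
  show ?case by (rule assms(1))
next
  case (step k)
  then show ?case using assms(3)[of "Suc k"] by simp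
qed

lemma slice_arc_rows: "slice_arc sl j x y \<Longrightarrow> fst x \<in> {j, Suc j} \<and> fst y \<in> {j, Suc j}"
  by (cases sl) auto

text \<open>
  The colour condition at one end of an arc implies the one at the other end, so it may be imposed
  there as well.
\<close>

lemma propagate:
  assumes D: "link_diagram D" and yz: "(y, z) \<in> arcs D \<union> (arcs D)\<inverse>" and y: "y \<in> I"
  shows "state_sum (color_weight D c (insert z I)) D (length D) = state_sum (color_weight D c I) D (length D)"
proof -
  obtain j where j: "j < length D" "slice_arc (D ! j) j y z \<or> slice_arc (D ! j) j z y"
    and pts: "y \<in> points D" "z \<in> points D"
    using yz by (auto simp: arcs_def)
  obtain a r a' r' where yz_eq: "y = (a, r)" "z = (a', r')" by fastforce
  have rows: "a \<in> {j, Suc j}" "a' \<in> {j, Suc j}"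
    using j(2) slice_arc_rows[of "D ! j" j] yz_eq by fastforce+
  have r: "r < length (row D a)" "r' < length (row D a')"
    using pts yz_eq by (auto simp: points_def)
  let ?A = "\<lambda>k. state_sum (color_weight D c (insert z I)) D k" and ?B = "\<lambda>k. state_sum (color_weight D c I) D k"
  have W: "color_weight D c (insert z I) (k, s) v = color_weight D c I (k, s) v" if "k \<noteq> a'" for k s v
    using that yz_eq by (simp add: color_weight_def)
  have fits: "fits (D ! j) (row D j)" using D j by (simp add: link_diagram_def)
  have key: "(if a' = Suc j then color (row D (Suc j)) r' p else color (row D j) r' (below (D ! j) x p)) = c"
    if g: "good D c I (Suc j) p" and nz: "coef (D ! j) x p \<noteq> 0" "?B j (below (D ! j) x p) \<noteq> 0" for p x
  proof -
    have "(if a = Suc j then color (row D (Suc j)) r p else color (row D j) r (below (D ! j) x p)) = c"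
      using g state_sum_good[OF nz(2)] rows(1) r(1) y yz_eq by (auto simp: good_def)
    then show ?thesis
      using color_arc[OF fits nz(1), of j a r a' r'] color_arc[OF fits nz(1), of j a' r' a r] j yz_eq
      by (auto simp: row_Suc[OF j(1)])
  qed
  have "?A (Suc j) p = ?B (Suc j) p" for p
  proof (cases "a' = Suc j")
    case True
    \<comment> \<open>With \<open>z\<close> on the upper row, the additional condition removes only
      terms that vanish already.\<close>
    then have Aj: "?A j = ?B j" by (intro state_sum_cong W) simp
    have good: "good D c (insert z I) (Suc j) p \<longleftrightarrow> good D c I (Suc j) p \<and> color (row D (Suc j)) r' p = c"
      using True r yz_eq by (auto simp: good_def)
    show ?thesis
    proof (cases "good D c I (Suc j) p \<and> color (row D (Suc j)) r' p \<noteq> c")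
      case True
      then have "coef (D ! j) x p * ?B j (below (D ! j) x p) = 0" for x
        using key[of p x] \<open>a' = Suc j\<close> by auto
      then have "(\<Sum>x\<in>UNIV. coef (D ! j) x p * ?B j (below (D ! j) x p)) = 0"
        by (intro sum.neutral ballI)
      then show ?thesis using True by (simp add: state_sum_Wc_Suc Aj good del: state_sum.simps)
    next
      case False
      then show ?thesis by (auto simp: state_sum_Wc_Suc Aj good simp del: state_sum.simps)
    qed
  next
    case False
    then have a': "a' = j" using rows by simp
    have good: "good D c (insert z I) (Suc j) p \<longleftrightarrow> good D c I (Suc j) p"
      using a' yz_eq by (simp add: good_def)
    \<comment> \<open>With \<open>z\<close> on the lower row, the additional condition sits inside
      the sum, where \<open>key\<close> applies. Row 0 is empty, so the condition enters in a proper
      step of the recursion.\<close>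
    obtain j' where j': "j = Suc j'" using r a' by (cases j) auto
    have "?A j' = ?B j'" using a' j' by (intro state_sum_cong W) simp
    moreover have "good D c (insert z I) j q \<longleftrightarrow> good D c I j q \<and> color (row D j) r' q = c" for q
      using a' r yz_eq by (auto simp: good_def)
    ultimately have Aj: "?A j q = (if color (row D j) r' q = c then ?B j q else 0)" for q
      unfolding j' by (simp add: state_sum_Wc_Suc del: state_sum.simps)
    have "coef (D ! j) x p * ?A j (below (D ! j) x p) = coef (D ! j) x p * ?B j (below (D ! j) x p)"
      if "good D c I (Suc j) p" for x
      using key[OF that, of x] a' by (auto simp: Aj)
    then have "good D c I (Suc j) p \<Longrightarrow> (\<Sum>x\<in>UNIV. coef (D ! j) x p * ?A j (below (D ! j) x p)) =
      (\<Sum>x\<in>UNIV. coef (D ! j) x p * ?B j (below (D ! j) x p))"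
      by (intro sum.cong HOL.refl)
    then show ?thesis by (simp add: state_sum_Wc_Suc good del: state_sum.simps)
  qed
  then have "?A (Suc j) = ?B (Suc j)" by blast
  then show ?thesis
    by (rule state_sum_cong_from) (use j rows in \<open>auto intro!: W\<close>)
qed

lemma finite_points: "finite (points D)"
proof (rule finite_subset)
  show "points D \<subseteq> (SIGMA j:{..length D}. {..<length (row D j)})" by (auto simp: points_def)
qed auto

text \<open>A maximal set containing \<open>b\<close> on which the colour may be imposed without
  changing the sum is closed under arcs; a knot has one component, so this set consists of all
  points.\<close>

lemma propagate_all:
  assumes D: "knot_diagram D" and b: "b \<in> points D"
  shows "state_sum (color_weight D c {b}) D (length D) = state_sum (color_weight D c (points D)) D (length D)"
proof -
  let ?V = "\<lambda>I. state_sum (color_weight D c I) D (length D)" and ?E = "(arcs D \<union> (arcs D)\<inverse>)\<^sup>*"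
  define F where "F = {I. b \<in> I \<and> I \<subseteq> points D \<and> ?V I = ?V {b}}"
  have "finite F" using finite_points by (auto simp: F_def intro: finite_subset[of _ "Pow (points D)"])
  moreover have "{b} \<in> F" using b by (simp add: F_def)
  ultimately obtain I where I: "I \<in> F" "\<And>J. J \<in> F \<Longrightarrow> I \<subseteq> J \<Longrightarrow> I = J"
    using finite_has_maximal[of F] by blast
  obtain C where C: "components D = {C}"
    using D by (auto simp: knot_diagram_def card_1_singleton_iff)
  have "points D \<subseteq> I"
  proof
    fix x assume "x \<in> points D"
    then have "?E `` {x} = C" "?E `` {b} = C"
      using C b by (auto simp: components_def quotient_def)
    then have "(b, x) \<in> ?E" by blast
    then show "x \<in> I"
    proof (induction rule: rtrancl_induct)
      case base
      then show ?case using I by (simp add: F_def)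
    next
      case (step y z)
      then have "?V (insert z I) = ?V I"
        using D by (intro propagate) (auto simp: knot_diagram_def)
      moreover have "z \<in> points D" using step by (auto simp: arcs_def)
      ultimately have "insert z I \<in> F" using I by (auto simp: F_def)
      then show ?case using I(2) by blast
    qed
  qed
  then show ?thesis using I by (auto simp: F_def)
qed

section \<open>Evaluation with one colour along the whole knot\<close>

lemma q0_4: "q0 ^ 4 = r3 * q0 - 2"
proof -
  have "q0 ^ 4 = (q0 * q0) * (q0 * q0)" by (simp add: power4_eq_xxxx mult.assoc)
  also have "\<dots> = (r3 * q0 - 1) * (r3 * q0 - 1)" by (simp only: q0_sq)
  also have "\<dots> = (r3 * r3) * (q0 * q0) - 2 * (r3 * q0) + 1" by (simp add: algebra_simps)
  also have "\<dots> = r3 * q0 - 2" by (simp only: q0_sq r3_sq) (simp add: algebra_simps)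
  finally show ?thesis .
qed

lemma q0_4_inv: "inverse (q0 ^ 4) = 1 - r3 * q0"
proof -
  have "q0 ^ 4 * (1 - r3 * q0) = 3 * (r3 * q0) - 2 - (r3 * r3) * (q0 * q0)"
    unfolding q0_4 by (simp add: algebra_simps)
  also have "\<dots> = 1" by (simp only: q0_sq r3_sq) (simp add: algebra_simps)
  finally show ?thesis by (rule inverse_unique)
qed

text \<open>\<open>q0 ^ 4\<close> is a primitive cube root of unity, and its expression linear in
  \<open>q0\<close> is the form that \<open>braid_phase\<close> uses.\<close>

lemma braid_phase_values:
  "braid_phase (- q0) 1 = q0 ^ 4" "braid_phase (- q0) (- 1) = inverse (q0 ^ 4)"
  "braid_phase (- inverse q0) 1 = inverse (q0 ^ 4)" "braid_phase (- inverse q0) (- 1) = q0 ^ 4"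
proof -
  have "r3 * (q0 + inverse q0) = 3" unfolding q0_sum by (rule r3_sq)
  then have *: "r3 * inverse q0 = 3 - r3 * q0" by (simp add: algebra_simps)
  show "braid_phase (- inverse q0) 1 = inverse (q0 ^ 4)" "braid_phase (- inverse q0) (- 1) = q0 ^ 4"
    unfolding q0_4_inv by (simp_all add: braid_phase_def q0_4 *)
  show "braid_phase (- q0) 1 = q0 ^ 4" "braid_phase (- q0) (- 1) = inverse (q0 ^ 4)"
    unfolding q0_4_inv by (simp_all add: braid_phase_def q0_4)
qed

text \<open>Exactly one \<open>x\<close> survives; at a cap, \<open>c\<close> determines the
  enclosed spin. At a crossing both differences are \<open>c\<close> or \<open>- c\<close>, so their
  product is 1 or -1 according to whether the strands have the same vertical direction; together
  with \<open>b\<close> this is the crossing sign.\<close>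

lemma sum_slice_good:
  assumes fits: "fits sl v" and c: "c * c = 1"
    and g: "\<And>r. r < length (next_row sl v) \<Longrightarrow> color (next_row sl v) r p = c"
  shows "(\<Sum>x\<in>UNIV. coef sl x p * (if \<forall>r<length v. color v r (below sl x p) = c then A else 0)) =
    (q0 ^ 4) powi crossing_sign sl v * A"
proof (cases sl)
  case (CupAt i u)
  then have i: "i \<le> length v" using fits by simp
  have "color (next_row (CupAt i u) v) i p = color (next_row (CupAt i u) v) (Suc i) p"
    using g[of i] g[of "Suc i"] i by (simp add: CupAt)
  then have p: "p !! i = p !! (i + 2)"
    unfolding color_def nth_next_row_Cup(2,3)[OF i]
    by (cases u) (simp_all add: numeral_2_eq_2 del: snth.simps)
  then have co: "coef (CupAt i u) x p = (if x = 0 then 1 else 0)" for x by simp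
  have "color v r (below (CupAt i u) 0 p) = c" if "r < length v" for r
  proof (cases "r < i")
    case True
    have "coef (CupAt i u) 0 p \<noteq> 0" using co[of 0] by (simp del: coef.simps)
    from color_Cup(2)[OF i True this] show ?thesis using g[of r] that i by (simp add: CupAt del: below.simps)
  next
    case False
    then show ?thesis using color_Cup(3)[OF i, of r u 0 p] g[of "Suc (Suc r)"] that i by (simp add: CupAt del: below.simps)
  qed
  then show ?thesis unfolding CupAt co by (simp add: sum_3 del: below.simps coef.simps)
next
  case (CapAt i)
  then have i: "Suc i < length v" "v ! i \<noteq> v ! Suc i" using fits by auto
  define y where "y = (if v ! i then p !! i + c else p !! i - c)"
  have ci: "color v i (below (CapAt i) x p) = c \<longleftrightarrow> x = y" for x
    by (auto simp: color_def y_def below_Cap_snth algebra_simps simp del: below.simps snth.simps)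
  have "(\<forall>r<length v. color v r (below (CapAt i) x p) = c) \<longleftrightarrow> x = y" for x
  proof
    assume "\<forall>r<length v. color v r (below (CapAt i) x p) = c"
    moreover have "i < length v" using i by simp
    ultimately show "x = y" using ci by blast
  next
    assume xy: "x = y"
    show "\<forall>r<length v. color v r (below (CapAt i) x p) = c"
    proof (intro allI impI)
      fix r assume r: "r < length v"
      consider "r < i" | "r = i" | "r = Suc i" | "r = Suc (Suc (r - 2))" "i \<le> r - 2" by linarith
      then show "color v r (below (CapAt i) x p) = c"
      proof cases
        case 1
        then show ?thesis using color_Cap(2)[OF i 1, of p x] g[of r] i by (simp add: CapAt del: below.simps)
      next
        case 2
        then show ?thesis using ci xy by simp
      next
        case 3
        then show ?thesis using ci[of x] xy color_Cap(1)[OF i, of x p] by simp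
      next
        case 4
        then have "r - 2 < length (next_row (CapAt i) v)" using r i by simp
        then show ?thesis using color_Cap(3)[OF i 4(2), of p x] g[of "r - 2"] 4(1) by (simp add: CapAt del: below.simps)
      qed
    qed
  qed
  then show ?thesis unfolding CapAt by (simp del: below.simps)
next
  case (CrossAt i b)
  then have i: "Suc i < length v" using fits by simp
  have len: "length (next_row (CrossAt i b) v) = length v" using i by simp
  have "color v r (below (CrossAt i b) 0 p) = c" if "r < length v" for r
    using color_Cross(1,2)[OF i, of b 0 p] color_Cross(3)[OF i, of r b 0 p] g[of r] g[of i] g[of "Suc i"] that i len
    by (cases "r = i"; cases "r = Suc i") (simp_all add: CrossAt del: below.simps next_row.simps)
  moreover have "p !! (i + 1) - p !! i = (if v ! Suc i then c else - c)"
    "p !! (i + 2) - p !! (i + 1) = (if v ! i then c else - c)"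
  proof -
    have aux: "x = (if a then c else - c)" if "(if a then x else - x) = c" for a x
      using that by auto
    have "color (next_row sl v) i p = c" "color (next_row sl v) (Suc i) p = c"
      using g[of i] g[of "Suc i"] i len by (simp_all add: CrossAt del: next_row.simps)
    note this[unfolded CrossAt color_def nth_next_row_Cross(2,3)[OF i]]
    from this[THEN aux] show "p !! (i + 1) - p !! i = (if v ! Suc i then c else - c)"
      "p !! (i + 2) - p !! (i + 1) = (if v ! i then c else - c)"
      by (simp_all only: add_2_eq_Suc' Suc_eq_plus1[symmetric])
  qed
  then have "(p !! (i + 1) - p !! i) * (p !! (i + 2) - p !! (i + 1)) = (if v ! i = v ! Suc i then 1 else - 1)"
    using c by (simp del: snth.simps)
  then have "coef (CrossAt i b) x p = (if x = 0 then (q0 ^ 4) powi crossing_sign sl v else 0)" for x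
    unfolding CrossAt coef.simps by (auto simp: braid_phase_values power_int_minus simp del: snth.simps)
  ultimately show ?thesis unfolding CrossAt by (simp add: sum_3 del: below.simps coef.simps)
qed

lemma state_sum_all:
  assumes D: "link_diagram D" and c: "c * c = 1" and "j \<le> length D"
  shows "state_sum (color_weight D c (points D)) D j p = (if \<forall>r<length (row D j). color (row D j) r p = c
    then (q0 ^ 4) powi (\<Sum>k<j. crossing_sign (D ! k) (row D k)) else 0)"
  using assms(3)
proof (induction j arbitrary: p)
  case (Suc j)
  then have j: "j < length D" by simp
  have fits: "fits (D ! j) (row D j)" using D j by (simp add: link_diagram_def)
  have good: "good D c (points D) (Suc j) p \<longleftrightarrow> (\<forall>r<length (row D (Suc j)). color (row D (Suc j)) r p = c)"
    using Suc.prems by (auto simp: good_def points_def)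
  have nz: "q0 ^ 4 \<noteq> 0" by simp
  show ?case
    unfolding state_sum_Wc_Suc good Suc.IH[OF less_imp_le[OF j]]
    using sum_slice_good[OF fits c, of p] nz
    by (auto simp: row_Suc[OF j] power_int_add mult.commute)
qed simp

text \<open>The weight at one point enters every term exactly once, so the sum is linear in it. This
  separates the differences 1 and 2 that the projection admits.\<close>

lemma state_sum_split:
  assumes b: "r0 < length (row D j0)"
    and W: "\<And>v. W (j0, r0) v = W1 (j0, r0) v + W2 (j0, r0) v"
    and eq: "\<And>x v. x \<noteq> (j0, r0) \<Longrightarrow> W1 x v = W x v" "\<And>x v. x \<noteq> (j0, r0) \<Longrightarrow> W2 x v = W x v"
    and "j0 \<le> j"
  shows "state_sum W D j p = state_sum W1 D j p + state_sum W2 D j p"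
  using assms(5)
proof (induction j arbitrary: p rule: dec_induct)
  case base
  obtain j where j: "j0 = Suc j" using b by (cases j0) auto
  have "state_sum W1 D j = state_sum W D j" "state_sum W2 D j = state_sum W D j"
    using eq j by (auto intro!: state_sum_cong)
  moreover have "(\<Prod>r<length (row D j0). W (j0, r) (f r)) =
      (\<Prod>r<length (row D j0). W1 (j0, r) (f r)) + (\<Prod>r<length (row D j0). W2 (j0, r) (f r))" for f
  proof -
    have r0: "finite {..<length (row D j0)}" "r0 \<in> {..<length (row D j0)}" using b by auto
    have "(\<Prod>r\<in>{..<length (row D j0)} - {r0}. W1 (j0, r) (f r)) = (\<Prod>r\<in>{..<length (row D j0)} - {r0}. W (j0, r) (f r))"
      "(\<Prod>r\<in>{..<length (row D j0)} - {r0}. W2 (j0, r) (f r)) = (\<Prod>r\<in>{..<length (row D j0)} - {r0}. W (j0, r) (f r))"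
      using eq by (auto intro!: prod.cong)
    then show ?thesis
      unfolding prod.remove[OF r0] by (simp add: W distrib_right)
  qed
  ultimately show ?case unfolding j by (simp add: distrib_right)
next
  case (step j)
  have "W1 (Suc j, r) v = W (Suc j, r) v" "W2 (Suc j, r) v = W (Suc j, r) v" for r v
    using eq step by auto
  then show ?case by (simp add: step.IH distrib_left sum.distrib)
qed

theorem potts_knot:
  assumes D: "knot_diagram D" and b: "b \<in> points D" and s: "s * s = q0"
  shows "potts (cabling 2 s f2 D {b}) 0 (\<lambda>p. 1) = (\<lambda>p. 2 * (q0 ^ 4) powi writhe D)"
proof
  fix p
  have L: "link_diagram D" using D by (simp add: knot_diagram_def)
  obtain j0 r0 where b0: "b = (j0, r0)" by fastforce
  then have jr: "j0 \<le> length D" "r0 < length (row D j0)" using b by (auto simp: points_def)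
  have row: "row D (length D) = []" using L by (simp add: link_diagram_def)
  have val: "state_sum (color_weight D c {b}) D (length D) p = (q0 ^ 4) powi writhe D" if "c * c = 1" for c
    unfolding propagate_all[OF D b] using state_sum_all[OF L that, of "length D" p] row by (simp add: writhe_def)
  have "potts (cabling 2 s f2 D {b}) 0 (\<lambda>p. 1) p = state_sum (\<lambda>x v. if x \<in> {b} then (if v = 0 then 0 else 1) else 1) D (length D) p"
    unfolding cabling_def potts_cabled_part[OF s] ..
  also have "\<dots> = state_sum (color_weight D 1 {b}) D (length D) p + state_sum (color_weight D 2 {b}) D (length D) p"
  proof (rule state_sum_split[OF jr(2)])
    fix v :: 3
    show "(if (j0, r0) \<in> {b} then if v = 0 then 0 else 1 else 1) = color_weight D 1 {b} (j0, r0) v + color_weight D 2 {b} (j0, r0) v"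
      by (rule exhaust_3'[of v]) (simp_all add: color_weight_def b0 numerals_3)
  qed (use jr b0 in \<open>auto simp: color_weight_def\<close>)
  also have "\<dots> = 2 * (q0 ^ 4) powi writhe D" by (simp add: val)
  finally show "potts (cabling 2 s f2 D {b}) 0 (\<lambda>p. 1) p = 2 * (q0 ^ 4) powi writhe D" .
qed

section \<open>Cabled diagrams as tangles\<close>

lemma crossing_type [simp]: "typed K (crossing s b)" "bots (crossing s b) = 2" "tops (crossing s b) = 2"
  by (simp_all add: crossing_def)

lemma cross_one_type:
  "typed K X \<Longrightarrow> bots X = 2 \<Longrightarrow> tops X = 2 \<Longrightarrow>
    typed K (cross_one X k) \<and> bots (cross_one X k) = Suc k \<and> tops (cross_one X k) = Suc k"
  by (induction k) auto

lemma cross_cables_type: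
  "typed K X \<Longrightarrow> bots X = 2 \<Longrightarrow> tops X = 2 \<Longrightarrow>
    typed K (cross_cables X l k) \<and> bots (cross_cables X l k) = l + k \<and> tops (cross_cables X l k) = l + k"
  by (induction l) (auto simp: cross_one_type)

lemma cabled_slice_type:
  assumes "fits sl v"
  shows "typed K (cabled_slice k s sl v) \<and> bots (cabled_slice k s sl v) = k * length v \<and>
    tops (cabled_slice k s sl v) = k * length (next_row sl v)"
proof (cases sl)
  case (CupAt i u)
  then have "length v = i + (length v - i)" using assms by simp
  then obtain m where "length v = i + m" by blast
  then show ?thesis using CupAt by (simp add: algebra_simps)
next
  case (CapAt i)
  then obtain m where "length v = i + 2 + m" using assms by (auto simp: less_iff_Suc_add)
  then show ?thesis using CapAt by (simp add: algebra_simps)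
next
  case (CrossAt i b)
  then obtain m where "length v = i + 2 + m" using assms by (auto simp: less_iff_Suc_add)
  then show ?thesis using CrossAt cross_cables_type[of K "crossing s b" k k] by (simp add: algebra_simps)
qed

lemma half_turn_type:
  "typed K p \<Longrightarrow> bots p = k \<Longrightarrow> tops p = k \<Longrightarrow>
    typed K (half_turn k p) \<and> bots (half_turn k p) = k \<and> tops (half_turn k p) = k"
  by (simp add: half_turn_def)

lemma foldr_tens_type:
  "(\<And>t. t \<in> set ts \<Longrightarrow> typed K t \<and> bots t = k \<and> tops t = k) \<Longrightarrow>
    typed K (foldr (\<otimes>) ts (Strands 0)) \<and> bots (foldr (\<otimes>) ts (Strands 0)) = k * length ts
      \<and> tops (foldr (\<otimes>) ts (Strands 0)) = k * length ts"
  by (induction ts) auto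

lemma cabled_row_type:
  assumes "typed K p" "bots p = k" "tops p = k"
  shows "typed K (cabled_row k p D B j) \<and> bots (cabled_row k p D B j) = k * length (row D j) \<and>
    tops (cabled_row k p D B j) = k * length (row D j)"
proof -
  let ?ts = "map (\<lambda>r. if (j, r) \<in> B then if row D j ! r then p else half_turn k p else Strands k)
      [0..<length (row D j)]"
  have "typed K t \<and> bots t = k \<and> tops t = k" if "t \<in> set ?ts" for t
    using that half_turn_type[OF assms] assms by (auto split: if_splits)
  from foldr_tens_type[of ?ts, OF this]
  show ?thesis unfolding cabled_row_def by simp
qed

lemma cabled_part_type:
  assumes "link_diagram D" "typed K p" "bots p = k" "tops p = k"
  shows "j \<le> length D \<Longrightarrow> typed K (cabled_part k s p D B j) \<and> bots (cabled_part k s p D B j) = 0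
    \<and> tops (cabled_part k s p D B j) = k * length (row D j)"
proof (induction j)
  case (Suc j)
  then have "fits (D ! j) (row D j)" using assms(1) by (simp add: link_diagram_def)
  then show ?case
    using Suc cabled_slice_type[of "D ! j" "row D j" K k s] cabled_row_type[OF assms(2-), of D B "Suc j"]
    by (simp add: row_Suc)
qed simp

lemma cabled_row_without:
  assumes "\<And>r. (j, r) \<notin> B"
  shows "cabled_row k p D B j = cabled_row k p' D B j"
  using assms by (simp add: cabled_row_def)

lemma cabled_part_before:
  assumes "\<And>i r. i \<le> j \<Longrightarrow> (i, r) \<notin> B"
  shows "cabled_part k s p D B j = cabled_part k s p' D B j"
  using assms
proof (induction j)
  case (Suc j)
  then show ?case using cabled_row_without[of "Suc j" B k p D p'] by simp
qed simp

context skein begin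

lemma cls_foldr:
  assumes "typed K t"
  shows "cls (foldr (\<otimes>) (replicate a (Strands k) @ t # replicate b (Strands k)) (Strands 0)) = w (k * a) (cls t) (k * b)"
proof -
  have "cls (foldr (\<otimes>) (replicate b (Strands k)) (Strands 0)) = S (k * b)"
    by (induction b) (simp_all add: cls_tens S_tens_S)
  then have 0: "cls (foldr (\<otimes>) (t # replicate b (Strands k)) (Strands 0)) = w 0 (cls t) (k * b)"
    using assms by (simp add: cls_tens w_0_left ok_cls)
  show ?thesis
  proof (induction a)
    case (Suc a)
    have "S k \<boxtimes> w (k * a) (cls t) (k * b) = w k (w (k * a) (cls t) (k * b)) 0"
      using assms by (simp add: w_0_right ok_cls)
    then show ?case using Suc assms by (simp add: cls_tens ok_cls)
  qed (use 0 in simp)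
qed

lemma cls_cabled_row:
  assumes p: "typed K p" "bots p = k" "tops p = k" and r0: "r0 < length (row D j0)"
  shows "cls (cabled_row k p D {(j0, r0)} j0) =
    w (k * r0) (cls (if row D j0 ! r0 then p else half_turn k p)) (k * (length (row D j0) - Suc r0))"
proof -
  let ?t = "if row D j0 ! r0 then p else half_turn k p" and ?n = "length (row D j0)"
  have "map (\<lambda>r. if (j0, r) \<in> {(j0, r0)} then if row D j0 ! r then p else half_turn k p else Strands k) [0..<?n]
    = replicate r0 (Strands k) @ ?t # replicate (?n - Suc r0) (Strands k)"
    using r0 by (intro nth_equalityI) (auto simp: nth_append nth_Cons')
  then show ?thesis
    unfolding cabled_row_def using cls_foldr[of ?t r0 k] half_turn_type[OF p] p by simp
qed

lemma cls_half_turn: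
  assumes p: "typed K p" "bots p = k" "tops p = k"
  shows "cls (half_turn k p) = w k (cls (nested_caps k)) 0 \<star> w k (cls p) k \<star> w 0 (cls (nested_cups k)) k"
  using p by (simp add: half_turn_def cls_comp comp_assoc ok_cls cls_tens w_0_left w_0_right w_def[of k _ k] tens_assoc)

text \<open>The contexts are box-free and chosen before \<open>p\<close>, so linear relations
  between inserted tangles carry over to the cablings.\<close>

lemma cabled_part_context:
  assumes D: "link_diagram D" and r0: "r0 < length (row D j0)" and "j0 \<le> j" "j \<le> length D"
  shows "\<exists>a c i l. TL a \<and> TL c \<and> dm c = 0 \<and> cd c = i + k + l \<and> dm a = i + k + l \<and> cd a = k * length (row D j) \<and>
    (\<forall>p. typed K p \<longrightarrow> bots p = k \<longrightarrow> tops p = k \<longrightarrow>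
      cls (cabled_part k s p D {(j0, r0)} j) = a \<star> w i (cls p) l \<star> c)"
  using assms(3,4)
proof (induction j rule: dec_induct)
  case base
  obtain j where j: "j0 = Suc j" using r0 by (cases j0) auto
  have fits: "fits (D ! j) (row D j)" using D base j by (simp add: link_diagram_def)
  define m where "m = length (row D j0) - Suc r0"
  have len: "k * length (row D j0) = k * r0 + k + k * m"
    using r0 unfolding m_def by (metis add_mult_distrib2 less_iff_Suc_add add_Suc_right diff_add_inverse add.commute mult_Suc_right add.left_commute add_Suc)
  \<comment> \<open>Nothing is inserted below the row of the base point, so \<open>Strands k\<close>
    can stand in for \<open>p\<close> there.\<close>
  define C where "C = cls (cabled_slice k s (D ! j) (row D j) \<odot> cabled_part k s (Strands k) D {(j0, r0)} j)"
  have tyC: "typed K' (cabled_slice k s (D ! j) (row D j) \<odot> cabled_part k s (Strands k) D {(j0, r0)} j)" for K'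
    using cabled_slice_type[OF fits, of K' k s] cabled_part_type[OF D, of K' "Strands k" k j] base j by simp
  have C [simp]: "TL C" "ok C" "dm C = 0" "cd C = k * length (row D j0)"
    unfolding C_def using tyC cabled_slice_type[OF fits, of K k s] cabled_part_type[OF D, of K "Strands k" k j s "{(j0, r0)}"] base j
    by (auto intro: TL_cls ok_cls simp: row_Suc)
  have part: "cls (cabled_part k s p D {(j0, r0)} j0) =
      w (k * r0) (cls (if row D j0 ! r0 then p else half_turn k p)) (k * m) \<star> C"
    if p: "typed K p" "bots p = k" "tops p = k" for p
  proof -
    have "cabled_part k s p D {(j0, r0)} j = cabled_part k s (Strands k) D {(j0, r0)} j"
      using j by (intro cabled_part_before) auto
    then have "cls (cabled_part k s p D {(j0, r0)} j0) = (cls (cabled_row k p D {(j0, r0)} j0)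
      \<star> cls (cabled_slice k s (D ! j) (row D j))) \<star> cls (cabled_part k s (Strands k) D {(j0, r0)} j)"
      using j by (simp add: cls_comp)
    also have "\<dots> = cls (cabled_row k p D {(j0, r0)} j0) \<star> C"
      unfolding C_def cls_comp
      using cabled_slice_type[OF fits, of K k s] cabled_part_type[OF D, of K "Strands k" k j s "{(j0, r0)}"]
        cabled_row_type[OF p, of D "{(j0, r0)}" j0] base j
      by (intro comp_assoc) (auto intro: ok_cls)
    finally show ?thesis unfolding cls_cabled_row[OF p r0] m_def .
  qed
  show ?case
  proof (cases "row D j0 ! r0")
    case True
    show ?thesis
      by (rule exI[of _ "S (k * r0 + k + k * m)"], rule exI[of _ C], rule exI[of _ "k * r0"], rule exI[of _ "k * m"])
        (use part len True in \<open>simp add: ok_cls\<close>)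
  next
    case False
    \<comment> \<open>On a downward strand the caps and cups of the half turn are moved into the
      contexts.\<close>
    have ty: "ok (cls (nested_caps k))" "ok (cls (nested_cups k))" "TL (cls (nested_caps k))" "TL (cls (nested_cups k))"
      by (auto intro: ok_cls TL_cls)
    have "cls (cabled_part k s p D {(j0, r0)} j0) = w (k * r0 + k) (cls (nested_caps k)) (k * m)
      \<star> w (k * r0 + k) (cls p) (k + k * m) \<star> w (k * r0) (cls (nested_cups k)) (k + k * m) \<star> C"
      if p: "typed K p" "bots p = k" "tops p = k" for p
      using part[OF p] False p ty len by (simp add: cls_half_turn w_comp comp_assoc ok_cls)
    then have "\<forall>p. typed K p \<longrightarrow> bots p = k \<longrightarrow> tops p = k \<longrightarrow> cls (cabled_part k s p D {(j0, r0)} j0) =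
      w (k * r0 + k) (cls (nested_caps k)) (k * m) \<star> w (k * r0 + k) (cls p) (k + k * m)
      \<star> w (k * r0) (cls (nested_cups k)) (k + k * m) \<star> C" by blast
    note * = this
    show ?thesis
      by (rule exI[of _ "w (k * r0 + k) (cls (nested_caps k)) (k * m)"],
          rule exI[of _ "w (k * r0) (cls (nested_cups k)) (k + k * m) \<star> C"],
          rule exI[of _ "k * r0 + k"], rule exI[of _ "k + k * m"])
        (use * ty len in simp)
  qed
next
  case (step j)
  then obtain a c i l where IH: "TL a" "TL c" "dm c = 0" "cd c = i + k + l" "dm a = i + k + l"
      "cd a = k * length (row D j)"
      "\<And>p. typed K p \<Longrightarrow> bots p = k \<Longrightarrow> tops p = k \<Longrightarrow>
        cls (cabled_part k s p D {(j0, r0)} j) = a \<star> w i (cls p) l \<star> c"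
    by auto
  have fits: "fits (D ! j) (row D j)" using D step by (simp add: link_diagram_def)
  define A where "A = cabled_row k (Strands k) D {(j0, r0)} (Suc j) \<odot> cabled_slice k s (D ! j) (row D j)"
  have A: "typed K' A" "bots A = k * length (row D j)" "tops A = k * length (row D (Suc j))" for K'
    unfolding A_def
    using cabled_slice_type[OF fits, of K' k s] cabled_row_type[of K' "Strands k" k D "{(j0, r0)}" "Suc j"] step
    by (simp_all add: row_Suc)
  have ok: "ok a" "ok c" using IH TL_ok by blast+
  have "cls (cabled_part k s p D {(j0, r0)} (Suc j)) = (cls A \<star> a) \<star> w i (cls p) l \<star> c"
    if p: "typed K p" "bots p = k" "tops p = k" for p
  proof -
    have "cabled_row k p D {(j0, r0)} (Suc j) = cabled_row k (Strands k) D {(j0, r0)} (Suc j)"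
      using step by (intro cabled_row_without) auto
    then have "cls (cabled_part k s p D {(j0, r0)} (Suc j)) = cls A \<star> (a \<star> w i (cls p) l \<star> c)"
      using IH(7)[OF p] by (simp add: A_def cls_comp)
    then show ?thesis using IH A ok p by (simp add: comp_assoc ok_cls)
  qed
  note * = this
  show ?case
    by (rule exI[of _ "cls A \<star> a"], rule exI[of _ c], rule exI[of _ i], rule exI[of _ l])
      (use * IH(1-6) A ok TL_cls[OF A(1)] in \<open>simp add: ok_cls del: cabled_part.simps\<close>)
qed

end

section \<open>Values of the cabled knot in both skein theories\<close>

lemma skein_valueI:
  assumes "skein_eq K d R t (c \<cdot> Strands 0)"
    and sound: "\<And>t u. skein_eq K d R t u \<Longrightarrow> potts t 0 = potts u 0"
  shows "skein_value K d R t = c" "potts t 0 (\<lambda>p. 1) p = c"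
proof -
  show "potts t 0 (\<lambda>p. 1) p = c" using sound[OF assms(1)] by simp
  \<comment> \<open>A multiple of the empty diagram acts by its scalar, which is read off at the
    constant function 1.\<close>
  have "c' = c" if "skein_eq K d R t (c' \<cdot> Strands 0)" for c'
  proof -
    have "potts (c' \<cdot> Strands 0) 0 = potts (c \<cdot> Strands 0) 0" using sound[OF assms(1)] sound[OF that] by simp
    from fun_cong[OF fun_cong[OF this, of "\<lambda>p. 1"]] show ?thesis by simp
  qed
  then show "skein_value K d R t = c"
    unfolding skein_value_def using assms(1) by (rule the_equality[rotated])
qed

lemma q_D_2: "q_D 2 = q0"
  by (simp add: q0_def)

lemma base_points_knot:
  assumes "knot_diagram D" "base_points D B"
  obtains j r where "B = {(j, r)}" "(j, r) \<in> points D" "j \<le> length D" "r < length (row D j)"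
proof -
  let ?E = "(arcs D \<union> (arcs D)\<inverse>)\<^sup>*"
  obtain C where C: "components D = {C}"
    using assms by (auto simp: knot_diagram_def card_1_singleton_iff)
  have "points D \<subseteq> C"
  proof
    fix x assume "x \<in> points D"
    then have "?E `` {x} \<in> components D" unfolding components_def by (rule quotientI)
    then show "x \<in> C" using C by auto
  qed
  then have "B \<inter> C = B" using assms by (auto simp: base_points_def)
  moreover have "\<exists>!x. x \<in> B \<inter> C" using assms(2) C by (simp add: base_points_def)
  ultimately have "\<exists>!x. x \<in> B" by simp
  then obtain b where "B = {b}" by blast
  moreover have "b \<in> points D" using assms(2) \<open>B = {b}\<close> by (auto simp: base_points_def)
  ultimately show ?thesis using that[of "fst b" "snd b"] by (auto simp: points_def)
qed

text \<open>Normal forms provide some scalar, and the Potts operator tells which one it is.\<close>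

lemma TL_value_knot:
  assumes D: "knot_diagram D" and b: "(j, r) \<in> points D" and s: "s * s = q0"
  shows "TL_value q0 (cabling 2 s f2 D {(j, r)}) = 2 * (q0 ^ 4) powi writhe D"
proof -
  let ?t = "cabling 2 s f2 D {(j, r)}"
  have L: "link_diagram D" using D by (simp add: knot_diagram_def)
  then have t: "typed {} ?t" "bots ?t = 0" "tops ?t = 0"
    using cabled_part_type[OF L f2_type, of "length D" s "{(j, r)}"]
    by (auto simp: cabling_def link_diagram_def)
  interpret skein "{}" "q0 + inverse q0" "{}" .
  have "span 0 0 (cls ?t)"
    using TL_span[OF TL_cls[OF t(1)]] t by simp
  then obtain c where "cls ?t = cls (c \<cdot> Strands 0)"
    using span_closed by (auto simp: cls_scale)
  then have eq: "TL_eq q0 ?t (c \<cdot> Strands 0)" using cls_eq_iff[OF t(1)] by simp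
  have sound: "TL_eq q0 t u \<Longrightarrow> potts t 0 = potts u 0" for t u
    unfolding q0_sum by (rule potts_sound) auto
  show ?thesis
    using skein_valueI[OF eq sound] potts_knot[OF D b s] by simp
qed

lemma (in one_box) cabling_P:
  assumes L: "link_diagram D" and jr: "j \<le> length D" "r < length (row D j)"
  shows "\<exists>z. cabling 2 s (P_D 2) D {(j, r)} \<approx> (z / 2) \<cdot> Strands 0 \<and>
    cabling 2 s f2 D {(j, r)} \<approx> z \<cdot> Strands 0"
proof -
  let ?t = "\<lambda>p. cabling 2 s p D {(j, r)}"
  have row: "row D (length D) = []" using L by (simp add: link_diagram_def)
  obtain a c i l where ac: "TL a" "TL c" "dm c = 0" "cd c = i + 2 + l" "dm a = i + 2 + l" "cd a = 0"
    and cab: "\<And>p. typed K p \<Longrightarrow> bots p = 2 \<Longrightarrow> tops p = 2 \<Longrightarrow> cls (?t p) = a \<star> w i (cls p) l \<star> c"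
    using cabled_part_context[OF L jr(2,1) order_refl, of 2 s] row by (auto simp: cabling_def)
  have ok: "ok a" "ok c" using ac TL_ok by blast+
  have f2K: "typed K f2" using typed_mono[OF f2_type(1)] .
  have TLf2: "TL (cls f2)" "ok (cls f2)" using f2_type f2K by (auto intro: TL_cls ok_cls)
  have S_end: "typed K (S_end 2)" "bots (S_end 2) = 2" "tops (S_end 2) = 2"
    using K4 by (simp_all add: S_end_def S_up_def)
  have P: "typed K (P_D 2)" "bots (P_D 2) = 2" "tops (P_D 2) = 2"
    using S_end f2K f2_type by (simp_all add: P_D_def q_D_2)
  have "span 0 0 (a \<star> w i (cls f2) l \<star> c)"
    using TL_span[of "a \<star> w i (cls f2) l \<star> c"] ac ok TLf2 f2_type f2K by simp
  from span_closed[OF this] obtain z where z: "cls (?t f2) = z \<bullet> S 0"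
    using cab[OF f2K] f2_type by auto
  \<comment> \<open>Moving the caps of \<open>S_end\<close> into the context leaves a box with all
    four strands up, the case \<open>x = 4\<close>, \<open>y = 0\<close> of
    \<open>one_box_vanishes\<close>.\<close>
  have "a \<star> w i (cls (S_end 2)) l \<star> c = Z 0 0"
  proof -
    have B0: "ok (B 0)" "dm (B 0) = 0" "cd (B 0) = 4" using B_type[of 4 0] by auto
    have n: "ok (cls (nested_caps 2))" "TL (cls (nested_caps 2))" by (auto intro: ok_cls TL_cls)
    have "cls (S_end 2) = w 2 (cls (nested_caps 2)) 0 \<star> w 0 (B 0) 2"
      using K4 by (simp add: S_end_def S_up_def cls_comp cls_tens w_0_left w_0_right ok_cls B.simps)
    then have "w i (cls (S_end 2)) l = w (i + 2) (cls (nested_caps 2)) l \<star> w i (B 0) (2 + l)"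
      using n B0 by (simp add: w_comp)
    then have "a \<star> w i (cls (S_end 2)) l \<star> c =
      (a \<star> w (i + 2) (cls (nested_caps 2)) l) \<star> w i (B 0) (2 + l) \<star> c"
      using ac ok n B0 by (simp add: comp_assoc)
    also have "\<dots> = Z 0 0"
      by (rule one_box_vanishes[of 4 0]) (use ac ok n B0 in simp_all)
    finally show ?thesis .
  qed
  moreover have "cls (P_D 2) = (1 / 2) \<bullet> (cls f2 \<boxplus> cls (S_end 2))"
    by (simp add: P_D_def q_D_2 cls_scale cls_plus)
  ultimately have "cls (?t (P_D 2)) = (1 / 2) \<bullet> (cls (?t f2) \<boxplus> Z 0 0)"
    using cab[OF P] cab[OF f2K] f2_type f2K S_end ac ok
    by (simp add: ok_cls w_plus plus_comp comp_plus scale_plus)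
  then have "cls (?t (P_D 2)) = cls ((z / 2) \<cdot> Strands 0)"
    unfolding z by (simp add: cls_scale)
  moreover have "typed K (?t p)" if "typed K p" "bots p = 2" "tops p = 2" for p
    using cabled_part_type[OF L that, of "length D" s "{(j, r)}"] by (simp add: cabling_def)
  note ty = this[OF P] this[OF f2K f2_type(2,3)]
  ultimately have "?t (P_D 2) \<approx> (z / 2) \<cdot> Strands 0"
    using cls_eq_iff[OF ty(1)] by simp
  moreover have "?t f2 \<approx> z \<cdot> Strands 0"
    using z cls_eq_iff[OF ty(2), of "z \<cdot> Strands 0"] by (simp add: cls_scale)
  ultimately show ?thesis by blast
qed

lemma one_box_D: "one_box {4 * 2 - 4} (qnum (q_D 2) 2) (D_relations 2)"
proof
  let ?K = "{4 * 2 - 4 :: nat}"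
  have "(bend 4 (Box 4), \<i> \<cdot> Box 4) \<in> D_relations 2" by (simp add: D_relations_def S_up_def)
  moreover have "typed ?K (bend 4 (Box 4))" "bots (bend 4 (Box 4)) = 0" "tops (bend 4 (Box 4)) = 4"
    using bend_type[of ?K "Box 4" 4] by auto
  ultimately show "D_eq 2 (bend 4 (Box 4)) (\<i> \<cdot> Box 4)"
    by (intro relation[where a = 0 and b = 4]) (auto simp: hom_iff)
next
  fix i j :: nat assume ij: "i + 2 + j = 4"
  then have "((Strands i \<otimes> Cap \<otimes> Strands j) \<odot> Box 4, Zero 0 (i + j)) \<in> D_relations 2"
    by (auto simp: D_relations_def S_up_def)
  then show "D_eq 2 ((Strands i \<otimes> Cap \<otimes> Strands j) \<odot> Box 4) (Zero 0 (i + j))"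
    by (rule relation[where a = 0 and b = "i + j"]) (use ij in \<open>auto simp: hom_iff\<close>)
qed simp

text \<open>The scalar \<open>z\<close> of the cabling with \<open>f2\<close> is read off within
  this skein theory, by the soundness of the Potts model for it; \<open>P\<close> contributes half
  of it.\<close>

lemma D_value_knot:
  assumes D: "knot_diagram D" and b: "(j, r) \<in> points D" and s: "s * s = q0"
  shows "D_value 2 (cabling 2 s (P_D 2) D {(j, r)}) = (q0 ^ 4) powi writhe D"
proof -
  have L: "link_diagram D" using D by (simp add: knot_diagram_def)
  have jr: "j \<le> length D" "r < length (row D j)" using b by (auto simp: points_def)
  obtain z where z: "D_eq 2 (cabling 2 s (P_D 2) D {(j, r)}) ((z / 2) \<cdot> Strands 0)"
    "D_eq 2 (cabling 2 s f2 D {(j, r)}) (z \<cdot> Strands 0)"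
    using one_box.cabling_P[OF one_box_D L jr, of s] by blast
  have "z = 2 * (q0 ^ 4) powi writhe D"
    using skein_valueI(2)[OF z(2) D_sound] potts_knot[OF D b s] by simp
  then show ?thesis using skein_valueI(1)[OF z(1) D_sound] by simp
qed

theorem theorem3p3:
  fixes D :: diagram and B :: "(nat \<times> nat) set" and s :: complex
  assumes "knot_diagram D" and "base_points D B"
    and "s\<^sup>2 = exp (2 * of_real pi * \<i> / 12)"
  shows "J_sl2 2 s D B = 2 * J_D_P 2 s D B \<and> 2 * J_D_P 2 s D B = 2"
proof -
  obtain j r where B: "B = {(j, r)}" "(j, r) \<in> points D"
    using base_points_knot[OF assms(1,2)] by metis
  have s2: "s\<^sup>2 = q0" using assms(3) by (simp add: q0_exp)
  then have s: "s * s = q0" by (simp add: power2_eq_square)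
  \<comment> \<open>The two framing factors agree: the fourth power of \<i> is 1, and
    \<open>s ^ 8\<close> and \<open>q_D n ^ (2 * n * (n - 1))\<close> for \<open>n = 2\<close> are
    both \<open>q0 ^ 4\<close>.\<close>
  have "s ^ 8 = (s\<^sup>2) ^ 4" by (simp flip: power_mult)
  then have framing: "\<i> ^ 2\<^sup>2 * s ^ (2\<^sup>2 + 2 * 2) = q0 ^ 4" by (simp add: s2)
  have "(q0 ^ 4) powi - writhe D * (q0 ^ 4) powi writhe D = 1"
    by (simp add: power_int_minus)
  then have "J_sl2 2 s D B = 2" "J_D_P 2 s D B = 1"
    unfolding J_sl2_def J_D_P_def B framing s2 q_D_2
    using TL_value_knot[OF assms(1) B(2) s] D_value_knot[OF assms(1) B(2) s] by (simp_all add: q_D_2)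
  then show ?thesis by simp
qed

end
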